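(* Let $M$ be an oriented smooth $4$-manifold with a Riemannian metric $g$ and a compatible almost-complex structure $J$ with fundamental form $\omega$, and let $\varphi\in\Gamma(\mathcal{W}^{+})$ be a nowhere-zero self-dual spinor field of the induced $Spin^{\mathbb{C}}$-structure. Then the form $\sigma(\varphi)=\tfrac14\varphi^{*}\omega$ is symplectic if and only if there is a unitary connection $A$ on $K^{*}$ that simultaneously minimizes $\mathcal{B}^{A}\varphi$, $\mathrm{Alt}\,\mathcal{B}^{A}\varphi$, $\mathrm{Sym}\,\mathcal{B}^{A}\varphi$ and $\mathcal{D}^{A}\varphi$ (point-wise, among all unitary connections on $K^*$).
   Context: Compatible means $J$ is $g$-orthogonal and induces the orientation; $\omega(v,w)=g(Jv,w)$ and $(\varphi^*\omega)(v,w)=\omega(\varphi v,\varphi w)$. $\nabla$ is the Levi-Civita connection of $g$ and $K^*=\det_{\mathbb{C}}(T_M,J)$. Symplectic means non-degenerate and closed. For the $Spin^{\mathbb{C}}$-structure induced by $J$, one identifies $\mathcal{W}^-=(T_M,J)$ and $\mathcal{W}^+=PSO^+(T_M)\subset\mathrm{Hom}(T_M,T_M)$, the rank-$4$ real bundle of fiber maps which, under an orientation-preserving isometry $T_M|_x\cong\mathbb{H}$ (oriented by $1,i,j,k$), are left multiplications by quaternions; complex structure $i\varphi=J\circ\varphi$; metric normalized by $g(\varphi v,\varphi w)=\|\varphi\|^2g(v,w)$. Clifford multiplication is $v\bullet\varphi=\varphi(v)$. Spinorial connections. In a U(2)-chart (local isometric orientation-preserving trivialization $T_M|_U\cong U\times\mathbb{H}$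 in which $J$ is left multiplication by $i$; it also trivializes $K^*$ by the frame $1\wedge_{\mathbb{C}}j$), write $\nabla v=\partial v+\mathfrak{a}_+v-v\,\mathfrak{a}_-$ with $\mathfrak{a}_\pm$ $\mathrm{Im}\,\mathbb{H}$-valued $1$-forms, and a unitary connection $A$ on $K^*$ as $Az=\partial z+2i\alpha z$ with $\alpha$ a real $1$-form. Then $\widetilde\nabla^{A}w=\partial w+i\alpha w-w\,\mathfrak{a}_-$ is the induced connection on $\mathcal{W}^-=T_M$, and the induced connection on $\mathcal{W}^+$ is $(\overline\nabla^{A}_X\varphi)(Y)=\widetilde\nabla^{A}_X(\varphi Y)-\varphi(\nabla_XY)$. $(\mathcal{B}^{A}\varphi)_XY=(\overline\nabla^{A}_X\varphi)(Y)$, a section of $T_M^*\otimes T_M^*\otimes T_M$; $(\mathrm{Alt}\,\mathcal{B}^A\varphi)_XY=\frac12((\mathcal{B}^A\varphi)_XY-(\mathcal{B}^A\varphi)_YX)$, $(\mathrm{Sym}\,\mathcal{B}^A\varphi)_XY=\frac12((\mathcal{B}^A\varphi)_XY+(\mathcal{B}^A\varphi)_YX)$, and $\mathcal{D}^A\varphi=\sum_k(\mathcal{B}^A\varphi)_{e_k}e_k$ ($g$-orthonormal frame) is the Dirac operator. "Minimizes" means that at every point $x$ the norm of the tensor at $x$ is minimal as $A$ varies over all unitary connections on $K^*$; norm on $T_M^*\otimes T_M^*\otimes T_M|_x$ from $\langle T_1,T_2\rangle=\sum_{j,k}g(T_1(e_j,e_k),T_2(e_j,e_k))$, and the $g$-norm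 for $\mathcal{D}^A\varphi$. *)

theory Defs
  imports "HOL-Analysis.Analysis"
begin

section \<open>Smooth functions on open subsets of Euclidean spaces\<close>

text \<open>The set \<open>S\<close> is always open in what follows.\<close>

primrec Ck_on ::
  "nat \<Rightarrow> 'a::euclidean_space set \<Rightarrow> ('a \<Rightarrow> 'b::real_normed_vector) \<Rightarrow> bool" where
  "Ck_on 0 S f \<longleftrightarrow> continuous_on S f"
| "Ck_on (Suc k) S f \<longleftrightarrow>
     (\<forall>p\<in>S. f differentiable (at p)) \<and>
     (\<forall>v. Ck_on k S (\<lambda>p. frechet_derivative f (at p) v))"

definition smooth_on ::
  "'a::euclidean_space set \<Rightarrow> ('a \<Rightarrow> 'b::real_normed_vector) \<Rightarrow> bool" where
  "smooth_on S f \<longleftrightarrow> (\<forall>k. Ck_on k S f)"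


section \<open>Oriented smooth 4-manifolds\<close>

type_synonym R4 = "real^4"

type_synonym 'm chart = "'m set \<times> ('m \<Rightarrow> R4)"

abbreviation cdom :: "'m chart \<Rightarrow> 'm set" where "cdom c \<equiv> fst c"

abbreviation coord :: "'m chart \<Rightarrow> 'm \<Rightarrow> R4" where "coord c \<equiv> snd c"

definition point :: "'m chart \<Rightarrow> R4 \<Rightarrow> 'm" where
  "point c = inv_into (cdom c) (coord c)"

definition is_chart :: "'m::topological_space chart \<Rightarrow> bool" where
  "is_chart c \<longleftrightarrow> open (cdom c) \<and> open (coord c ` cdom c) \<and>
     homeomorphism (cdom c) (coord c ` cdom c) (coord c) (point c)"

text \<open>
  An oriented smooth 4-manifold is a second countable Hausdorff space \<open>'m\<close> with an atlas whose
  transition maps are smooth and have positive Jacobian determinant; the atlas need not be maximal.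
\<close>

definition oriented_smooth_atlas ::
  "'m::{t2_space, second_countable_topology} chart set \<Rightarrow> bool" where
  "oriented_smooth_atlas \<A> \<longleftrightarrow>
     (\<forall>c\<in>\<A>. is_chart c) \<and> (\<Union>c\<in>\<A>. cdom c) = UNIV \<and>
     (\<forall>c\<in>\<A>. \<forall>d\<in>\<A>.
        smooth_on (coord c ` (cdom c \<inter> cdom d)) (coord d \<circ> point c) \<and>
        (\<forall>p \<in> coord c ` (cdom c \<inter> cdom d).
           0 < det (matrix (frechet_derivative (coord d \<circ> point c) (at p)))))"

text \<open>
  A tangent vector at \<open>x\<close> is an equivalence class of pairs (chart at \<open>x\<close>, vector of \<open>\<real>\<^sup>4\<close>) under the
  Jacobians of the transition maps. Every class has exactly one representative in the chart
  \<open>chart_at \<A> x\<close>, so the tangent space at every point is modelled on \<open>\<real>\<^sup>4\<close>. The map \<open>dcoord \<A> c x\<close>, the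
  differential at \<open>x\<close> of the chart \<open>c\<close>, gives the components of a tangent vector with respect to any other
  chart. As \<open>chart_at \<A> x\<close> may jump with \<open>x\<close>, smoothness of tensor fields must be, and is, expressed
  through components in the charts. Since the atlas is oriented, the standard orientation of \<open>\<real>\<^sup>4\<close> is
  the orientation of the tangent space.
\<close>

definition chart_at :: "'m chart set \<Rightarrow> 'm \<Rightarrow> 'm chart" where
  "chart_at \<A> x = (SOME c. c \<in> \<A> \<and> x \<in> cdom c)"

definition dcoord :: "'m chart set \<Rightarrow> 'm chart \<Rightarrow> 'm \<Rightarrow> R4 \<Rightarrow> R4" where
  "dcoord \<A> c x =
     frechet_derivative (coord c \<circ> point (chart_at \<A> x)) (at (coord (chart_at \<A> x) x))"

type_synonym 'm vfield = "'m \<Rightarrow> R4"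

definition smooth_fun ::
  "'m chart set \<Rightarrow> 'm set \<Rightarrow> ('m \<Rightarrow> 'b::real_normed_vector) \<Rightarrow> bool" where
  "smooth_fun \<A> U f \<longleftrightarrow> (\<forall>c\<in>\<A>. smooth_on (coord c ` (U \<inter> cdom c)) (f \<circ> point c))"

definition dir_deriv ::
  "'m chart set \<Rightarrow> ('m \<Rightarrow> 'b::real_normed_vector) \<Rightarrow> 'm \<Rightarrow> R4 \<Rightarrow> 'b" where
  "dir_deriv \<A> f x v =
     frechet_derivative (f \<circ> point (chart_at \<A> x)) (at (coord (chart_at \<A> x) x)) v"

definition vf_coord :: "'m chart set \<Rightarrow> 'm chart \<Rightarrow> 'm vfield \<Rightarrow> R4 \<Rightarrow> R4" where
  "vf_coord \<A> c X p = dcoord \<A> c (point c p) (X (point c p))"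

definition smooth_vf :: "'m chart set \<Rightarrow> 'm set \<Rightarrow> 'm vfield \<Rightarrow> bool" where
  "smooth_vf \<A> U X \<longleftrightarrow> (\<forall>c\<in>\<A>. smooth_on (coord c ` (U \<inter> cdom c)) (vf_coord \<A> c X))"

text \<open>\<open>[X,Y] = DY(X) - DX(Y)\<close> in the chart \<open>chart_at \<A> x\<close>, whose own differential at \<open>x\<close> is the identity.\<close>

definition lie_bracket :: "'m chart set \<Rightarrow> 'm vfield \<Rightarrow> 'm vfield \<Rightarrow> 'm \<Rightarrow> R4" where
  "lie_bracket \<A> X Y x =
     (let c = chart_at \<A> x; p = coord c x in
        frechet_derivative (vf_coord \<A> c Y) (at p) (X x)
      - frechet_derivative (vf_coord \<A> c X) (at p) (Y x))"


section \<open>Tensor fields, differential 2-forms\<close>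

definition smooth_bilinear ::
  "'m::topological_space chart set \<Rightarrow> ('m \<Rightarrow> R4 \<Rightarrow> R4 \<Rightarrow> real) \<Rightarrow> bool" where
  "smooth_bilinear \<A> b \<longleftrightarrow> (\<forall>x. bilinear (b x)) \<and>
     (\<forall>U X Y. open U \<longrightarrow> smooth_vf \<A> U X \<longrightarrow> smooth_vf \<A> U Y \<longrightarrow>
        smooth_fun \<A> U (\<lambda>x. b x (X x) (Y x)))"

definition smooth_endo ::
  "'m::topological_space chart set \<Rightarrow> ('m \<Rightarrow> R4 \<Rightarrow> R4) \<Rightarrow> bool" where
  "smooth_endo \<A> F \<longleftrightarrow> (\<forall>x. linear (F x)) \<and>
     (\<forall>U X. open U \<longrightarrow> smooth_vf \<A> U X \<longrightarrow> smooth_vf \<A> U (\<lambda>x. F x (X x)))"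

definition riemannian_metric ::
  "'m::topological_space chart set \<Rightarrow> ('m \<Rightarrow> R4 \<Rightarrow> R4 \<Rightarrow> real) \<Rightarrow> bool" where
  "riemannian_metric \<A> g \<longleftrightarrow> smooth_bilinear \<A> g \<and>
     (\<forall>x v w. g x v w = g x w v) \<and> (\<forall>x v. v \<noteq> 0 \<longrightarrow> 0 < g x v v)"

definition two_form ::
  "'m::topological_space chart set \<Rightarrow> ('m \<Rightarrow> R4 \<Rightarrow> R4 \<Rightarrow> real) \<Rightarrow> bool" where
  "two_form \<A> \<eta> \<longleftrightarrow> smooth_bilinear \<A> \<eta> \<and> (\<forall>x v. \<eta> x v v = 0)"

definition form_coord ::
  "'m chart set \<Rightarrow> 'm chart \<Rightarrow> ('m \<Rightarrow> R4 \<Rightarrow> R4 \<Rightarrow> real) \<Rightarrow> R4 \<Rightarrow> R4 \<Rightarrow> R4 \<Rightarrow> real" where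
  "form_coord \<A> c \<eta> p v w =
     (let x = point c p in \<eta> x (inv (dcoord \<A> c x) v) (inv (dcoord \<A> c x) w))"

text \<open>Exterior derivative of a 2-form, computed in the chart \<open>chart_at \<A> x\<close>.\<close>

definition ext_deriv ::
  "'m chart set \<Rightarrow> ('m \<Rightarrow> R4 \<Rightarrow> R4 \<Rightarrow> real) \<Rightarrow> 'm \<Rightarrow> R4 \<Rightarrow> R4 \<Rightarrow> R4 \<Rightarrow> real" where
  "ext_deriv \<A> \<eta> x u v w =
     (let c = chart_at \<A> x; p = coord c x in
        frechet_derivative (\<lambda>q. form_coord \<A> c \<eta> q v w) (at p) u
      + frechet_derivative (\<lambda>q. form_coord \<A> c \<eta> q w u) (at p) v
      + frechet_derivative (\<lambda>q. form_coord \<A> c \<eta> q u v) (at p) w)"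

definition closed_form ::
  "'m chart set \<Rightarrow> ('m \<Rightarrow> R4 \<Rightarrow> R4 \<Rightarrow> real) \<Rightarrow> bool" where
  "closed_form \<A> \<eta> \<longleftrightarrow> (\<forall>x u v w. ext_deriv \<A> \<eta> x u v w = 0)"

definition nondegenerate :: "('m \<Rightarrow> R4 \<Rightarrow> R4 \<Rightarrow> real) \<Rightarrow> bool" where
  "nondegenerate \<eta> \<longleftrightarrow> (\<forall>x v. (\<forall>w. \<eta> x v w = 0) \<longrightarrow> v = 0)"

definition symplectic ::
  "'m::topological_space chart set \<Rightarrow> ('m \<Rightarrow> R4 \<Rightarrow> R4 \<Rightarrow> real) \<Rightarrow> bool" where
  "symplectic \<A> \<eta> \<longleftrightarrow> two_form \<A> \<eta> \<and> nondegenerate \<eta> \<and> closed_form \<A> \<eta>"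


section \<open>The Levi-Civita connection\<close>

text \<open>
  \<open>nabla Y x v\<close> is the derivative at \<open>x\<close> of the vector field \<open>Y\<close> in the direction \<open>v\<close>. The operator acts on local
  sections: \<open>Y\<close> needs to be smooth only near \<open>x\<close>, and its values away from \<open>x\<close> are irrelevant.
\<close>

type_synonym 'm tconn = "'m vfield \<Rightarrow> 'm \<Rightarrow> R4 \<Rightarrow> R4"

definition affine_connection :: "'m::topological_space chart set \<Rightarrow> 'm tconn \<Rightarrow> bool" where
  "affine_connection \<A> nabla \<longleftrightarrow> (\<forall>U. open U \<longrightarrow>
     (\<forall>Y. smooth_vf \<A> U Y \<longrightarrow>
        (\<forall>x\<in>U. linear (nabla Y x)) \<and>
        (\<forall>X. smooth_vf \<A> U X \<longrightarrow> smooth_vf \<A> U (\<lambda>x. nabla Y x (X x))) \<and>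
        (\<forall>Z. smooth_vf \<A> U Z \<longrightarrow>
           (\<forall>x\<in>U. \<forall>v. nabla (\<lambda>y. Y y + Z y) x v = nabla Y x v + nabla Z x v)) \<and>
        (\<forall>f::'m \<Rightarrow> real. smooth_fun \<A> U f \<longrightarrow>
           (\<forall>x\<in>U. \<forall>v. nabla (\<lambda>y. f y *\<^sub>R Y y) x v
                        = dir_deriv \<A> f x v *\<^sub>R Y x + f x *\<^sub>R nabla Y x v)) \<and>
        (\<forall>Z. (\<forall>y\<in>U. Z y = Y y) \<longrightarrow> (\<forall>x\<in>U. nabla Z x = nabla Y x))))"

definition levi_civita ::
  "'m::topological_space chart set \<Rightarrow> ('m \<Rightarrow> R4 \<Rightarrow> R4 \<Rightarrow> real) \<Rightarrow> 'm tconn \<Rightarrow> bool" where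
  "levi_civita \<A> g nabla \<longleftrightarrow> affine_connection \<A> nabla \<and>
     (\<forall>U X Y. open U \<longrightarrow> smooth_vf \<A> U X \<longrightarrow> smooth_vf \<A> U Y \<longrightarrow>
        (\<forall>x\<in>U. nabla Y x (X x) - nabla X x (Y x) = lie_bracket \<A> X Y x) \<and>
        (\<forall>x\<in>U. \<forall>v. dir_deriv \<A> (\<lambda>y. g y (X y) (Y y)) x v
                     = g x (nabla X x v) (Y x) + g x (X x) (nabla Y x v)))"


section \<open>Quaternions\<close>

type_synonym quat = "real^4"

definition quat :: "real \<Rightarrow> real \<Rightarrow> real \<Rightarrow> real \<Rightarrow> quat" where
  "quat a b c d = vector [a, b, c, d]"

lemma quat_nth [simp]:
  "quat a b c d $ 1 = a" "quat a b c d $ 2 = b" "quat a b c d $ 3 = c" "quat a b c d $ 4 = d"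
  by (simp_all add: quat_def vector_def)

definition qmult :: "quat \<Rightarrow> quat \<Rightarrow> quat" where
  "qmult p q = quat
     (p$1 * q$1 - p$2 * q$2 - p$3 * q$3 - p$4 * q$4)
     (p$1 * q$2 + p$2 * q$1 + p$3 * q$4 - p$4 * q$3)
     (p$1 * q$3 - p$2 * q$4 + p$3 * q$1 + p$4 * q$2)
     (p$1 * q$4 + p$2 * q$3 - p$3 * q$2 + p$4 * q$1)"

abbreviation q1 :: quat where "q1 \<equiv> quat 1 0 0 0"
abbreviation qi :: quat where "qi \<equiv> quat 0 1 0 0"
abbreviation qj :: quat where "qj \<equiv> quat 0 0 1 0"

definition imag_quat :: "quat \<Rightarrow> bool" where
  "imag_quat q \<longleftrightarrow> q$1 = 0"


section \<open>Almost-complex structures and self-dual spinors\<close>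

definition compatible_acs ::
  "'m::topological_space chart set \<Rightarrow> ('m \<Rightarrow> R4 \<Rightarrow> R4 \<Rightarrow> real) \<Rightarrow> ('m \<Rightarrow> R4 \<Rightarrow> R4) \<Rightarrow> bool" where
  "compatible_acs \<A> g J \<longleftrightarrow> smooth_endo \<A> J \<and>
     (\<forall>x v. J x (J x v) = - v) \<and>
     (\<forall>x v w. g x (J x v) (J x w) = g x v w) \<and>
     (\<forall>x v w. v \<noteq> 0 \<and> w \<notin> span {v, J x v} \<longrightarrow>
        0 < det (vector [v, J x v, w, J x w] :: real^4^4))"

definition fund_form ::
  "('m \<Rightarrow> R4 \<Rightarrow> R4 \<Rightarrow> real) \<Rightarrow> ('m \<Rightarrow> R4 \<Rightarrow> R4) \<Rightarrow> 'm \<Rightarrow> R4 \<Rightarrow> R4 \<Rightarrow> real" where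
  "fund_form g J x v w = g x (J x v) w"

definition oriented_isometry :: "(R4 \<Rightarrow> R4 \<Rightarrow> real) \<Rightarrow> (R4 \<Rightarrow> quat) \<Rightarrow> bool" where
  "oriented_isometry gx h \<longleftrightarrow>
     linear h \<and> (\<forall>v w. h v \<bullet> h w = gx v w) \<and> 0 < det (matrix h)"

text \<open>The fibre of \<open>\<W>\<^sup>+\<close>; it does not depend on the isometry.\<close>

definition W_plus :: "(R4 \<Rightarrow> R4 \<Rightarrow> real) \<Rightarrow> (R4 \<Rightarrow> R4) set" where
  "W_plus gx =
     {f. \<exists>h q. oriented_isometry gx h \<and> (\<forall>v. h (f v) = qmult q (h v))}"

definition self_dual_spinor_field ::
  "'m::topological_space chart set \<Rightarrow> ('m \<Rightarrow> R4 \<Rightarrow> R4 \<Rightarrow> real) \<Rightarrow> ('m \<Rightarrow> R4 \<Rightarrow> R4) \<Rightarrow> bool" where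
  "self_dual_spinor_field \<A> g \<phi> \<longleftrightarrow> smooth_endo \<A> \<phi> \<and> (\<forall>x. \<phi> x \<in> W_plus (g x))"

definition sigma_form ::
  "('m \<Rightarrow> R4 \<Rightarrow> R4 \<Rightarrow> real) \<Rightarrow> ('m \<Rightarrow> R4 \<Rightarrow> R4) \<Rightarrow> ('m \<Rightarrow> R4 \<Rightarrow> R4) \<Rightarrow> 'm \<Rightarrow> R4 \<Rightarrow> R4 \<Rightarrow> real" where
  "sigma_form g J \<phi> x v w = 1/4 * fund_form g J x (\<phi> x v) (\<phi> x w)"


section \<open>The line bundle \<open>K\<^sup>*\<close> and its unitary connections\<close>

text \<open>
  For a real vector space \<open>V\<close> with complex structure \<open>J\<close>, the real subspace
  \<open>{T \<in> V \<otimes>\<^sub>\<real> V. (J \<otimes> 1) T = (1 \<otimes> J) T}\<close>, with complex structure \<open>J \<otimes> 1\<close>, is mapped isomorphically onto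
  \<open>V \<otimes>\<^sub>\<complex> V\<close> by the canonical projection; \<open>v \<otimes>\<^sub>\<complex> w\<close> corresponds to \<open>1/2 (v \<otimes> w - Jv \<otimes> Jw)\<close>.
  The second exterior power over \<open>\<complex>\<close>, which is the complex determinant line of \<open>(V,J)\<close> here,
  consists of the skew tensors in it. A tensor in \<open>V \<otimes>\<^sub>\<real> V\<close> is encoded by the matrix of its components,
  so \<open>(J \<otimes> 1) T\<close> and \<open>(1 \<otimes> J) T\<close> are \<open>J ** T\<close> and \<open>T ** transpose J\<close>.
\<close>

type_synonym bivector = "real^4^4"

definition K_dual :: "(R4 \<Rightarrow> R4) \<Rightarrow> bivector set" where
  "K_dual Jx = {T. transpose T = - T \<and> matrix Jx ** T = T ** transpose (matrix Jx)}"

definition tensor :: "R4 \<Rightarrow> R4 \<Rightarrow> bivector" where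
  "tensor v w = (\<chi> a b. v$a * w$b)"

definition ctensor :: "(R4 \<Rightarrow> R4) \<Rightarrow> R4 \<Rightarrow> R4 \<Rightarrow> bivector" where
  "ctensor Jx v w = (1/2) *\<^sub>R (tensor v w - tensor (Jx v) (Jx w))"

definition cwedge :: "(R4 \<Rightarrow> R4) \<Rightarrow> R4 \<Rightarrow> R4 \<Rightarrow> bivector" where
  "cwedge Jx v w = ctensor Jx v w - ctensor Jx w v"

definition cscale :: "(R4 \<Rightarrow> R4) \<Rightarrow> complex \<Rightarrow> bivector \<Rightarrow> bivector" where
  "cscale Jx \<zeta> T = Re \<zeta> *\<^sub>R T + Im \<zeta> *\<^sub>R (matrix Jx ** T)"

text \<open>
  The Hermitian metric of \<open>K\<^sup>*\<close> (complex linear in the first argument); its real part is \<open>g \<otimes> g\<close>.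
  The wedge product \<open>cwedge\<close> of a unitary frame has norm 1.
\<close>

definition biv_inner :: "(R4 \<Rightarrow> R4 \<Rightarrow> real) \<Rightarrow> bivector \<Rightarrow> bivector \<Rightarrow> real" where
  "biv_inner gx T S =
     (\<Sum>a\<in>UNIV. \<Sum>b\<in>UNIV. \<Sum>c\<in>UNIV. \<Sum>d\<in>UNIV.
        gx (axis a 1) (axis c 1) * gx (axis b 1) (axis d 1) * T$a$b * S$c$d)"

definition K_herm ::
  "(R4 \<Rightarrow> R4 \<Rightarrow> real) \<Rightarrow> (R4 \<Rightarrow> R4) \<Rightarrow> bivector \<Rightarrow> bivector \<Rightarrow> complex" where
  "K_herm gx Jx T S = Complex (biv_inner gx T S) (biv_inner gx T (matrix Jx ** S))"

definition smooth_K_section ::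
  "'m chart set \<Rightarrow> ('m \<Rightarrow> R4 \<Rightarrow> R4) \<Rightarrow> 'm set \<Rightarrow> ('m \<Rightarrow> bivector) \<Rightarrow> bool" where
  "smooth_K_section \<A> J U s \<longleftrightarrow> (\<forall>x\<in>U. s x \<in> K_dual (J x)) \<and>
     (\<forall>c\<in>\<A>. smooth_on (coord c ` (U \<inter> cdom c))
        (\<lambda>p. let x = point c p; D = matrix (dcoord \<A> c x) in D ** s x ** transpose D))"

type_synonym 'm kconn = "('m \<Rightarrow> bivector) \<Rightarrow> 'm \<Rightarrow> R4 \<Rightarrow> bivector"

definition unitary_connection ::
  "'m::topological_space chart set \<Rightarrow> ('m \<Rightarrow> R4 \<Rightarrow> R4 \<Rightarrow> real) \<Rightarrow> ('m \<Rightarrow> R4 \<Rightarrow> R4) \<Rightarrow>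
   'm kconn \<Rightarrow> bool" where
  "unitary_connection \<A> g J A \<longleftrightarrow> (\<forall>U. open U \<longrightarrow>
     (\<forall>s. smooth_K_section \<A> J U s \<longrightarrow>
        (\<forall>x\<in>U. linear (A s x)) \<and>
        (\<forall>X. smooth_vf \<A> U X \<longrightarrow> smooth_K_section \<A> J U (\<lambda>x. A s x (X x))) \<and>
        (\<forall>t. smooth_K_section \<A> J U t \<longrightarrow>
           (\<forall>x\<in>U. \<forall>v. A (\<lambda>y. s y + t y) x v = A s x v + A t x v)) \<and>
        (\<forall>f::'m \<Rightarrow> complex. smooth_fun \<A> U f \<longrightarrow>
           (\<forall>x\<in>U. \<forall>v. A (\<lambda>y. cscale (J y) (f y) (s y)) x v
                        = cscale (J x) (dir_deriv \<A> f x v) (s x) + cscale (J x) (f x) (A s x v))) \<and>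
        (\<forall>t. (\<forall>y\<in>U. t y = s y) \<longrightarrow> (\<forall>x\<in>U. A t x = A s x)) \<and>
        (\<forall>t. smooth_K_section \<A> J U t \<longrightarrow>
           (\<forall>x\<in>U. \<forall>v. dir_deriv \<A> (\<lambda>y. K_herm (g y) (J y) (s y) (t y)) x v
                        = K_herm (g x) (J x) (A s x v) (t x) + K_herm (g x) (J x) (s x) (A t x v)))))"


section \<open>U(2)-charts and connection forms\<close>

text \<open>A U(2)-chart is an open set \<open>U\<close> with isometries \<open>\<tau> x\<close> from the tangent spaces at \<open>x \<in> U\<close> to \<open>\<H>\<close>.\<close>

type_synonym 'm u2chart = "'m set \<times> ('m \<Rightarrow> R4 \<Rightarrow> quat)"

definition u2_chart ::
  "'m::topological_space chart set \<Rightarrow> ('m \<Rightarrow> R4 \<Rightarrow> R4 \<Rightarrow> real) \<Rightarrow> ('m \<Rightarrow> R4 \<Rightarrow> R4) \<Rightarrow>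
   'm u2chart \<Rightarrow> bool" where
  "u2_chart \<A> g J = (\<lambda>(U, \<tau>). open U \<and>
     (\<forall>x\<in>U. oriented_isometry (g x) (\<tau> x) \<and> (\<forall>v. \<tau> x (J x v) = qmult qi (\<tau> x v))) \<and>
     (\<forall>q. smooth_vf \<A> U (\<lambda>x. inv (\<tau> x) q)))"

text \<open>
  The frame \<open>1 \<and>\<^sub>\<complex> j\<close> of \<open>K\<^sup>*\<close> and, at a point \<open>x\<close> and in the direction \<open>v\<close>, the connection forms \<open>\<alpha>\<close> of \<open>A\<close>
  and \<open>(\<aa>\<^sub>+, \<aa>\<^sub>-)\<close> of \<open>\<nabla>\<close> in a U(2)-chart.
\<close>

definition K_frame :: "('m \<Rightarrow> R4 \<Rightarrow> R4) \<Rightarrow> 'm u2chart \<Rightarrow> 'm \<Rightarrow> bivector" where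
  "K_frame J = (\<lambda>(U, \<tau>) x. cwedge (J x) (inv (\<tau> x) q1) (inv (\<tau> x) qj))"

definition alpha_form ::
  "'m chart set \<Rightarrow> ('m \<Rightarrow> R4 \<Rightarrow> R4) \<Rightarrow> 'm u2chart \<Rightarrow> 'm kconn \<Rightarrow> 'm \<Rightarrow> R4 \<Rightarrow> real" where
  "alpha_form \<A> J T A x v = (THE a. \<forall>z::'m \<Rightarrow> complex. smooth_fun \<A> (fst T) z \<longrightarrow>
     A (\<lambda>y. cscale (J y) (z y) (K_frame J T y)) x v
       = cscale (J x) (dir_deriv \<A> z x v + 2 * \<i> * of_real a * z x) (K_frame J T x))"

definition spin_forms ::
  "'m chart set \<Rightarrow> 'm tconn \<Rightarrow> 'm u2chart \<Rightarrow> 'm \<Rightarrow> R4 \<Rightarrow> quat \<times> quat" where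
  "spin_forms \<A> nabla = (\<lambda>(U, \<tau>) x v. THE (a_plus, a_minus).
     imag_quat a_plus \<and> imag_quat a_minus \<and>
     (\<forall>Y. smooth_vf \<A> U Y \<longrightarrow>
        \<tau> x (nabla Y x v) = dir_deriv \<A> (\<lambda>y. \<tau> y (Y y)) x v
                        + qmult a_plus (\<tau> x (Y x)) - qmult (\<tau> x (Y x)) a_minus))"


section \<open>Spinorial connections\<close>

definition u2_chart_at ::
  "'m::topological_space chart set \<Rightarrow> ('m \<Rightarrow> R4 \<Rightarrow> R4 \<Rightarrow> real) \<Rightarrow> ('m \<Rightarrow> R4 \<Rightarrow> R4) \<Rightarrow>
   'm \<Rightarrow> 'm u2chart" where
  "u2_chart_at \<A> g J x = (SOME T. u2_chart \<A> g J T \<and> x \<in> fst T)"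

text \<open>The induced connection on \<open>\<W>\<^sup>- = TM\<close>; it does not depend on the U(2)-chart around \<open>x\<close>.\<close>

definition spin_conn_minus ::
  "'m::topological_space chart set \<Rightarrow> ('m \<Rightarrow> R4 \<Rightarrow> R4 \<Rightarrow> real) \<Rightarrow> ('m \<Rightarrow> R4 \<Rightarrow> R4) \<Rightarrow>
   'm tconn \<Rightarrow> 'm kconn \<Rightarrow> 'm tconn" where
  "spin_conn_minus \<A> g J nabla A w x v =
     (let T = u2_chart_at \<A> g J x; \<tau> = snd T in
        inv (\<tau> x)
          (dir_deriv \<A> (\<lambda>y. \<tau> y (w y)) x v
           + qmult (alpha_form \<A> J T A x v *\<^sub>R qi) (\<tau> x (w x))
           - qmult (\<tau> x (w x)) (snd (spin_forms \<A> nabla T x v))))"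

text \<open>The induced connection on \<open>\<W>\<^sup>+\<close>, as an operator on local vector fields \<open>Y\<close>, which is tensorial in \<open>Y\<close>.\<close>

definition spin_conn_plus ::
  "'m::topological_space chart set \<Rightarrow> ('m \<Rightarrow> R4 \<Rightarrow> R4 \<Rightarrow> real) \<Rightarrow> ('m \<Rightarrow> R4 \<Rightarrow> R4) \<Rightarrow>
   'm tconn \<Rightarrow> 'm kconn \<Rightarrow> ('m \<Rightarrow> R4 \<Rightarrow> R4) \<Rightarrow> 'm \<Rightarrow> R4 \<Rightarrow> 'm vfield \<Rightarrow> R4" where
  "spin_conn_plus \<A> g J nabla A \<phi> x X Y =
     spin_conn_minus \<A> g J nabla A (\<lambda>y. \<phi> y (Y y)) x X - \<phi> x (nabla Y x X)"

text \<open>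
  \<open>(\<B>\<^sup>A\<phi>)\<^sub>X Y\<close> for tangent vectors \<open>X\<close>, \<open>Y\<close> at \<open>x\<close>: the common value for all smooth local vector
  fields extending \<open>Y\<close>.
\<close>

definition B_tensor ::
  "'m::topological_space chart set \<Rightarrow> ('m \<Rightarrow> R4 \<Rightarrow> R4 \<Rightarrow> real) \<Rightarrow> ('m \<Rightarrow> R4 \<Rightarrow> R4) \<Rightarrow>
   'm tconn \<Rightarrow> ('m \<Rightarrow> R4 \<Rightarrow> R4) \<Rightarrow> 'm kconn \<Rightarrow> 'm \<Rightarrow> R4 \<Rightarrow> R4 \<Rightarrow> R4" where
  "B_tensor \<A> g J nabla \<phi> A x X Y = (THE r. \<forall>U Z.
     open U \<and> x \<in> U \<and> smooth_vf \<A> U Z \<and> Z x = Y \<longrightarrow>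
     r = spin_conn_plus \<A> g J nabla A \<phi> x X Z)"

definition Alt :: "(R4 \<Rightarrow> R4 \<Rightarrow> R4) \<Rightarrow> R4 \<Rightarrow> R4 \<Rightarrow> R4" where
  "Alt B X Y = (1/2) *\<^sub>R (B X Y - B Y X)"

definition Sym :: "(R4 \<Rightarrow> R4 \<Rightarrow> R4) \<Rightarrow> R4 \<Rightarrow> R4 \<Rightarrow> R4" where
  "Sym B X Y = (1/2) *\<^sub>R (B X Y + B Y X)"

definition orthonormal_frame :: "(R4 \<Rightarrow> R4 \<Rightarrow> real) \<Rightarrow> (4 \<Rightarrow> R4) \<Rightarrow> bool" where
  "orthonormal_frame gx e \<longleftrightarrow> (\<forall>j k. gx (e j) (e k) = (if j = k then 1 else 0))"

definition some_frame :: "(R4 \<Rightarrow> R4 \<Rightarrow> real) \<Rightarrow> 4 \<Rightarrow> R4" where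
  "some_frame gx = (SOME e. orthonormal_frame gx e)"

definition dirac_trace :: "(R4 \<Rightarrow> R4 \<Rightarrow> real) \<Rightarrow> (R4 \<Rightarrow> R4 \<Rightarrow> R4) \<Rightarrow> R4" where
  "dirac_trace gx B = (\<Sum>k\<in>UNIV. B (some_frame gx k) (some_frame gx k))"

definition vec_norm :: "(R4 \<Rightarrow> R4 \<Rightarrow> real) \<Rightarrow> R4 \<Rightarrow> real" where
  "vec_norm gx v = sqrt (gx v v)"

definition tensor_norm :: "(R4 \<Rightarrow> R4 \<Rightarrow> real) \<Rightarrow> (R4 \<Rightarrow> R4 \<Rightarrow> R4) \<Rightarrow> real" where
  "tensor_norm gx B = sqrt (\<Sum>j\<in>UNIV. \<Sum>k\<in>UNIV.
     gx (B (some_frame gx j) (some_frame gx k)) (B (some_frame gx j) (some_frame gx k)))"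

text \<open>\<open>N A x\<close> stands for the norm at the point \<open>x\<close> of a tensor determined by the connection \<open>A\<close>.\<close>

definition minimizes ::
  "'m::topological_space chart set \<Rightarrow> ('m \<Rightarrow> R4 \<Rightarrow> R4 \<Rightarrow> real) \<Rightarrow> ('m \<Rightarrow> R4 \<Rightarrow> R4) \<Rightarrow>
   ('m kconn \<Rightarrow> 'm \<Rightarrow> real) \<Rightarrow> 'm kconn \<Rightarrow> bool" where
  "minimizes \<A> g J N A \<longleftrightarrow>
     (\<forall>x. \<forall>A'. unitary_connection \<A> g J A' \<longrightarrow> N A x \<le> N A' x)"

end

theory Submission
  imports Defs
begin

text \<open>
  In a U(2)-chart \<open>\<phi>\<close> is left multiplication by a quaternion-valued function \<open>q\<close>, and \<open>(\<B>\<^sup>A\<phi>)\<^sub>X Y\<close> is the product of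
  \<open>b(X) = \<partial>\<^sub>X q + i \<alpha>(X) q - q \<aa>\<^sub>+(X)\<close> with \<open>Y\<close>. Put \<open>S = \<Sum>\<^sub>k \<bar>b(e\<^sub>k)\<bar>\<^sup>2\<close> and \<open>D = \<Sum>\<^sub>k b(e\<^sub>k) e\<^sub>k\<close>. The squared norms of
  the tensor, its alternating part, its symmetric part and its trace are \<open>4 S\<close>, \<open>S + \<bar>D\<bar>\<^sup>2/2\<close>, \<open>3 S - \<bar>D\<bar>\<^sup>2/2\<close> and \<open>\<bar>D\<bar>\<^sup>2\<close>.
  As functions of \<open>\<alpha>\<close>, both \<open>S\<close> and \<open>\<bar>D\<bar>\<^sup>2\<close> are, up to a constant, \<open>\<bar>q\<bar>\<^sup>2\<close> times the squared distance from a unique minimizer;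
  the minimizers \<open>\<alpha>\<^sub>B\<close> and \<open>\<alpha>\<^sub>D\<close> come from global unitary connections, and \<open>D\<close> vanishes for \<open>\<alpha>\<^sub>D\<close>. Hence a
  connection minimizing all four norms exists iff \<open>\<alpha>\<^sub>B = \<alpha>\<^sub>D\<close>. On the other hand \<open>\<nabla>\<^sub>X \<sigma>\<close> corresponds to the imaginary
  quaternion \<open>c(X)/4\<close>, where \<open>c(X) = 2 q\<^sup>* i b(X)\<close> for \<open>\<alpha> = \<alpha>\<^sub>B\<close> and \<open>q\<^sup>*\<close> is the conjugate of \<open>q\<close>. The form is closed iff
  \<open>\<Sum>\<^sub>k c(e\<^sub>k) e\<^sub>k = 2 q\<^sup>* i D\<close> vanishes, that is, iff \<open>D = 0\<close> for \<open>\<alpha>\<^sub>B\<close>.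
\<close>

section \<open>Calculus of smooth functions\<close>


text \<open>The obstacle is that U(2)-charts and connection forms are local, while the minimizers
  must be connections on the whole manifold. The Hermitian part of \<open>nabla\<close> induces one
  global unitary connection on the line bundle, whose form in every chart is the i-component of
  \<open>aplus\<close>; at each point any other one differs from it by a real linear form \<beta>,
  and the two optimal \<beta> have formulas without charts. Changing \<alpha> by \<beta> adds
  \<beta>(X) i q to b(X). So S is minimal exactly when every b(X) is orthogonal to i q, which is the
  same as c(X) being imaginary. The trace D changes by the sum of \<beta>(e_k) i q e_k, and the
  vectors i q e_k form an orthogonal basis of common length |q|: four real parameters move a vector
  in four dimensions, so exactly one \<beta> makes D vanish. In the symmetric part |D|^2 enters with
  a negative sign. Since S and |D|^2 grow with the same weight |q|^2, a common minimizer still gives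
  a minimum there, with net coefficient 3 - 1/2. The closedness criterion rests on self-duality:
  3-forms in dimension four have four components, and these match the components of the quaternionic
  trace.\<close>

lemma Ck_on_Suc_imp: "Ck_on (Suc k) S f \<Longrightarrow> Ck_on k S f"
proof (induction k arbitrary: f)
  case 0
  then show ?case
    by (auto intro!: differentiable_imp_continuous_within continuous_at_imp_continuous_on)
next
  case (Suc k)
  then show ?case by (metis Ck_on.simps(2))
qed

lemma Ck_on_subset: "Ck_on k S f \<Longrightarrow> T \<subseteq> S \<Longrightarrow> Ck_on k T f"
  by (induction k arbitrary: f) (auto intro: continuous_on_subset)

lemma frechet_derivative_cong_open:
  assumes "open S" "p \<in> S" "\<And>q. q \<in> S \<Longrightarrow> f q = g q" "f differentiable (at p)"
  shows "frechet_derivative g (at p) = frechet_derivative f (at p)" "g differentiable (at p)"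
proof -
  have "(f has_derivative frechet_derivative f (at p)) (at p)"
    using assms(4) frechet_derivative_works by blast
  then have "(g has_derivative frechet_derivative f (at p)) (at p)"
    by (rule has_derivative_transform_within_open[OF _ assms(1,2)]) (use assms in auto)
  then show "frechet_derivative g (at p) = frechet_derivative f (at p)" "g differentiable (at p)"
    using frechet_derivative_at differentiable_def by metis+
qed

lemma Ck_on_cong:
  "open S \<Longrightarrow> (\<And>p. p \<in> S \<Longrightarrow> f p = g p) \<Longrightarrow> Ck_on k S f \<Longrightarrow> Ck_on k S g"
proof (induction k arbitrary: f g)
  case 0
  then show ?case using continuous_on_cong by (metis Ck_on.simps(1))
next
  case (Suc k)
  have "g differentiable (at p)" if "p \<in> S" for p
    using frechet_derivative_cong_open(2)[OF Suc.prems(1) that Suc.prems(2)] Suc.prems(3) that by auto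
  moreover have "Ck_on k S (\<lambda>p. frechet_derivative g (at p) v)" for v
    apply (rule Suc.IH[of "\<lambda>p. frechet_derivative f (at p) v", OF Suc.prems(1)])
    using frechet_derivative_cong_open(1)[OF Suc.prems(1) _ Suc.prems(2)] Suc.prems(3) by auto
  ultimately show ?case by simp
qed

text \<open>\<open>Ck_on\<close> is phrased with the total function
  \<open>frechet_derivative\<close>; on an open set any formula for the derivative may replace it.
  The rules of calculus enter through this form.\<close>

lemma Ck_on_SucI:
  assumes "open S" "\<And>p. p \<in> S \<Longrightarrow> (f has_derivative f' p) (at p)"
    "\<And>v. Ck_on k S (\<lambda>p. f' p v)"
  shows "Ck_on (Suc k) S f"
proof -
  have "Ck_on k S (\<lambda>p. frechet_derivative f (at p) v)" for v
    apply (rule Ck_on_cong[OF assms(1) _ assms(3)[of v]])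
    using assms(2) frechet_derivative_at by metis
  then show ?thesis using assms(2) by (auto simp: differentiable_def)
qed

lemma Ck_on_SucD:
  assumes "Ck_on (Suc k) S f" "p \<in> S"
  shows "(f has_derivative frechet_derivative f (at p)) (at p)"
  using assms frechet_derivative_works by auto

lemma Ck_on_local:
  assumes "\<And>p. p \<in> S \<Longrightarrow> \<exists>T. open T \<and> p \<in> T \<and> Ck_on k (S \<inter> T) f" "open S"
  shows "Ck_on k S f"
  using assms
proof (induction k arbitrary: f)
  case 0
  have "isCont f p" if p: "p \<in> S" for p
  proof -
    obtain T where "open T" "p \<in> T" "continuous_on (S \<inter> T) f" using 0 p by auto
    then show ?thesis using 0(2) p by (metis IntI continuous_on_eq_continuous_at open_Int)
  qed
  then show ?case by (simp add: continuous_at_imp_continuous_on)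
next
  case (Suc k)
  then show ?case by (simp) (metis IntI)
qed

lemma Ck_on_const [simp]: "Ck_on k S (\<lambda>p. c)"
  by (induction k arbitrary: c) auto

lemma Ck_on_linear:
  assumes "bounded_linear L" "open S" "Ck_on k S f"
  shows "Ck_on k S (\<lambda>p. L (f p))"
  using assms(3)
proof (induction k arbitrary: f)
  case 0
  then show ?case using bounded_linear.continuous_on[OF assms(1)] by auto
next
  case (Suc k)
  show ?case
    by (rule Ck_on_SucI[OF assms(2) bounded_linear.has_derivative[OF assms(1) Ck_on_SucD[OF Suc.prems]]])
      (use Suc in auto)
qed

lemma Ck_on_add:
  assumes "open S" "Ck_on k S f" "Ck_on k S g"
  shows "Ck_on k S (\<lambda>p. f p + g p)"
  using assms(2,3)
proof (induction k arbitrary: f g)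
  case 0
  then show ?case by (auto intro!: continuous_on_add)
next
  case (Suc k)
  show ?case
    by (rule Ck_on_SucI[OF assms(1) has_derivative_add[OF Ck_on_SucD[OF Suc.prems(1)] Ck_on_SucD[OF Suc.prems(2)]]])
      (use Suc in auto)
qed

lemma Ck_on_bilinear:
  assumes "bounded_bilinear B" "open S" "Ck_on k S f" "Ck_on k S g"
  shows "Ck_on k S (\<lambda>p. B (f p) (g p))"
  using assms(3,4)
proof (induction k arbitrary: f g)
  case 0
  then show ?case using bounded_bilinear.continuous_on[OF assms(1)] by auto
next
  case (Suc k)
  show ?case
    apply (rule Ck_on_SucI[OF assms(2) bounded_bilinear.FDERIV[OF assms(1) Ck_on_SucD[OF Suc.prems(1)] Ck_on_SucD[OF Suc.prems(2)]]])
       apply assumption+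
    apply (rule Ck_on_add[OF assms(2)])
    subgoal using Suc.IH[OF Ck_on_Suc_imp[OF Suc.prems(1)]] Suc.prems by simp
    subgoal using Suc.IH[OF _ Ck_on_Suc_imp[OF Suc.prems(2)]] Suc.prems by simp
    done
qed

lemma Ck_on_sum:
  "open S \<Longrightarrow> (\<And>i. i \<in> I \<Longrightarrow> Ck_on k S (f i)) \<Longrightarrow> Ck_on k S (\<lambda>p. \<Sum>i\<in>I. f i p)"
  by (induction I rule: infinite_finite_induct) (auto intro: Ck_on_add)

lemma Ck_on_compose:
  assumes "open S" "open T" "h ` S \<subseteq> T" "Ck_on k T f" "Ck_on k S h"
  shows "Ck_on k S (\<lambda>p. f (h p))"
  using assms(4,5)
proof (induction k arbitrary: f)
  case 0
  then show ?case using assms(3) continuous_on_compose2 by (metis Ck_on.simps(1))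
next
  case (Suc k)
  \<comment> \<open>The induction hypothesis covers derivatives of \<open>f\<close> in fixed
    directions, whereas the chain rule applies the derivative of \<open>f\<close> to a moving
    vector. Expanding that vector in the basis separates the two.\<close>
  have 1: "((\<lambda>p. f (h p)) has_derivative
      (\<lambda>v. \<Sum>b\<in>Basis. (frechet_derivative h (at p) v \<bullet> b) *\<^sub>R frechet_derivative f (at (h p)) b)) (at p)"
    if p: "p \<in> S" for p
  proof -
    have "h p \<in> T" using p assms by auto
    then have f: "(f has_derivative frechet_derivative f (at (h p))) (at (h p))"
      using Ck_on_SucD Suc.prems by blast
    have rep: "frechet_derivative f (at (h p)) w = (\<Sum>b\<in>Basis. (w \<bullet> b) *\<^sub>R frechet_derivative f (at (h p)) b)" for w
    proof -
      have l: "linear (frechet_derivative f (at (h p)))"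
        using f has_derivative_linear by blast
      have "frechet_derivative f (at (h p)) (\<Sum>b\<in>Basis. (w \<bullet> b) *\<^sub>R b) = (\<Sum>b\<in>Basis. (w \<bullet> b) *\<^sub>R frechet_derivative f (at (h p)) b)"
        by (simp add: linear_sum[OF l] linear_scale[OF l])
      then show ?thesis by (simp add: euclidean_representation)
    qed
    from has_derivative_compose[OF Ck_on_SucD[OF Suc.prems(2) p] f]
    show ?thesis unfolding rep[of "frechet_derivative h (at p) _"] .
  qed
  show ?case
    apply (rule Ck_on_SucI[OF assms(1) 1], assumption)
    apply (rule Ck_on_sum[OF assms(1)])
    apply (rule Ck_on_bilinear[OF bounded_bilinear_scaleR assms(1)])
    subgoal
      apply (rule Ck_on_bilinear[OF bounded_bilinear_inner assms(1)])
      using Suc.prems by auto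
    subgoal for v b
      using Suc.IH[of "\<lambda>q. frechet_derivative f (at q) b"] Suc.prems Ck_on_Suc_imp by auto
    done
qed

lemma Ck_on_inverse:
  fixes f :: "'a::euclidean_space \<Rightarrow> real"
  assumes "open S" "Ck_on k S f" "\<And>p. p \<in> S \<Longrightarrow> f p \<noteq> 0"
  shows "Ck_on k S (\<lambda>p. inverse (f p))"
  using assms(2,3)
proof (induction k)
  case 0
  then show ?case by (auto intro: continuous_on_inverse)
next
  case (Suc k)
  have i: "Ck_on k S (\<lambda>p. inverse (f p))"
    using Suc Ck_on_Suc_imp by blast
  show ?case
    apply (rule Ck_on_SucI[OF assms(1) Deriv.has_derivative_inverse[OF Suc.prems(2) Ck_on_SucD[OF Suc.prems(1)]]])
      apply assumption+
    apply (rule Ck_on_linear[OF bounded_linear_minus[OF bounded_linear_ident] assms(1)])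
    apply (rule Ck_on_bilinear[OF bounded_bilinear_mult assms(1)])+
    using i Suc.prems by auto
qed

lemma Ck_on_sqrt:
  fixes f :: "'a::euclidean_space \<Rightarrow> real"
  assumes "open S" "Ck_on k S f" "\<And>p. p \<in> S \<Longrightarrow> 0 < f p"
  shows "Ck_on k S (\<lambda>p. sqrt (f p))"
  using assms(2)
proof (induction k)
  case 0
  then show ?case by (auto intro!: continuous_on_real_sqrt)
next
  case (Suc k)
  have i: "Ck_on k S (\<lambda>p. inverse (sqrt (f p)))"
    by (rule Ck_on_inverse[OF assms(1) Suc.IH[OF Ck_on_Suc_imp[OF Suc.prems]]])
      (use assms(3) in fastforce)
  have 1: "((\<lambda>p. sqrt (f p)) has_derivative (\<lambda>v. frechet_derivative f (at p) v * (inverse (sqrt (f p)) * (1/2)))) (at p)"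
    if "p \<in> S" for p
  proof -
    have "(sqrt has_real_derivative inverse (sqrt (f p)) / 2) (at (f p))"
      using DERIV_real_sqrt assms(3)[OF that] by blast
    from DERIV_compose_FDERIV[OF this Ck_on_SucD[OF Suc.prems that]] show ?thesis
      by (simp add: field_simps)
  qed
  show ?case
    apply (rule Ck_on_SucI[OF assms(1) 1])
      apply assumption+
    using i Suc.prems
    by (intro Ck_on_bilinear[OF bounded_bilinear_mult assms(1)] Ck_on_const) auto
qed

section \<open>Closure rules for smooth functions, all orders at once\<close>

lemma smooth_on_subset: "smooth_on S f \<Longrightarrow> T \<subseteq> S \<Longrightarrow> smooth_on T f"
  unfolding smooth_on_def using Ck_on_subset by blast

lemma smooth_on_cong:
  "open S \<Longrightarrow> (\<And>p. p \<in> S \<Longrightarrow> f p = g p) \<Longrightarrow> smooth_on S f \<Longrightarrow> smooth_on S g"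
  unfolding smooth_on_def using Ck_on_cong by blast

lemma smooth_on_local:
  assumes "\<And>p. p \<in> S \<Longrightarrow> \<exists>T. open T \<and> p \<in> T \<and> smooth_on (S \<inter> T) f" "open S"
  shows "smooth_on S f"
  using assms unfolding smooth_on_def by (meson Ck_on_local)

lemma smooth_on_const [simp]: "smooth_on S (\<lambda>p. c)"
  unfolding smooth_on_def by simp

lemma smooth_on_linear:
  "bounded_linear L \<Longrightarrow> open S \<Longrightarrow> smooth_on S f \<Longrightarrow> smooth_on S (\<lambda>p. L (f p))"
  unfolding smooth_on_def using Ck_on_linear by blast

lemma smooth_on_add:
  "open S \<Longrightarrow> smooth_on S f \<Longrightarrow> smooth_on S g \<Longrightarrow> smooth_on S (\<lambda>p. f p + g p)"
  unfolding smooth_on_def using Ck_on_add by blast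

lemma smooth_on_bilinear:
  "bounded_bilinear B \<Longrightarrow> open S \<Longrightarrow> smooth_on S f \<Longrightarrow> smooth_on S g \<Longrightarrow> smooth_on S (\<lambda>p. B (f p) (g p))"
  unfolding smooth_on_def using Ck_on_bilinear by blast

lemma smooth_on_sum:
  "open S \<Longrightarrow> (\<And>i. i \<in> I \<Longrightarrow> smooth_on S (f i)) \<Longrightarrow> smooth_on S (\<lambda>p. \<Sum>i\<in>I. f i p)"
  unfolding smooth_on_def by (simp add: Ck_on_sum)

lemma smooth_on_compose:
  assumes "open S" "open T" "h ` S \<subseteq> T" "smooth_on T f" "smooth_on S h"
  shows "smooth_on S (\<lambda>p. f (h p))"
  using assms(4,5) Ck_on_compose[OF assms(1-3)] unfolding smooth_on_def by blast

lemma smooth_on_inverse: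
  fixes f :: "'a::euclidean_space \<Rightarrow> real"
  shows "open S \<Longrightarrow> smooth_on S f \<Longrightarrow> (\<And>p. p \<in> S \<Longrightarrow> f p \<noteq> 0) \<Longrightarrow> smooth_on S (\<lambda>p. inverse (f p))"
  unfolding smooth_on_def using Ck_on_inverse by blast

lemma smooth_on_sqrt:
  fixes f :: "'a::euclidean_space \<Rightarrow> real"
  shows "open S \<Longrightarrow> smooth_on S f \<Longrightarrow> (\<And>p. p \<in> S \<Longrightarrow> 0 < f p) \<Longrightarrow> smooth_on S (\<lambda>p. sqrt (f p))"
  unfolding smooth_on_def using Ck_on_sqrt by blast

lemma smooth_on_has_derivative:
  "smooth_on S f \<Longrightarrow> p \<in> S \<Longrightarrow> (f has_derivative frechet_derivative f (at p)) (at p)"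
  unfolding smooth_on_def using Ck_on_SucD by blast

lemma smooth_on_derivative:
  "smooth_on S f \<Longrightarrow> smooth_on S (\<lambda>p. frechet_derivative f (at p) v)"
  unfolding smooth_on_def by (metis Ck_on.simps(2))

lemma smooth_on_imp_continuous_on: "smooth_on S f \<Longrightarrow> continuous_on S f"
  unfolding smooth_on_def by (metis Ck_on.simps(1))



section \<open>Calculus on an oriented smooth manifold\<close>

lemma linear_R4_expand:
  assumes "linear (L :: R4 \<Rightarrow> 'b::real_vector)"
  shows "L v = (\<Sum>k\<in>UNIV. v $ k *\<^sub>R L (axis k 1))"
proof -
  have "v = (\<Sum>k\<in>UNIV. v $ k *\<^sub>R axis k 1)"
    using basis_expansion[of v] by (simp add: scalar_mult_eq_scaleR)
  then have "L v = L (\<Sum>k\<in>UNIV. v $ k *\<^sub>R axis k 1)" by simp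
  also have "\<dots> = (\<Sum>k\<in>UNIV. v $ k *\<^sub>R L (axis k 1))"
    by (simp add: linear_sum[OF assms] linear_scale[OF assms])
  finally show ?thesis .
qed

locale oriented_manifold =
  fixes \<A> :: "'m::{t2_space, second_countable_topology} chart set"
  assumes atlas: "oriented_smooth_atlas \<A>"
begin

section \<open>Charts, transition maps and differentials\<close>

lemma chart: "c \<in> \<A> \<Longrightarrow> is_chart c"
  using atlas unfolding oriented_smooth_atlas_def by blast

lemma open_cdom [simp]: "c \<in> \<A> \<Longrightarrow> open (cdom c)"
  using chart is_chart_def by blast

lemma point_coord [simp]: "c \<in> \<A> \<Longrightarrow> x \<in> cdom c \<Longrightarrow> point c (coord c x) = x"
  using chart unfolding is_chart_def homeomorphism_def by blast

lemma inj_coord: "c \<in> \<A> \<Longrightarrow> inj_on (coord c) (cdom c)"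
  by (rule inj_on_inverseI[of _ "point c"]) simp

lemma open_coord_image: "c \<in> \<A> \<Longrightarrow> open U \<Longrightarrow> open (coord c ` (U \<inter> cdom c))"
proof -
  assume c: "c \<in> \<A>" and U: "open U"
  have h: "homeomorphism (cdom c) (coord c ` cdom c) (coord c) (point c)" "open (coord c ` cdom c)"
    using chart[OF c] is_chart_def by blast+
  have "openin (top_of_set (cdom c)) (U \<inter> cdom c)"
    using U by (metis inf_commute openin_open_Int)
  then have "openin (top_of_set (coord c ` cdom c)) (coord c ` (U \<inter> cdom c))"
    using homeomorphism_imp_open_map[OF h(1)] by blast
  then show ?thesis using h(2) openin_open_trans by blast
qed

lemma chart_at: "chart_at \<A> x \<in> \<A>" "x \<in> cdom (chart_at \<A> x)"
proof -
  have "\<exists>c. c \<in> \<A> \<and> x \<in> cdom c"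
    using atlas unfolding oriented_smooth_atlas_def by blast
  then have "chart_at \<A> x \<in> \<A> \<and> x \<in> cdom (chart_at \<A> x)"
    unfolding chart_at_def by (rule someI_ex)
  then show "chart_at \<A> x \<in> \<A>" "x \<in> cdom (chart_at \<A> x)" by auto
qed

lemma smooth_transition:
  "c \<in> \<A> \<Longrightarrow> d \<in> \<A> \<Longrightarrow> smooth_on (coord c ` (cdom c \<inter> cdom d)) (coord d \<circ> point c)"
  using atlas unfolding oriented_smooth_atlas_def by blast

lemma transition_has_derivative:
  assumes "c \<in> \<A>" "d \<in> \<A>" "x \<in> cdom c" "x \<in> cdom d"
  shows "((coord d \<circ> point c) has_derivative frechet_derivative (coord d \<circ> point c) (at (coord c x))) (at (coord c x))"
  by (rule smooth_on_has_derivative[OF smooth_transition]) (use assms in auto)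

lemma has_derivative_change_chart:
  assumes "c \<in> \<A>" "d \<in> \<A>" "x \<in> cdom c" "x \<in> cdom d"
    "((f \<circ> point d) has_derivative F) (at (coord d x))"
  shows "((f \<circ> point c) has_derivative
    (\<lambda>v. F (frechet_derivative (coord d \<circ> point c) (at (coord c x)) v))) (at (coord c x))"
proof -
  have "((f \<circ> point d) has_derivative F) (at ((coord d \<circ> point c) (coord c x)))"
    using assms by simp
  from has_derivative_compose[OF transition_has_derivative[OF assms(1-4)] this]
  have 1: "((\<lambda>p. (f \<circ> point d) ((coord d \<circ> point c) p)) has_derivative
    (\<lambda>v. F (frechet_derivative (coord d \<circ> point c) (at (coord c x)) v))) (at (coord c x))" .
  show ?thesis
    by (rule has_derivative_transform_within_open[OF 1 open_coord_image[OF assms(1) open_cdom[OF assms(2)]]])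
      (use assms in auto)
qed

lemma dcoord_has_derivative:
  assumes "c \<in> \<A>" "x \<in> cdom c"
  shows "((coord c \<circ> point (chart_at \<A> x)) has_derivative dcoord \<A> c x) (at (coord (chart_at \<A> x) x))"
  unfolding dcoord_def by (rule transition_has_derivative) (use assms chart_at in auto)

lemma linear_dcoord: "c \<in> \<A> \<Longrightarrow> x \<in> cdom c \<Longrightarrow> linear (dcoord \<A> c x)"
  using dcoord_has_derivative has_derivative_linear by blast

text \<open>Chain rule through the base chart \<open>chart_at \<A> x\<close>, in which tangent
  vectors at \<open>x\<close> are represented: components with respect to two charts differ by the
  Jacobian of the transition map.\<close>

lemma dcoord_change_chart:
  assumes "c \<in> \<A>" "d \<in> \<A>" "x \<in> cdom c" "x \<in> cdom d"
  shows "dcoord \<A> d x v = frechet_derivative (coord d \<circ> point c) (at (coord c x)) (dcoord \<A> c x v)"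
proof -
  have "dcoord \<A> d x = (\<lambda>v. frechet_derivative (coord d \<circ> point c) (at (coord c x)) (dcoord \<A> c x v))"
    using has_derivative_change_chart[OF chart_at(1)[of x] assms(1) chart_at(2) assms(3)
        transition_has_derivative[OF assms]] dcoord_has_derivative[OF assms(2,4)] has_derivative_unique
    unfolding dcoord_def by blast
  then show ?thesis by metis
qed

lemma dcoord_chart_at [simp]: "dcoord \<A> (chart_at \<A> x) x = (\<lambda>v. v)"
proof -
  have "((coord (chart_at \<A> x) \<circ> point (chart_at \<A> x)) has_derivative (\<lambda>v. v)) (at (coord (chart_at \<A> x) x))"
    by (rule has_derivative_transform_within_open[OF has_derivative_ident open_coord_image[OF chart_at(1)[of x] open_UNIV]])
      (use chart_at in auto)
  then show ?thesis
    using dcoord_has_derivative[OF chart_at] has_derivative_unique by blast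
qed

lemma bij_dcoord:
  assumes "c \<in> \<A>" "x \<in> cdom c"
  shows "bij (dcoord \<A> c x)"
proof -
  \<comment> \<open>Changing from \<open>c\<close> back to the base chart, whose own differential is
    the identity, is a left inverse.\<close>
  have "inj (dcoord \<A> c x)"
  proof (rule injI)
    fix v w assume "dcoord \<A> c x v = dcoord \<A> c x w"
    then show "v = w"
      using dcoord_change_chart[OF assms(1) chart_at(1)[of x] assms(2) chart_at(2)] by (metis dcoord_chart_at)
  qed
  then show ?thesis
    using linear_injective_imp_surjective[OF linear_dcoord[OF assms]] bij_def by blast
qed

lemma dcoord_inv [simp]: "c \<in> \<A> \<Longrightarrow> x \<in> cdom c \<Longrightarrow> dcoord \<A> c x (inv (dcoord \<A> c x) v) = v"
  using bij_dcoord by (simp add: bij_is_surj surj_f_inv_f)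

lemma inv_dcoord [simp]: "c \<in> \<A> \<Longrightarrow> x \<in> cdom c \<Longrightarrow> inv (dcoord \<A> c x) (dcoord \<A> c x v) = v"
  using bij_dcoord by (simp add: bij_is_inj)

lemma linear_inv_dcoord: "c \<in> \<A> \<Longrightarrow> x \<in> cdom c \<Longrightarrow> linear (inv (dcoord \<A> c x))"
  using linear_dcoord bij_dcoord inj_linear_imp_inv_linear bij_is_inj by blast


subsection \<open>Smooth functions\<close>

lemma smooth_funD: "smooth_fun \<A> U f \<Longrightarrow> c \<in> \<A> \<Longrightarrow> smooth_on (coord c ` (U \<inter> cdom c)) (f \<circ> point c)"
  unfolding smooth_fun_def by blast

lemma smooth_fun_subset: "smooth_fun \<A> U f \<Longrightarrow> V \<subseteq> U \<Longrightarrow> smooth_fun \<A> V f"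
  unfolding smooth_fun_def by (meson Int_mono image_mono order_refl smooth_on_subset)

lemma smooth_fun_cong:
  assumes "open U" "\<And>x. x \<in> U \<Longrightarrow> f x = g x" "smooth_fun \<A> U f"
  shows "smooth_fun \<A> U g"
  unfolding smooth_fun_def
proof
  fix c assume c: "c \<in> \<A>"
  show "smooth_on (coord c ` (U \<inter> cdom c)) (g \<circ> point c)"
    by (rule smooth_on_cong[OF open_coord_image[OF c assms(1)] _ smooth_funD[OF assms(3) c]])
      (use assms c in auto)
qed

lemma smooth_on_local_chart:
  assumes "open U" "\<And>x. x \<in> U \<Longrightarrow> \<exists>V. open V \<and> x \<in> V \<and> smooth_on (coord c ` (U \<inter> V \<inter> cdom c)) F" "c \<in> \<A>"
  shows "smooth_on (coord c ` (U \<inter> cdom c)) F"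
proof (rule smooth_on_local[OF _ open_coord_image[OF assms(3,1)]])
  fix p assume "p \<in> coord c ` (U \<inter> cdom c)"
  then obtain x where x: "x \<in> U" "x \<in> cdom c" "p = coord c x" by auto
  obtain V where V: "open V" "x \<in> V" "smooth_on (coord c ` (U \<inter> V \<inter> cdom c)) F"
    using assms(2)[OF x(1)] by auto
  have "coord c ` (U \<inter> cdom c) \<inter> coord c ` (V \<inter> cdom c) = coord c ` (U \<inter> V \<inter> cdom c)"
    using inj_coord[OF assms(3)] by (auto simp: inj_on_def)
  then show "\<exists>T. open T \<and> p \<in> T \<and> smooth_on (coord c ` (U \<inter> cdom c) \<inter> T) F"
    using open_coord_image[OF assms(3) V(1)] V x by (intro exI[of _ "coord c ` (V \<inter> cdom c)"]) auto
qed

lemma smooth_fun_local: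
  assumes "open U" "\<And>x. x \<in> U \<Longrightarrow> \<exists>V. open V \<and> x \<in> V \<and> smooth_fun \<A> (U \<inter> V) f"
  shows "smooth_fun \<A> U f"
  unfolding smooth_fun_def
proof
  fix c assume c: "c \<in> \<A>"
  show "smooth_on (coord c ` (U \<inter> cdom c)) (f \<circ> point c)"
    by (rule smooth_on_local_chart[OF assms(1) _ c]) (meson assms(2) smooth_funD c)
qed

lemma smooth_fun_const [simp]: "smooth_fun \<A> U (\<lambda>x. k)"
  unfolding smooth_fun_def by (simp add: comp_def)

lemma smooth_fun_linear:
  "bounded_linear L \<Longrightarrow> open U \<Longrightarrow> smooth_fun \<A> U f \<Longrightarrow> smooth_fun \<A> U (\<lambda>x. L (f x))"
  unfolding smooth_fun_def comp_def
  by (intro ballI, rule smooth_on_linear[of L, OF _ open_coord_image[of _ U]]) auto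

lemma smooth_fun_add:
  "open U \<Longrightarrow> smooth_fun \<A> U f \<Longrightarrow> smooth_fun \<A> U g \<Longrightarrow> smooth_fun \<A> U (\<lambda>x. f x + g x)"
  unfolding smooth_fun_def comp_def by (simp add: smooth_on_add open_coord_image)

lemma smooth_fun_bilinear:
  "bounded_bilinear B \<Longrightarrow> open U \<Longrightarrow> smooth_fun \<A> U f \<Longrightarrow> smooth_fun \<A> U g \<Longrightarrow> smooth_fun \<A> U (\<lambda>x. B (f x) (g x))"
  unfolding smooth_fun_def comp_def
  by (intro ballI, rule smooth_on_bilinear[of B, OF _ open_coord_image[of _ U]]) auto

lemma smooth_fun_sum:
  "open U \<Longrightarrow> (\<And>i. i \<in> I \<Longrightarrow> smooth_fun \<A> U (f i)) \<Longrightarrow> smooth_fun \<A> U (\<lambda>x. \<Sum>i\<in>I. f i x)"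
  unfolding smooth_fun_def comp_def by (simp add: smooth_on_sum open_coord_image)

lemma smooth_fun_inverse:
  fixes f :: "'m \<Rightarrow> real"
  assumes "open U" "smooth_fun \<A> U f" "\<And>x. x \<in> U \<Longrightarrow> f x \<noteq> 0"
  shows "smooth_fun \<A> U (\<lambda>x. inverse (f x))"
  unfolding smooth_fun_def comp_def
proof
  fix c assume c: "c \<in> \<A>"
  show "smooth_on (coord c ` (U \<inter> cdom c)) (\<lambda>p. inverse (f (point c p)))"
    by (rule smooth_on_inverse[OF open_coord_image[OF c assms(1)] smooth_funD[OF assms(2) c, unfolded comp_def]])
      (use assms(3) c in auto)
qed

lemma smooth_fun_sqrt:
  fixes f :: "'m \<Rightarrow> real"
  assumes "open U" "smooth_fun \<A> U f" "\<And>x. x \<in> U \<Longrightarrow> 0 < f x"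
  shows "smooth_fun \<A> U (\<lambda>x. sqrt (f x))"
  unfolding smooth_fun_def comp_def
proof
  fix c assume c: "c \<in> \<A>"
  show "smooth_on (coord c ` (U \<inter> cdom c)) (\<lambda>p. sqrt (f (point c p)))"
    by (rule smooth_on_sqrt[OF open_coord_image[OF c assms(1)] smooth_funD[OF assms(2) c, unfolded comp_def]])
      (use assms(3) c in auto)
qed

lemma smooth_fun_minus: "open U \<Longrightarrow> smooth_fun \<A> U f \<Longrightarrow> smooth_fun \<A> U (\<lambda>x. - f x)"
  by (rule smooth_fun_linear[OF bounded_linear_minus[OF bounded_linear_ident]])

lemma smooth_fun_diff:
  "open U \<Longrightarrow> smooth_fun \<A> U f \<Longrightarrow> smooth_fun \<A> U g \<Longrightarrow> smooth_fun \<A> U (\<lambda>x. f x - g x)"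
  using smooth_fun_add[of U f "\<lambda>x. - g x"] smooth_fun_minus[of U g] by simp

lemmas smooth_fun_mult = smooth_fun_bilinear[OF bounded_bilinear_mult]
lemmas smooth_fun_scaleR = smooth_fun_bilinear[OF bounded_bilinear_scaleR]
lemmas smooth_fun_inner = smooth_fun_bilinear[OF bounded_bilinear_inner]

lemma smooth_fun_continuous_on:
  assumes "open U" "smooth_fun \<A> U f"
  shows "continuous_on U f"
proof -
  have "isCont f x" if x: "x \<in> U" for x
  proof -
    let ?c = "chart_at \<A> x"
    have c: "?c \<in> \<A>" "x \<in> cdom ?c" using chart_at by auto
    have "continuous_on (cdom ?c) (coord ?c)"
      using chart[OF c(1)] unfolding is_chart_def homeomorphism_def by blast
    then have "continuous_on (U \<inter> cdom ?c) (coord ?c)"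
      by (rule continuous_on_subset) auto
    from continuous_on_compose[OF this smooth_on_imp_continuous_on[OF smooth_funD[OF assms(2) c(1)]]]
    have "continuous_on (U \<inter> cdom ?c) ((f \<circ> point ?c) \<circ> coord ?c)" .
    then have "continuous_on (U \<inter> cdom ?c) f"
      by (rule continuous_on_eq) (use c in auto)
    then show ?thesis
      using x c assms(1) by (metis IntI continuous_on_eq_continuous_at open_Int open_cdom)
  qed
  then show ?thesis by (simp add: continuous_at_imp_continuous_on)
qed

text \<open>Serves to shrink a chart domain to the open set on which a vector field does not
  vanish.\<close>

lemma open_smooth_fun_pos:
  fixes f :: "'m \<Rightarrow> real"
  assumes "open U" "smooth_fun \<A> U f"
  shows "open {x \<in> U. 0 < f x}"
proof -
  have "open (U \<inter> f -` {0<..})"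
    using continuous_open_preimage[OF smooth_fun_continuous_on[OF assms] assms(1)] by auto
  moreover have "U \<inter> f -` {0<..} = {x \<in> U. 0 < f x}" by auto
  ultimately show ?thesis by simp
qed


subsection \<open>Directional derivatives\<close>

lemma smooth_fun_has_derivative:
  assumes "smooth_fun \<A> U f" "x \<in> U" "c \<in> \<A>" "x \<in> cdom c"
  shows "((f \<circ> point c) has_derivative frechet_derivative (f \<circ> point c) (at (coord c x))) (at (coord c x))"
  by (rule smooth_on_has_derivative[OF smooth_funD[OF assms(1,3)]]) (use assms in auto)

lemma dir_deriv_has_derivative:
  assumes "smooth_fun \<A> U f" "x \<in> U"
  shows "((f \<circ> point (chart_at \<A> x)) has_derivative dir_deriv \<A> f x) (at (coord (chart_at \<A> x) x))"
  using smooth_fun_has_derivative[OF assms chart_at] unfolding dir_deriv_def by (simp add: eta_contract_eq)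

lemma dir_deriv_eqI:
  "((f \<circ> point (chart_at \<A> x)) has_derivative F) (at (coord (chart_at \<A> x) x)) \<Longrightarrow> dir_deriv \<A> f x v = F v"
  unfolding dir_deriv_def using frechet_derivative_at by metis

lemma dir_deriv_chart:
  assumes "smooth_fun \<A> U f" "x \<in> U" "c \<in> \<A>" "x \<in> cdom c"
  shows "dir_deriv \<A> f x v = frechet_derivative (f \<circ> point c) (at (coord c x)) (dcoord \<A> c x v)"
  unfolding dcoord_def
  by (rule dir_deriv_eqI, rule has_derivative_change_chart[OF chart_at(1)[of x] assms(3) chart_at(2) assms(4)
        smooth_fun_has_derivative[OF assms]])

lemma linear_dir_deriv: "smooth_fun \<A> U f \<Longrightarrow> x \<in> U \<Longrightarrow> linear (dir_deriv \<A> f x)"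
  using dir_deriv_has_derivative has_derivative_linear by blast

lemma dir_deriv_cong:
  assumes "open U" "x \<in> U" "\<And>y. y \<in> U \<Longrightarrow> f y = h y" "smooth_fun \<A> U f"
  shows "dir_deriv \<A> h x v = dir_deriv \<A> f x v"
  by (rule dir_deriv_eqI, rule has_derivative_transform_within_open[OF dir_deriv_has_derivative[OF assms(4,2)]
        open_coord_image[OF chart_at(1)[of x] assms(1)]])
    (use assms chart_at in auto)

lemma dir_deriv_const [simp]: "dir_deriv \<A> (\<lambda>y. k) x v = 0"
  by (rule dir_deriv_eqI[where F = "\<lambda>v. 0"]) (simp add: comp_def)

lemma dir_deriv_add:
  assumes "smooth_fun \<A> U f" "smooth_fun \<A> U h" "x \<in> U"
  shows "dir_deriv \<A> (\<lambda>y. f y + h y) x v = dir_deriv \<A> f x v + dir_deriv \<A> h x v"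
  by (rule dir_deriv_eqI) (use has_derivative_add[OF dir_deriv_has_derivative[OF assms(1,3)]
     dir_deriv_has_derivative[OF assms(2,3)]] in \<open>simp add: comp_def\<close>)

lemma dir_deriv_linear:
  assumes "bounded_linear L" "smooth_fun \<A> U f" "x \<in> U"
  shows "dir_deriv \<A> (\<lambda>y. L (f y)) x v = L (dir_deriv \<A> f x v)"
  by (rule dir_deriv_eqI) (use bounded_linear.has_derivative[OF assms(1) dir_deriv_has_derivative[OF assms(2,3)]]
     in \<open>simp add: comp_def\<close>)

lemma dir_deriv_bilinear:
  assumes "bounded_bilinear B" "smooth_fun \<A> U f" "smooth_fun \<A> U h" "x \<in> U"
  shows "dir_deriv \<A> (\<lambda>y. B (f y) (h y)) x v = B (f x) (dir_deriv \<A> h x v) + B (dir_deriv \<A> f x v) (h x)"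
  by (rule dir_deriv_eqI) (use bounded_bilinear.FDERIV[OF assms(1) dir_deriv_has_derivative[OF assms(2,4)]
     dir_deriv_has_derivative[OF assms(3,4)]] chart_at in \<open>simp add: comp_def\<close>)


subsection \<open>Smooth vector fields\<close>

lemma smooth_vfD: "smooth_vf \<A> U X \<Longrightarrow> c \<in> \<A> \<Longrightarrow> smooth_on (coord c ` (U \<inter> cdom c)) (vf_coord \<A> c X)"
  unfolding smooth_vf_def by blast

lemma smooth_vf_subset: "smooth_vf \<A> U X \<Longrightarrow> V \<subseteq> U \<Longrightarrow> smooth_vf \<A> V X"
  unfolding smooth_vf_def by (meson Int_mono image_mono order_refl smooth_on_subset)

lemma smooth_vf_cong:
  assumes "open U" "\<And>x. x \<in> U \<Longrightarrow> X x = Y x" "smooth_vf \<A> U X"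
  shows "smooth_vf \<A> U Y"
  unfolding smooth_vf_def
proof
  fix c assume c: "c \<in> \<A>"
  show "smooth_on (coord c ` (U \<inter> cdom c)) (vf_coord \<A> c Y)"
    by (rule smooth_on_cong[OF open_coord_image[OF c assms(1)] _ smooth_vfD[OF assms(3) c]])
      (use assms c in \<open>auto simp: vf_coord_def\<close>)
qed

lemma smooth_vf_add:
  assumes "open U" "smooth_vf \<A> U X" "smooth_vf \<A> U Y"
  shows "smooth_vf \<A> U (\<lambda>x. X x + Y x)"
  unfolding smooth_vf_def
proof
  fix c assume c: "c \<in> \<A>"
  show "smooth_on (coord c ` (U \<inter> cdom c)) (vf_coord \<A> c (\<lambda>x. X x + Y x))"
    by (rule smooth_on_cong[OF open_coord_image[OF c assms(1)] _
          smooth_on_add[OF open_coord_image[OF c assms(1)] smooth_vfD[OF assms(2) c] smooth_vfD[OF assms(3) c]]])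
      (use c in \<open>auto simp: vf_coord_def linear_add[OF linear_dcoord]\<close>)
qed

lemma smooth_vf_scaleR:
  assumes "open U" "smooth_fun \<A> U f" "smooth_vf \<A> U X"
  shows "smooth_vf \<A> U (\<lambda>x. f x *\<^sub>R X x)"
  unfolding smooth_vf_def
proof
  fix c assume c: "c \<in> \<A>"
  show "smooth_on (coord c ` (U \<inter> cdom c)) (vf_coord \<A> c (\<lambda>x. f x *\<^sub>R X x))"
    by (rule smooth_on_cong[OF open_coord_image[OF c assms(1)] _
          smooth_on_bilinear[OF bounded_bilinear_scaleR open_coord_image[OF c assms(1)] smooth_funD[OF assms(2) c] smooth_vfD[OF assms(3) c]]])
      (use c in \<open>auto simp: vf_coord_def linear_scale[OF linear_dcoord]\<close>)
qed

lemma smooth_vf_cscaleR: "open U \<Longrightarrow> smooth_vf \<A> U X \<Longrightarrow> smooth_vf \<A> U (\<lambda>x. k *\<^sub>R X x)"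
  by (rule smooth_vf_scaleR) auto

lemma smooth_vf_minus: "open U \<Longrightarrow> smooth_vf \<A> U X \<Longrightarrow> smooth_vf \<A> U (\<lambda>x. - X x)"
  using smooth_vf_cscaleR[of U X "-1"] by simp

lemma smooth_vf_diff:
  "open U \<Longrightarrow> smooth_vf \<A> U X \<Longrightarrow> smooth_vf \<A> U Y \<Longrightarrow> smooth_vf \<A> U (\<lambda>x. X x - Y x)"
  using smooth_vf_add[of U X "\<lambda>x. - Y x"] smooth_vf_minus[of U Y] by simp

lemma smooth_vf_zero [simp]: "open U \<Longrightarrow> smooth_vf \<A> U (\<lambda>x. 0)"
  unfolding smooth_vf_def
proof
  fix c assume U: "open U" and c: "c \<in> \<A>"
  show "smooth_on (coord c ` (U \<inter> cdom c)) (vf_coord \<A> c (\<lambda>x. 0))"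
    by (rule smooth_on_cong[OF open_coord_image[OF c U] _ smooth_on_const[of _ 0]])
      (use c in \<open>auto simp: vf_coord_def linear_0[OF linear_dcoord]\<close>)
qed

lemma smooth_vf_sum:
  "open U \<Longrightarrow> (\<And>i. i \<in> I \<Longrightarrow> smooth_vf \<A> U (X i)) \<Longrightarrow> smooth_vf \<A> U (\<lambda>x. \<Sum>i\<in>I. X i x)"
  by (induction I rule: infinite_finite_induct) (auto intro: smooth_vf_add)

text \<open>The constant fields of a chart. They extend any tangent vector to a smooth local field,
  start the construction of unitary frames, and commute, which makes them the test fields for the
  exterior derivative.\<close>

definition coord_field :: "'m chart \<Rightarrow> R4 \<Rightarrow> 'm vfield" where
  "coord_field c v x = inv (dcoord \<A> c x) v"

text \<open>In a second chart \<open>d\<close> the components are the Jacobian of the transition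
  from \<open>c\<close> to \<open>d\<close> applied to \<open>v\<close>, composed with the
  transition from \<open>d\<close> to \<open>c\<close>; both are smooth.\<close>

lemma smooth_coord_field:
  assumes c: "c \<in> \<A>"
  shows "smooth_vf \<A> (cdom c) (coord_field c v)"
  unfolding smooth_vf_def
proof
  fix d assume d: "d \<in> \<A>"
  let ?S = "coord d ` (cdom c \<inter> cdom d)" and ?T = "coord c ` (cdom c \<inter> cdom d)"
  have o: "open ?S" using open_coord_image[OF d open_cdom[OF c]] .
  have "open ?T" using open_coord_image[OF c open_cdom[OF d]] by (simp add: Int_commute)
  moreover have "smooth_on ?T (\<lambda>p. frechet_derivative (coord d \<circ> point c) (at p) v)"
    by (rule smooth_on_derivative[OF smooth_transition[OF c d]])
  moreover have "smooth_on ?S (coord c \<circ> point d)"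
    using smooth_transition[OF d c] by (simp add: Int_commute)
  moreover have "(coord c \<circ> point d) ` ?S \<subseteq> ?T" using d by auto
  ultimately have 1: "smooth_on ?S (\<lambda>p. frechet_derivative (coord d \<circ> point c) (at ((coord c \<circ> point d) p)) v)"
    using smooth_on_compose[OF o] by blast
  show "smooth_on ?S (vf_coord \<A> d (coord_field c v))"
    by (rule smooth_on_cong[OF o _ 1])
      (use c d in \<open>auto simp: vf_coord_def coord_field_def dcoord_change_chart[OF c d]\<close>)
qed

lemma coord_field_chart_at [simp]: "coord_field (chart_at \<A> x) v x = v"
  using inv_dcoord[OF chart_at(1)[of x] chart_at(2), of v] unfolding coord_field_def dcoord_chart_at .

lemma smooth_dir_deriv:
  assumes U: "open U" and f: "smooth_fun \<A> U f" and X: "smooth_vf \<A> U X"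
  shows "smooth_fun \<A> U (\<lambda>x. dir_deriv \<A> f x (X x))"
  unfolding smooth_fun_def
proof
  fix c assume c: "c \<in> \<A>"
  let ?S = "coord c ` (U \<inter> cdom c)"
  have o: "open ?S" using open_coord_image[OF c U] .
  \<comment> \<open>Smoothness of a derivative is available in constant directions, so the moving
    direction \<open>X\<close> is expanded in the standard basis.\<close>
  have "smooth_on ?S (\<lambda>p. \<Sum>k\<in>UNIV. (vf_coord \<A> c X p \<bullet> axis k 1) *\<^sub>R frechet_derivative (f \<circ> point c) (at p) (axis k 1))"
    by (intro smooth_on_sum[OF o] smooth_on_bilinear[OF bounded_bilinear_scaleR o]
        smooth_on_bilinear[OF bounded_bilinear_inner o] smooth_on_const smooth_on_derivative smooth_vfD[OF X c] smooth_funD[OF f c])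
  then show "smooth_on ?S ((\<lambda>x. dir_deriv \<A> f x (X x)) \<circ> point c)"
  proof (rule smooth_on_cong[OF o, rotated])
    fix p assume "p \<in> ?S"
    then obtain x where x: "x \<in> U" "x \<in> cdom c" "p = coord c x" by auto
    have "linear (frechet_derivative (f \<circ> point c) (at (coord c x)))"
      using smooth_fun_has_derivative[OF f x(1) c x(2)] has_derivative_linear by blast
    note l = linear_R4_expand[OF this]
    have "((\<lambda>x. dir_deriv \<A> f x (X x)) \<circ> point c) p = frechet_derivative (f \<circ> point c) (at p) (vf_coord \<A> c X p)"
      using dir_deriv_chart[OF f x(1) c x(2)] by (simp only: comp_apply vf_coord_def point_coord[OF c x(2)] x(3))
    moreover have "w \<bullet> axis k 1 = w $ k" for w :: R4 and k
      by (simp add: inner_axis)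
    ultimately show "(\<Sum>k\<in>UNIV. (vf_coord \<A> c X p \<bullet> axis k 1) *\<^sub>R frechet_derivative (f \<circ> point c) (at p) (axis k 1))
       = ((\<lambda>x. dir_deriv \<A> f x (X x)) \<circ> point c) p"
      using l[of "vf_coord \<A> c X p"] by (simp only: x(3))
  qed
qed

end



section \<open>Quaternions and self-dual endomorphisms\<close>

lemma quat_eq_iff: "(p::quat) = q \<longleftrightarrow> p$1 = q$1 \<and> p$2 = q$2 \<and> p$3 = q$3 \<and> p$4 = q$4"
  by (simp add: vec_eq_iff forall_4)

lemma inner_quat: "(p::quat) \<bullet> q = p$1 * q$1 + p$2 * q$2 + p$3 * q$3 + p$4 * q$4"
  by (simp add: inner_vec_def sum_4)

lemma axis_quat: "axis 1 1 = q1" "axis 2 1 = qi" "axis 3 1 = qj" "axis 4 1 = quat 0 0 0 1"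
  by (simp_all add: quat_eq_iff axis_def)

lemma qmult_nth [simp]:
  "qmult p q $ 1 = p$1 * q$1 - p$2 * q$2 - p$3 * q$3 - p$4 * q$4"
  "qmult p q $ 2 = p$1 * q$2 + p$2 * q$1 + p$3 * q$4 - p$4 * q$3"
  "qmult p q $ 3 = p$1 * q$3 - p$2 * q$4 + p$3 * q$1 + p$4 * q$2"
  "qmult p q $ 4 = p$1 * q$4 + p$2 * q$3 - p$3 * q$2 + p$4 * q$1"
  by (simp_all add: qmult_def)

definition qcnj :: "quat \<Rightarrow> quat" where
  "qcnj q = quat (q$1) (- q$2) (- q$3) (- q$4)"

lemma qcnj_nth [simp]: "qcnj q $ 1 = q$1" "qcnj q $ 2 = - q$2" "qcnj q $ 3 = - q$3" "qcnj q $ 4 = - q$4"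
  by (simp_all add: qcnj_def)

lemma qmult_add_left: "qmult (p + p') q = qmult p q + qmult p' q"
  and qmult_add_right: "qmult p (q + q') = qmult p q + qmult p q'"
  and qmult_scaleR_left: "qmult (r *\<^sub>R p) q = r *\<^sub>R qmult p q"
  and qmult_scaleR_right: "qmult p (r *\<^sub>R q) = r *\<^sub>R qmult p q"
  and qmult_diff_left: "qmult (p - p') q = qmult p q - qmult p' q"
  and qmult_diff_right: "qmult p (q - q') = qmult p q - qmult p q'"
  and qmult_assoc: "qmult (qmult p q) s = qmult p (qmult q s)"
  and qmult_1_left [simp]: "qmult q1 q = q"
  and qmult_1_right [simp]: "qmult q q1 = q"
  by (simp_all add: quat_eq_iff algebra_simps)

lemma bilinear_qmult: "bilinear qmult"
  by (simp add: bilinear_def linear_iff qmult_add_left qmult_add_right qmult_scaleR_left qmult_scaleR_right)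

lemma bounded_bilinear_qmult: "bounded_bilinear qmult"
  using bilinear_qmult bilinear_conv_bounded_bilinear by blast

lemma linear_qmult: "linear (qmult p)"
  using bilinear_qmult by (simp add: bilinear_def)

lemma qmult_qcnj: "qmult p (qcnj p) = (p \<bullet> p) *\<^sub>R q1" "qmult (qcnj p) p = (p \<bullet> p) *\<^sub>R q1"
  by (simp_all add: quat_eq_iff inner_quat algebra_simps)

lemma inner_qmult_left: "qmult p x \<bullet> qmult p y = (p \<bullet> p) * (x \<bullet> y)"
  by (simp add: inner_quat algebra_simps)

lemma inner_qmult_right: "qmult x p \<bullet> qmult y p = (p \<bullet> p) * (x \<bullet> y)"
  by (simp add: inner_quat algebra_simps)

lemma qmult_eq_0_iff: "qmult p q = 0 \<longleftrightarrow> p = 0 \<or> q = 0"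
proof -
  have "qmult p q \<bullet> qmult p q = (p \<bullet> p) * (q \<bullet> q)" by (rule inner_qmult_left)
  then show ?thesis by (metis inner_eq_zero_iff mult_eq_0_iff)
qed

section \<open>Rotations of the quaternions\<close>

lemma vector_4:
  "(vector [a,b,c,d] :: 'a::zero^4) $ 1 = a" "(vector [a,b,c,d] :: 'a^4) $ 2 = b"
  "(vector [a,b,c,d] :: 'a^4) $ 3 = c" "(vector [a,b,c,d] :: 'a^4) $ 4 = d"
  by (simp_all add: vector_def)

lemma det_4:
  "det (A::'a::comm_ring_1^4^4) =
    A$1$1 * (A$2$2 * (A$3$3 * A$4$4 - A$3$4 * A$4$3) - A$2$3 * (A$3$2 * A$4$4 - A$3$4 * A$4$2)
      + A$2$4 * (A$3$2 * A$4$3 - A$3$3 * A$4$2))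
  - A$1$2 * (A$2$1 * (A$3$3 * A$4$4 - A$3$4 * A$4$3) - A$2$3 * (A$3$1 * A$4$4 - A$3$4 * A$4$1)
      + A$2$4 * (A$3$1 * A$4$3 - A$3$3 * A$4$1))
  + A$1$3 * (A$2$1 * (A$3$2 * A$4$4 - A$3$4 * A$4$2) - A$2$2 * (A$3$1 * A$4$4 - A$3$4 * A$4$1)
      + A$2$4 * (A$3$1 * A$4$2 - A$3$2 * A$4$1))
  - A$1$4 * (A$2$1 * (A$3$2 * A$4$3 - A$3$3 * A$4$2) - A$2$2 * (A$3$1 * A$4$3 - A$3$3 * A$4$1)
      + A$2$3 * (A$3$1 * A$4$2 - A$3$2 * A$4$1))"
proof -
  have f1234: "finite {2::4, 3, 4}" "1 \<notin> {2::4, 3, 4}" by auto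
  have f234: "finite {3::4, 4}" "2 \<notin> {3::4, 4}" by auto
  have f34: "finite {4::4}" "3 \<notin> {4::4}" by auto
  show ?thesis
    unfolding det_def UNIV_4
    unfolding sum_over_permutations_insert[OF f1234]
    unfolding sum_over_permutations_insert[OF f234]
    unfolding sum_over_permutations_insert[OF f34]
    unfolding permutes_sing
    by (simp add: sign_swap_id permutation_swap_id sign_compose sign_id swap_id_eq permutation_compose algebra_simps)
qed

lemma det_qmult: "det (matrix (qmult p)) = (p \<bullet> p)\<^sup>2"
  unfolding det_4 by (simp add: matrix_def axis_quat inner_quat power2_eq_square algebra_simps)

text \<open>Such an \<open>R\<close> is a rotation of the imaginary quaternions. It preserves inner
  product and determinant, hence the cross product, and these together with the unit 1 determine
  quaternion multiplication.\<close>

lemma orthogonal_fixing_one_qmult: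
  assumes R: "orthogonal_transformation R" "0 < det (matrix R)" "R q1 = q1"
  shows "R (qmult x y) = qmult (R x) (R y)"
proof -
  have lin: "linear R" using R(1) orthogonal_transformation_linear by blast
  have inn: "R x \<bullet> R y = x \<bullet> y" for x y using R(1) orthogonal_transformation_def by blast
  have "det (matrix R) = 1"
    using det_orthogonal_matrix[of "matrix R"] R orthogonal_transformation_matrix by fastforce
  then have det: "det (matrix R ** A) = det A" for A by (simp add: det_mul)
  \<comment> \<open>With columns 1, x, y, z the determinant is the triple product of the imaginary
    parts, that is, the inner product of \<open>z\<close> with the cross product
    \<open>T x y\<close>.\<close>
  define M where "M x y z = transpose (vector [q1, x, y, z] :: real^4^4)" for x y z :: quat
  define T where "T x y = quat 0 (x$3 * y$4 - x$4 * y$3) (x$4 * y$2 - x$2 * y$4) (x$2 * y$3 - x$3 * y$2)" for x y :: quat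
  have M: "det (M x y z) = T x y \<bullet> z" for x y z
    unfolding M_def det_transpose unfolding det_4 T_def by (simp add: vector_4 inner_quat algebra_simps)
  have "column k (matrix R ** M x y z) = R (column k (M x y z))" for k x y z
  proof -
    have "matrix R *v column k (M x y z) = R (column k (M x y z))"
      using fun_cong[OF matrix_vector_mul(2)[OF lin]] by blast
    then show ?thesis by (simp add: column_def matrix_matrix_mult_def matrix_vector_mult_def)
  qed
  then have "matrix R ** M x y z = M (R x) (R y) (R z)" for x y z
    by (simp add: vec_eq_iff column_def M_def transpose_def forall_4 vector_4 R(3))
  then have TR: "T (R x) (R y) \<bullet> R z = T x y \<bullet> z" for x y z
    using det[of "M x y z"] by (simp add: M)
  \<comment> \<open>It suffices to test against vectors of the form \<open>R z\<close>, since these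
    exhaust the space.\<close>
  have "T (R x) (R y) = R (T x y)"
  proof (rule vector_eq_ldot[THEN iffD1], rule allI)
    fix w obtain z where "w = R z" using orthogonal_transformation_surj[OF R(1)] by (meson surjD)
    then show "w \<bullet> T (R x) (R y) = w \<bullet> R (T x y)"
      using TR[of x y z] inn[of "T x y" z] by (simp add: inner_commute)
  qed
  moreover have q: "qmult x y = T x y + (x \<bullet> q1) *\<^sub>R y + (y \<bullet> q1) *\<^sub>R x - (x \<bullet> y) *\<^sub>R q1" for x y
    by (simp add: quat_eq_iff inner_quat T_def algebra_simps)
  moreover have "R x \<bullet> q1 = x \<bullet> q1" for x using inn[of x q1] R(3) by simp
  ultimately show ?thesis
    using inn R(3) by (simp add: q[of x] q[of "R x"] linear_add[OF lin] linear_diff[OF lin] linear_scale[OF lin])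
qed

text \<open>Write \<open>R = L\<^sub>p R'\<close> with \<open>p = R 1\<close>; then \<open>R'\<close> is an automorphism of the algebra \<open>\<H>\<close>.\<close>

lemma special_orthogonal_qmult:
  assumes R: "orthogonal_transformation R" "0 < det (matrix R)"
  shows "\<exists>q'. \<forall>v. R (qmult q v) = qmult q' (R v)"
proof -
  have lin: "linear R" using R(1) orthogonal_transformation_linear by blast
  have inn: "R x \<bullet> R y = x \<bullet> y" for x y using R(1) orthogonal_transformation_def by blast
  define p where "p = R q1"
  have p: "p \<bullet> p = 1" unfolding p_def inn by (simp add: inner_quat)
  have pc: "qcnj p \<bullet> qcnj p = 1" using p by (simp add: inner_quat)
  define R' where "R' = qmult (qcnj p) \<circ> R"
  have R': "orthogonal_transformation R'"
    unfolding orthogonal_transformation_def R'_def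
    using linear_compose[OF lin linear_qmult] by (simp add: inner_qmult_left pc inn)
  have "det (matrix R') = det (matrix R)"
    unfolding R'_def matrix_compose[OF lin linear_qmult] det_mul det_qmult pc by simp
  moreover have "R' q1 = q1" using p by (simp add: R'_def p_def[symmetric] qmult_qcnj)
  ultimately have hom: "R' (qmult x y) = qmult (R' x) (R' y)" for x y
    using orthogonal_fixing_one_qmult[OF R'] R(2) by simp
  have RR': "R v = qmult p (R' v)" for v
    using p by (simp add: R'_def qmult_qcnj flip: qmult_assoc)
  \<comment> \<open>The multiplier is the image of \<open>q\<close> under the automorphism
    \<open>R'\<close>, conjugated by the unit quaternion \<open>p\<close>.\<close>
  have "R (qmult q v) = qmult (qmult p (qmult (R' q) (qcnj p))) (R v)" for v
    using p by (simp add: RR' hom qmult_assoc) (simp add: qmult_qcnj flip: qmult_assoc[of "qcnj p"])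
  then show ?thesis by blast
qed

lemma oriented_isometryD:
  assumes "oriented_isometry gx h"
  shows "linear h" "h v \<bullet> h w = gx v w" "0 < det (matrix h)" "bij h"
proof -
  show l: "linear h" "h v \<bullet> h w = gx v w" and d: "0 < det (matrix h)"
    using assms unfolding oriented_isometry_def by auto
  have "inj h"
    using d det_nz_iff_inj[OF l(1)] by simp
  then show "bij h" using l(1) linear_injective_imp_surjective bij_def by blast
qed

text \<open>Independence of the fibre from the isometry used to describe it: two oriented isometries
  differ by an element of SO(4), and conjugation by such an element carries left multiplications to
  left multiplications.\<close>

lemma W_plus_isometry:
  assumes f: "f \<in> W_plus gx" and h: "oriented_isometry gx h"
  shows "\<exists>q. \<forall>v. h (f v) = qmult q (h v)"
proof -
  obtain k q where k: "oriented_isometry gx k" "\<And>v. k (f v) = qmult q (k v)"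
    using f unfolding W_plus_def by blast
  have kk: "k (inv k y) = y" "inv k (k v) = v" for y v
    using oriented_isometryD(4)[OF k(1)] by (simp_all add: bij_is_surj surj_f_inv_f bij_is_inj)
  have li: "linear (inv k)"
    using inj_linear_imp_inv_linear oriented_isometryD[OF k(1)] bij_is_inj by blast
  let ?R = "h \<circ> inv k"
  have lin: "linear ?R" using linear_compose[OF li oriented_isometryD(1)[OF h]] .
  have "orthogonal_transformation ?R"
    unfolding orthogonal_transformation_def
    using lin oriented_isometryD(2)[OF h] by (simp flip: oriented_isometryD(2)[OF k(1)] add: kk)
  moreover have "0 < det (matrix ?R)"
  proof -
    have "det (matrix h) = det (matrix ?R) * det (matrix k)"
      unfolding det_mul[symmetric] matrix_compose[OF oriented_isometryD(1)[OF k(1)] lin, symmetric]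
      by (simp add: comp_def kk)
    then show ?thesis using oriented_isometryD(3)[OF h] oriented_isometryD(3)[OF k(1)] by (simp add: zero_less_mult_iff)
  qed
  ultimately obtain q' where "\<And>v. ?R (qmult q v) = qmult q' (?R v)"
    using special_orthogonal_qmult by blast
  then have "h (f v) = qmult q' (h v)" for v
    using k(2)[of v] kk by (metis comp_apply)
  then show ?thesis by blast
qed

text \<open>A trace does not depend on the orthonormal basis. The norms and the Dirac operator are
  defined with an arbitrary \<open>some_frame\<close>, and this moves them to the frame of a
  U(2)-chart.\<close>

lemma orthonormal_trace:
  fixes E :: "4 \<Rightarrow> R4" and \<beta> :: "R4 \<Rightarrow> R4 \<Rightarrow> 'b::real_vector"
  assumes "\<And>j k. E j \<bullet> E k = (if j = k then 1 else 0)" "\<And>y. linear (\<lambda>x. \<beta> x y)" "\<And>x. linear (\<beta> x)"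
  shows "(\<Sum>k\<in>UNIV. \<beta> (E k) (E k)) = (\<Sum>k\<in>UNIV. \<beta> (axis k 1) (axis k 1))"
proof -
  define Q where "Q = (\<chi> k. E k)"
  have "Q ** transpose Q = mat 1"
    using assms(1) by (simp add: Q_def vec_eq_iff matrix_matrix_mult_def transpose_def mat_def inner_vec_def)
  \<comment> \<open>A one-sided inverse of a square matrix is two-sided, so orthonormal rows give
    orthonormal columns.\<close>
  then have "transpose Q ** Q = mat 1"
    using matrix_left_right_inverse by blast
  then have o: "(\<Sum>k\<in>UNIV. E k $ m * E k $ n) = (if m = n then 1 else 0)" for m n
    by (simp add: Q_def vec_eq_iff matrix_matrix_mult_def transpose_def mat_def)
  have "\<beta> (E k) (E k) = (\<Sum>m\<in>UNIV. \<Sum>n\<in>UNIV. (E k $ m * E k $ n) *\<^sub>R \<beta> (axis m 1) (axis n 1))" for k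
  proof -
    have "\<beta> (E k) (E k) = (\<Sum>m\<in>UNIV. E k $ m *\<^sub>R \<beta> (axis m 1) (E k))"
      using linear_R4_expand[OF assms(2)] by blast
    also have "\<dots> = (\<Sum>m\<in>UNIV. E k $ m *\<^sub>R (\<Sum>n\<in>UNIV. E k $ n *\<^sub>R \<beta> (axis m 1) (axis n 1)))"
      using linear_R4_expand[OF assms(3)] by metis
    finally show ?thesis by (simp add: scaleR_sum_right)
  qed
  then have "(\<Sum>k\<in>UNIV. \<beta> (E k) (E k)) = (\<Sum>k\<in>UNIV. \<Sum>m\<in>UNIV. \<Sum>n\<in>UNIV. (E k $ m * E k $ n) *\<^sub>R \<beta> (axis m 1) (axis n 1))"
    by simp
  also have "\<dots> = (\<Sum>m\<in>UNIV. \<Sum>k\<in>UNIV. \<Sum>n\<in>UNIV. (E k $ m * E k $ n) *\<^sub>R \<beta> (axis m 1) (axis n 1))"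
    by (rule sum.swap)
  also have "\<dots> = (\<Sum>m\<in>UNIV. \<Sum>n\<in>UNIV. \<Sum>k\<in>UNIV. (E k $ m * E k $ n) *\<^sub>R \<beta> (axis m 1) (axis n 1))"
    by (intro sum.cong refl sum.swap)
  also have "\<dots> = (\<Sum>m\<in>UNIV. \<Sum>n\<in>UNIV. (if m = n then 1 else 0) *\<^sub>R \<beta> (axis m 1) (axis n 1))"
    by (simp add: o flip: scaleR_sum_left)
  also have "\<dots> = (\<Sum>k\<in>UNIV. \<beta> (axis k 1) (axis k 1))"
    by (simp add: if_distrib[of "\<lambda>r. r *\<^sub>R _"] cong: if_cong)
  finally show ?thesis .
qed



section \<open>Existence of U(2)-charts\<close>

locale almost_hermitian = oriented_manifold \<A>
  for \<A> :: "'m::{t2_space, second_countable_topology} chart set" +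
  fixes g :: "'m \<Rightarrow> R4 \<Rightarrow> R4 \<Rightarrow> real" and J :: "'m \<Rightarrow> R4 \<Rightarrow> R4"
  assumes metric: "riemannian_metric \<A> g" and acs: "compatible_acs \<A> g J"
begin

lemma bilinear_g: "bilinear (g x)"
  using metric unfolding riemannian_metric_def smooth_bilinear_def by blast

lemmas g_simps [simp] = bilinear_ladd[OF bilinear_g] bilinear_radd[OF bilinear_g]
  bilinear_lmul[OF bilinear_g] bilinear_rmul[OF bilinear_g] bilinear_lneg[OF bilinear_g]
  bilinear_rneg[OF bilinear_g] bilinear_lzero[OF bilinear_g] bilinear_rzero[OF bilinear_g]
  bilinear_lsub[OF bilinear_g] bilinear_rsub[OF bilinear_g]

lemma g_sym: "g x v w = g x w v"
  using metric unfolding riemannian_metric_def by blast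

lemma g_pos: "v \<noteq> 0 \<Longrightarrow> 0 < g x v v"
  using metric unfolding riemannian_metric_def by blast

lemma smooth_g: "open U \<Longrightarrow> smooth_vf \<A> U X \<Longrightarrow> smooth_vf \<A> U Y \<Longrightarrow> smooth_fun \<A> U (\<lambda>x. g x (X x) (Y x))"
  using metric unfolding riemannian_metric_def smooth_bilinear_def by blast

lemma linear_J: "linear (J x)"
  using acs unfolding compatible_acs_def smooth_endo_def by blast

lemmas J_simps = linear_add[OF linear_J] linear_scale[OF linear_J] linear_neg[OF linear_J]
  linear_diff[OF linear_J] linear_0[OF linear_J]

lemma J_J [simp]: "J x (J x v) = - v"
  using acs unfolding compatible_acs_def by blast

lemma g_J_J [simp]: "g x (J x v) (J x w) = g x v w"
  using acs unfolding compatible_acs_def by blast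

lemma g_J_left: "g x (J x v) w = - g x v (J x w)"
  using g_J_J[of x v "J x w"] by simp

lemma g_J_self [simp]: "g x v (J x v) = 0" "g x (J x v) v = 0"
  using g_J_left[of x v v] g_sym[of x v "J x v"] by auto

lemma smooth_J: "open U \<Longrightarrow> smooth_vf \<A> U X \<Longrightarrow> smooth_vf \<A> U (\<lambda>x. J x (X x))"
  using acs unfolding compatible_acs_def smooth_endo_def by blast

lemma J_orientation:
  "v \<noteq> 0 \<Longrightarrow> w \<notin> span {v, J x v} \<Longrightarrow> 0 < det (vector [v, J x v, w, J x w] :: real^4^4)"
  using acs unfolding compatible_acs_def by blast

text \<open>The map \<open>h\<close> sends e, J e, f, J f to 1, i, j, k; it intertwines
  \<open>J\<close> with left multiplication by i because i j = k. Its determinant is positive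
  because \<open>J\<close> induces the orientation.\<close>

lemma oriented_isometry_of_frame:
  assumes e: "g x e e = 1" and f: "g x f f = 1" "g x e f = 0" "g x (J x e) f = 0"
  defines "h \<equiv> \<lambda>v. quat (g x v e) (g x v (J x e)) (g x v f) (g x v (J x f))"
    and "s \<equiv> \<lambda>q. q$1 *\<^sub>R e + q$2 *\<^sub>R J x e + q$3 *\<^sub>R f + q$4 *\<^sub>R J x f"
  shows "oriented_isometry (g x) h" "h (J x v) = qmult qi (h v)" "inv h = s"
proof -
  have o: "g x e f = 0" "g x f e = 0" "g x e (J x f) = 0" "g x (J x f) e = 0" "g x (J x e) f = 0" "g x f (J x e) = 0"
    using f g_sym g_J_left by (metis neg_equal_0_iff_equal)+
  have hs: "h (s q) = q" for q
    by (simp add: h_def s_def quat_eq_iff e f o)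
  have lh: "linear h" by (simp add: h_def linear_iff quat_eq_iff)
  have ls: "linear s" by (simp add: s_def linear_iff algebra_simps)
  have "inj s" using hs by (metis injI)
  then have "surj s" using ls linear_injective_imp_surjective by blast
  then have sh: "s (h v) = v" for v using hs by (metis surjD)
  show "inv h = s" using hs sh by (metis inv_equality)
  have gs: "g x (s p) (s q) = p \<bullet> q" for p q
    by (simp add: s_def inner_quat e f o)
  show "h (J x v) = qmult qi (h v)"
    by (simp add: h_def quat_eq_iff g_J_left)
  have "e \<noteq> 0" using e by auto
  moreover have "f \<notin> span {e, J x e}"
  proof
    assume "f \<in> span {e, J x e}"
    then obtain a b where ab: "f - a *\<^sub>R e = b *\<^sub>R J x e"
      unfolding span_insert by (auto simp: span_singleton)
    then have "f = a *\<^sub>R e + b *\<^sub>R J x e" by (simp add: algebra_simps)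
    then have "g x f f = g x f (a *\<^sub>R e + b *\<^sub>R J x e)" by metis
    then show False using f o by simp
  qed
  ultimately have "0 < det (vector [e, J x e, f, J x f] :: real^4^4)"
    using J_orientation by blast
  moreover have "transpose (matrix s) = vector [e, J x e, f, J x f]"
    by (simp add: vec_eq_iff transpose_def matrix_def forall_4 vector_4 s_def axis_quat)
  ultimately have "0 < det (matrix s)" using det_transpose[of "matrix s"] by simp
  moreover have "det (matrix h) * det (matrix s) = 1"
    unfolding det_mul[symmetric] matrix_compose[OF ls lh, symmetric]
    by (simp add: comp_def hs matrix_id_mat_1 [unfolded id_def])
  ultimately have "0 < det (matrix h)" by (metis zero_less_mult_pos2 zero_less_one)
  moreover have "h v \<bullet> h w = g x v w" for v w using gs[of "h v" "h w"] by (simp add: sh)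
  ultimately show "oriented_isometry (g x) h" using lh unfolding oriented_isometry_def by blast
qed

lemma u2_chart_of_frame:
  assumes U: "open U" and sm: "smooth_vf \<A> U e" "smooth_vf \<A> U f"
    and e: "\<And>x. x \<in> U \<Longrightarrow> g x (e x) (e x) = 1"
    and f: "\<And>x. x \<in> U \<Longrightarrow> g x (f x) (f x) = 1" "\<And>x. x \<in> U \<Longrightarrow> g x (e x) (f x) = 0"
      "\<And>x. x \<in> U \<Longrightarrow> g x (J x (e x)) (f x) = 0"
  shows "u2_chart \<A> g J (U, \<lambda>x v. quat (g x v (e x)) (g x v (J x (e x))) (g x v (f x)) (g x v (J x (f x))))"
proof -
  note fr = oriented_isometry_of_frame[OF e f]
  have "smooth_vf \<A> U (\<lambda>x. inv (\<lambda>v. quat (g x v (e x)) (g x v (J x (e x))) (g x v (f x)) (g x v (J x (f x)))) q)" for q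
  proof (rule smooth_vf_cong[OF U])
    show "smooth_vf \<A> U (\<lambda>x. q$1 *\<^sub>R e x + q$2 *\<^sub>R J x (e x) + q$3 *\<^sub>R f x + q$4 *\<^sub>R J x (f x))"
      by (intro smooth_vf_add smooth_vf_cscaleR smooth_J U sm)
  qed (use fr(3) in simp)
  then show ?thesis unfolding u2_chart_def using U fr(1,2) by simp
qed

lemma smooth_normalize:
  assumes "open U" "smooth_vf \<A> U X" "\<And>x. x \<in> U \<Longrightarrow> X x \<noteq> 0"
  shows "smooth_vf \<A> U (\<lambda>x. inverse (sqrt (g x (X x) (X x))) *\<^sub>R X x)"
proof -
  have "0 < g x (X x) (X x)" if "x \<in> U" for x using g_pos assms(3)[OF that] .
  then show ?thesis
    by (intro smooth_vf_scaleR smooth_fun_inverse smooth_fun_sqrt smooth_g assms) fastforce+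
qed

lemma g_normalize: "X \<noteq> 0 \<Longrightarrow> g x (inverse (sqrt (g x X X)) *\<^sub>R X) (inverse (sqrt (g x X X)) *\<^sub>R X) = 1"
  using g_pos[of X x] by (simp add: field_simps flip: power2_eq_square)

text \<open>Complex Gram-Schmidt orthonormalization of two coordinate fields.\<close>

lemma u2_chart_exists: "\<exists>T. u2_chart \<A> g J T \<and> x \<in> fst T"
proof -
  define c where "c = chart_at \<A> x"
  have c: "c \<in> \<A>" "x \<in> cdom c" using chart_at c_def by auto
  define V where "V = coord_field c (axis 1 1)"
  have V: "smooth_vf \<A> (cdom c) V" unfolding V_def by (rule smooth_coord_field[OF c(1)])
  have V0: "V y \<noteq> 0" if "y \<in> cdom c" for y
  proof
    assume "V y = 0"
    then have "dcoord \<A> c y (V y) = 0" using linear_0[OF linear_dcoord[OF c(1) that]] by simp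
    then show False using c that by (simp add: V_def coord_field_def axis_eq_0_iff)
  qed
  define e where "e = (\<lambda>y. inverse (sqrt (g y (V y) (V y))) *\<^sub>R V y)"
  have e: "smooth_vf \<A> (cdom c) e" unfolding e_def by (rule smooth_normalize[OF open_cdom[OF c(1)] V V0])
  have e1: "g y (e y) (e y) = 1" if "y \<in> cdom c" for y
    unfolding e_def by (rule g_normalize[OF V0[OF that]])
  \<comment> \<open>The complex line through \<open>e x\<close> has real dimension at most 2, so a
    second direction remains in the four-dimensional tangent space.\<close>
  have "span {e x, J x (e x)} \<noteq> (UNIV :: R4 set)"
  proof
    assume *: "span {e x, J x (e x)} = (UNIV :: R4 set)"
    have "dim (span {e x, J x (e x)}) \<le> card {e x, J x (e x)}"
      by (metis dim_span dim_le_card' finite.emptyI finite.insertI)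
    also have "\<dots> \<le> 2" by (simp add: card_insert_if)
    finally show False using * by (simp add: dim_UNIV)
  qed
  then obtain w where w: "w \<notin> span {e x, J x (e x)}" by blast
  define W where "W y = coord_field c w y - g y (coord_field c w y) (e y) *\<^sub>R e y
     - g y (coord_field c w y) (J y (e y)) *\<^sub>R J y (e y)" for y
  have W: "smooth_vf \<A> (cdom c) W" unfolding W_def
    by (intro smooth_vf_diff smooth_vf_scaleR smooth_g smooth_J open_cdom[OF c(1)] smooth_coord_field[OF c(1)] e)
  \<comment> \<open>The projected field \<open>W\<close> is nonzero at \<open>x\<close>; normalizing
    it requires restricting to the neighbourhood on which it stays nonzero.\<close>
  define U where "U = {y \<in> cdom c. 0 < g y (W y) (W y)}"
  have U: "open U" unfolding U_def
    by (intro open_smooth_fun_pos open_cdom[OF c(1)] smooth_g W)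
  have "W x \<noteq> 0"
  proof
    assume "W x = 0"
    then have "w = g x w (e x) *\<^sub>R e x + g x w (J x (e x)) *\<^sub>R J x (e x)"
      by (simp add: W_def c_def algebra_simps)
    also have "\<dots> \<in> span {e x, J x (e x)}"
      by (intro span_add span_scale span_base) auto
    finally show False using w by simp
  qed
  then have xU: "x \<in> U" using c g_pos by (simp add: U_def)
  have UW: "W y \<noteq> 0" "y \<in> cdom c" if "y \<in> U" for y using that by (auto simp: U_def)
  have eW: "g y (e y) (W y) = 0" "g y (J y (e y)) (W y) = 0" if "y \<in> cdom c" for y
    using e1[OF that] by (simp_all add: W_def g_sym[of y _ "coord_field c w y"] g_sym[of y "J y (e y)" "e y"])
  define f where "f = (\<lambda>y. inverse (sqrt (g y (W y) (W y))) *\<^sub>R W y)"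
  have f: "smooth_vf \<A> U f" unfolding f_def
    by (rule smooth_normalize[OF U smooth_vf_subset[OF W] UW(1)]) (auto simp: U_def)
  have f1: "g y (f y) (f y) = 1" if "y \<in> U" for y
    unfolding f_def by (rule g_normalize[OF UW(1)[OF that]])
  have ef: "g y (e y) (f y) = 0" "g y (J y (e y)) (f y) = 0" if "y \<in> U" for y
    using eW[OF UW(2)[OF that]] by (simp_all add: f_def)
  have Uc: "U \<subseteq> cdom c" using UW(2) by blast
  have "u2_chart \<A> g J (U, \<lambda>x v. quat (g x v (e x)) (g x v (J x (e x))) (g x v (f x)) (g x v (J x (f x))))"
    (is "u2_chart _ _ _ ?T")
    by (rule u2_chart_of_frame[OF U smooth_vf_subset[OF e Uc] f e1[OF UW(2)] f1 ef])
  moreover have "x \<in> fst ?T" using xU by simp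
  ultimately show ?thesis by (intro exI[of _ ?T] conjI)
qed

lemma u2_chart_at: "u2_chart \<A> g J (u2_chart_at \<A> g J x)" "x \<in> fst (u2_chart_at \<A> g J x)"
  using someI_ex[OF u2_chart_exists[of x]] unfolding u2_chart_at_def by blast+

lemma orthonormal_frame_some_frame: "orthonormal_frame (g x) (some_frame (g x))"
proof -
  have h: "oriented_isometry (g x) (snd (u2_chart_at \<A> g J x) x)"
    using u2_chart_at[of x] unfolding u2_chart_def by (auto split: prod.splits)
  let ?h = "snd (u2_chart_at \<A> g J x) x"
  have "orthonormal_frame (g x) (\<lambda>k. inv ?h (axis k 1))"
    unfolding orthonormal_frame_def oriented_isometryD(2)[OF h, symmetric]
    using oriented_isometryD(4)[OF h] by (simp add: bij_is_surj surj_f_inv_f inner_axis_axis)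
  then show ?thesis unfolding some_frame_def by (metis someI_ex)
qed


subsection \<open>Calculus in a U(2)-chart\<close>

context
  fixes T :: "'m u2chart"
  assumes T: "u2_chart \<A> g J T"
begin

lemma u2_open: "open (fst T)"
  using T unfolding u2_chart_def by (auto split: prod.splits)

lemma u2_isometry: "x \<in> fst T \<Longrightarrow> oriented_isometry (g x) (snd T x)"
  using T unfolding u2_chart_def by (auto split: prod.splits)

lemma u2_J: "x \<in> fst T \<Longrightarrow> snd T x (J x v) = qmult qi (snd T x v)"
  using T unfolding u2_chart_def by (auto split: prod.splits)

lemma smooth_u2_frame: "smooth_vf \<A> (fst T) (\<lambda>x. inv (snd T x) q)"
  using T unfolding u2_chart_def by (auto split: prod.splits)

lemma u2_inv [simp]: "x \<in> fst T \<Longrightarrow> snd T x (inv (snd T x) q) = q"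
  using oriented_isometryD(4)[OF u2_isometry] by (simp add: bij_is_surj surj_f_inv_f)

lemma inv_u2 [simp]: "x \<in> fst T \<Longrightarrow> inv (snd T x) (snd T x v) = v"
  using oriented_isometryD(4)[OF u2_isometry] by (simp add: bij_is_inj)

lemma linear_u2: "x \<in> fst T \<Longrightarrow> linear (snd T x)"
  using oriented_isometryD(1)[OF u2_isometry] by simp

lemma linear_inv_u2: "x \<in> fst T \<Longrightarrow> linear (inv (snd T x))"
  using inj_linear_imp_inv_linear linear_u2 oriented_isometryD(4)[OF u2_isometry] bij_is_inj by blast

lemma inner_u2: "x \<in> fst T \<Longrightarrow> snd T x v \<bullet> snd T x w = g x v w"
  using oriented_isometryD(2)[OF u2_isometry] by simp

lemma g_inv_u2: "x \<in> fst T \<Longrightarrow> g x (inv (snd T x) p) (inv (snd T x) q) = p \<bullet> q"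
  by (simp flip: inner_u2)

lemma J_inv_u2: "x \<in> fst T \<Longrightarrow> J x (inv (snd T x) q) = inv (snd T x) (qmult qi q)"
  by (metis u2_J inv_u2 u2_inv)

text \<open>A U(2)-chart is smooth by definition only through its frame, the images of constants
  under \<open>inv (snd T x)\<close>. Components of \<open>X\<close> are inner products with that
  frame.\<close>

lemma smooth_u2:
  assumes V: "open V" and X: "smooth_vf \<A> V X"
  shows "smooth_fun \<A> (V \<inter> fst T) (\<lambda>y. snd T y (X y))"
proof (rule smooth_fun_cong)
  show o: "open (V \<inter> fst T)" using V u2_open by blast
  show "smooth_fun \<A> (V \<inter> fst T) (\<lambda>y. \<Sum>k\<in>UNIV. g y (X y) (inv (snd T y) (axis k 1)) *\<^sub>R axis k 1)"
    by (intro smooth_fun_sum smooth_fun_scaleR smooth_g o smooth_fun_const smooth_vf_subset[OF X]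
        smooth_vf_subset[OF smooth_u2_frame]) auto
  fix y assume y: "y \<in> V \<inter> fst T"
  have "g y (X y) (inv (snd T y) (axis k 1)) = snd T y (X y) $ k" for k
    using y by (simp add: inner_axis flip: inner_u2)
  then show "(\<Sum>k\<in>UNIV. g y (X y) (inv (snd T y) (axis k 1)) *\<^sub>R axis k 1) = snd T y (X y)"
    using basis_expansion[of "snd T y (X y)"] by (simp add: scalar_mult_eq_scaleR)
qed

end

end



section \<open>The connection forms of the Levi-Civita connection\<close>

locale hermitian_levi_civita = almost_hermitian \<A> g J
  for \<A> :: "'m::{t2_space, second_countable_topology} chart set" and g J +
  fixes nabla :: "'m tconn"
  assumes levi_civita: "levi_civita \<A> g nabla"
begin

lemma affine: "affine_connection \<A> nabla"
  using levi_civita unfolding levi_civita_def by blast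

lemmas affine_conj = affine[unfolded affine_connection_def, THEN spec, THEN mp, THEN spec, THEN mp]

lemma linear_nabla: "open U \<Longrightarrow> smooth_vf \<A> U Y \<Longrightarrow> x \<in> U \<Longrightarrow> linear (nabla Y x)"
  by (rule affine_conj[THEN conjunct1, THEN bspec])

lemma smooth_nabla:
  "open U \<Longrightarrow> smooth_vf \<A> U Y \<Longrightarrow> smooth_vf \<A> U X \<Longrightarrow> smooth_vf \<A> U (\<lambda>x. nabla Y x (X x))"
  by (rule affine_conj[THEN conjunct2, THEN conjunct1, THEN spec, THEN mp])

lemma nabla_add:
  "open U \<Longrightarrow> smooth_vf \<A> U Y \<Longrightarrow> smooth_vf \<A> U Z \<Longrightarrow> x \<in> U \<Longrightarrow>
   nabla (\<lambda>y. Y y + Z y) x v = nabla Y x v + nabla Z x v"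
  by (rule affine_conj[THEN conjunct2, THEN conjunct2, THEN conjunct1, THEN spec, THEN mp, THEN bspec, THEN spec])

lemma nabla_scaleR:
  "open U \<Longrightarrow> smooth_vf \<A> U Y \<Longrightarrow> smooth_fun \<A> U f \<Longrightarrow> x \<in> U \<Longrightarrow>
   nabla (\<lambda>y. f y *\<^sub>R Y y) x v = dir_deriv \<A> f x v *\<^sub>R Y x + f x *\<^sub>R nabla Y x v"
  by (rule affine_conj[THEN conjunct2, THEN conjunct2, THEN conjunct2, THEN conjunct1, THEN spec, THEN mp, THEN bspec, THEN spec])

lemma nabla_cong:
  assumes "open U" "smooth_vf \<A> U Y" "\<And>y. y \<in> U \<Longrightarrow> Z y = Y y" "x \<in> U"
  shows "nabla Z x = nabla Y x"
  by (rule affine_conj[OF assms(1,2), THEN conjunct2, THEN conjunct2, THEN conjunct2, THEN conjunct2, THEN spec, THEN mp, THEN bspec])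
    (use assms in auto)

lemma nabla_torsion_free:
  "open U \<Longrightarrow> smooth_vf \<A> U X \<Longrightarrow> smooth_vf \<A> U Y \<Longrightarrow> x \<in> U \<Longrightarrow>
   nabla Y x (X x) - nabla X x (Y x) = lie_bracket \<A> X Y x"
  using levi_civita unfolding levi_civita_def by blast

lemma nabla_metric:
  "open U \<Longrightarrow> smooth_vf \<A> U X \<Longrightarrow> smooth_vf \<A> U Y \<Longrightarrow> x \<in> U \<Longrightarrow>
   dir_deriv \<A> (\<lambda>y. g y (X y) (Y y)) x v = g x (nabla X x v) (Y x) + g x (X x) (nabla Y x v)"
  using levi_civita unfolding levi_civita_def by blast

lemma nabla_zero: "open U \<Longrightarrow> x \<in> U \<Longrightarrow> nabla (\<lambda>y. 0) x v = 0"
  using nabla_add[of U "\<lambda>y. 0" "\<lambda>y. 0" x v] by simp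

lemma nabla_sum:
  assumes "open U" "x \<in> U"
  shows "(\<And>i. i \<in> I \<Longrightarrow> smooth_vf \<A> U (Y i)) \<Longrightarrow> finite I \<Longrightarrow>
    nabla (\<lambda>y. \<Sum>i\<in>I. Y i y) x v = (\<Sum>i\<in>I. nabla (Y i) x v)"
proof (induction I rule: infinite_finite_induct)
  case (insert i I)
  then have "nabla (\<lambda>y. Y i y + (\<Sum>i\<in>I. Y i y)) x v = nabla (Y i) x v + nabla (\<lambda>y. \<Sum>i\<in>I. Y i y) x v"
    using assms by (intro nabla_add smooth_vf_sum) auto
  then show ?case using insert by simp
qed (use assms nabla_zero in auto)

definition om :: "'m u2chart \<Rightarrow> 'm \<Rightarrow> R4 \<Rightarrow> 4 \<Rightarrow> quat" where
  "om T x v k = snd T x (nabla (\<lambda>y. inv (snd T y) (axis k 1)) x v)"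

text \<open>The skew endomorphism with columns \<open>om 1, \<dots>, om 4\<close> of \<open>\<H>\<close> is \<open>y \<mapsto> aplus y - y aminus\<close>.\<close>

definition aplus :: "'m u2chart \<Rightarrow> 'm \<Rightarrow> R4 \<Rightarrow> quat" where
  "aplus T x v = quat 0 ((om T x v 1 $ 2 + om T x v 3 $ 4) / 2)
     ((om T x v 1 $ 3 - om T x v 2 $ 4) / 2) ((om T x v 1 $ 4 + om T x v 2 $ 3) / 2)"

definition aminus :: "'m u2chart \<Rightarrow> 'm \<Rightarrow> R4 \<Rightarrow> quat" where
  "aminus T x v = quat 0 ((om T x v 3 $ 4 - om T x v 1 $ 2) / 2)
     (- (om T x v 2 $ 4 + om T x v 1 $ 3) / 2) ((om T x v 2 $ 3 - om T x v 1 $ 4) / 2)"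

text \<open>The Hermitian part of the Levi-Civita connection, obtained by averaging over
  \<open>J\<close>; it commutes with \<open>J\<close>. As no chart occurs in it, it provides the
  global reference point among unitary connections.\<close>

definition nabla_herm :: "'m tconn" where
  "nabla_herm Y x v = (1/2) *\<^sub>R (nabla Y x v - J x (nabla (\<lambda>y. J y (Y y)) x v))"

context
  fixes T :: "'m u2chart"
  assumes T: "u2_chart \<A> g J T"
begin

lemmas Topen = u2_open[OF T]

lemma nabla_om:
  assumes V: "open V" and Y: "smooth_vf \<A> V Y" and x: "x \<in> V" "x \<in> fst T"
  shows "snd T x (nabla Y x v) = dir_deriv \<A> (\<lambda>y. snd T y (Y y)) x v + (\<Sum>k\<in>UNIV. snd T x (Y x) $ k *\<^sub>R om T x v k)"
proof -
  let ?W = "V \<inter> fst T"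
  have W: "open ?W" "x \<in> ?W" using V Topen x by auto
  define f where "f k y = snd T y (Y y) \<bullet> axis k 1" for k y
  have sm: "smooth_fun \<A> ?W (\<lambda>y. snd T y (Y y))" by (rule smooth_u2[OF T V Y])
  then have f: "smooth_fun \<A> ?W (f k)" for k
    unfolding f_def by (intro smooth_fun_inner W smooth_fun_const)
  have E: "smooth_vf \<A> ?W (\<lambda>y. inv (snd T y) (axis k 1))" for k
    by (rule smooth_vf_subset[OF smooth_u2_frame[OF T]]) auto
  have "Y y = (\<Sum>k\<in>UNIV. f k y *\<^sub>R inv (snd T y) (axis k 1))" if "y \<in> ?W" for y
    using linear_R4_expand[OF linear_inv_u2[OF T], of y "snd T y (Y y)"] that
    by (simp add: f_def inner_axis inv_u2[OF T])
  from nabla_cong[OF W(1) smooth_vf_sum[OF W(1) smooth_vf_scaleR[OF W(1) f E]] this W(2)]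
  have "nabla Y x v = nabla (\<lambda>y. \<Sum>k\<in>UNIV. f k y *\<^sub>R inv (snd T y) (axis k 1)) x v"
    by simp
  also have "\<dots> = (\<Sum>k\<in>UNIV. nabla (\<lambda>y. f k y *\<^sub>R inv (snd T y) (axis k 1)) x v)"
    by (rule nabla_sum[OF W smooth_vf_scaleR[OF W(1) f E]]) simp
  also have "\<dots> = (\<Sum>k\<in>UNIV. dir_deriv \<A> (f k) x v *\<^sub>R inv (snd T x) (axis k 1)
      + f k x *\<^sub>R nabla (\<lambda>y. inv (snd T y) (axis k 1)) x v)"
    by (simp add: nabla_scaleR[OF W(1) E f W(2)])
  finally have "snd T x (nabla Y x v) = (\<Sum>k\<in>UNIV. dir_deriv \<A> (f k) x v *\<^sub>R axis k 1 + f k x *\<^sub>R om T x v k)"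
    by (simp add: linear_sum[OF linear_u2[OF T x(2)]] linear_add[OF linear_u2[OF T x(2)]]
        linear_scale[OF linear_u2[OF T x(2)]] u2_inv[OF T x(2)] om_def)
  moreover have "dir_deriv \<A> (f k) x v = dir_deriv \<A> (\<lambda>y. snd T y (Y y)) x v $ k" for k
    unfolding f_def
    using dir_deriv_linear[OF bounded_linear_inner_left sm W(2), of "axis k 1" v] by (simp add: inner_axis)
  ultimately show ?thesis
    using basis_expansion[of "dir_deriv \<A> (\<lambda>y. snd T y (Y y)) x v"]
    by (simp add: sum.distrib f_def inner_axis scalar_mult_eq_scaleR)
qed

text \<open>Metric compatibility applied to an orthonormal frame, whose inner products are
  constant.\<close>

lemma om_skew:
  assumes x: "x \<in> fst T"
  shows "om T x v k $ m = - om T x v m $ k"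
proof -
  let ?E = "\<lambda>k y. inv (snd T y) (axis k 1)"
  have "0 = dir_deriv \<A> (\<lambda>y. axis k 1 \<bullet> (axis m 1 :: quat)) x v"
    by simp
  also have "\<dots> = dir_deriv \<A> (\<lambda>y. g y (?E k y) (?E m y)) x v"
    using g_inv_u2[OF T] by (intro dir_deriv_cong[OF Topen x, symmetric]) auto
  also have "\<dots> = g x (nabla (?E k) x v) (?E m x) + g x (?E k x) (nabla (?E m) x v)"
    by (rule nabla_metric[OF Topen smooth_u2_frame[OF T] smooth_u2_frame[OF T] x])
  also have "\<dots> = om T x v k $ m + om T x v m $ k"
    using x by (simp add: om_def inner_axis inner_axis' u2_inv[OF T] flip: inner_u2[OF T])
  finally show ?thesis by simp
qed

text \<open>The splitting of so(4) into two copies of the imaginary quaternions, one acting from the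
  left and one from the right.\<close>

lemma om_aplus_aminus:
  assumes x: "x \<in> fst T"
  shows "(\<Sum>k\<in>UNIV. q $ k *\<^sub>R om T x v k) = qmult (aplus T x v) q - qmult q (aminus T x v)"
proof -
  have z: "om T x v k $ k = 0" for k using om_skew[OF x, of v k k] by simp
  note s = om_skew[OF x, of v 2 1] om_skew[OF x, of v 3 1] om_skew[OF x, of v 4 1]
    om_skew[OF x, of v 3 2] om_skew[OF x, of v 4 2] om_skew[OF x, of v 4 3]
  show ?thesis
    by (simp add: quat_eq_iff sum_4 aplus_def aminus_def z s) (simp add: field_simps)
qed

lemma nabla_u2:
  assumes "open V" "smooth_vf \<A> V Y" "x \<in> V" "x \<in> fst T"
  shows "snd T x (nabla Y x v) = dir_deriv \<A> (\<lambda>y. snd T y (Y y)) x v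
     + qmult (aplus T x v) (snd T x (Y x)) - qmult (snd T x (Y x)) (aminus T x v)"
  using nabla_om[OF assms] om_aplus_aminus[OF assms(4)] by simp

text \<open>Resolves the definite description. For uniqueness, the fields with constant components
  1, i, j are inserted: two solutions differ by the same imaginary quaternion on both sides, which
  then commutes with i and j and is 0.\<close>

lemma spin_forms_eq:
  assumes x: "x \<in> fst T"
  shows "spin_forms \<A> nabla T x v = (aplus T x v, aminus T x v)"
proof -
  let ?P = "\<lambda>p m. imag_quat p \<and> imag_quat m \<and>
     (\<forall>Y. smooth_vf \<A> (fst T) Y \<longrightarrow>
        snd T x (nabla Y x v) = dir_deriv \<A> (\<lambda>y. snd T y (Y y)) x v
                        + qmult p (snd T x (Y x)) - qmult (snd T x (Y x)) m)"
  have im: "imag_quat (aplus T x v)" "imag_quat (aminus T x v)"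
    by (simp_all add: imag_quat_def aplus_def aminus_def)
  have 1: "?P (aplus T x v) (aminus T x v)"
    using im nabla_u2[OF Topen _ x x] by blast
  have 2: "p = aplus T x v \<and> m = aminus T x v" if P: "?P p m" for p m
  proof -
    have e: "qmult p e - qmult e m = qmult (aplus T x v) e - qmult e (aminus T x v)" for e
    proof -
      have *: "smooth_vf \<A> (fst T) (\<lambda>y. inv (snd T y) e)" by (rule smooth_u2_frame[OF T])
      have "snd T x (nabla (\<lambda>y. inv (snd T y) e) x v) = dir_deriv \<A> (\<lambda>y. snd T y (inv (snd T y) e)) x v
         + qmult p e - qmult e m"
        using P[THEN conjunct2, THEN conjunct2, THEN spec, THEN mp, OF *] by (simp only: u2_inv[OF T x])
      moreover have "snd T x (nabla (\<lambda>y. inv (snd T y) e) x v) = dir_deriv \<A> (\<lambda>y. snd T y (inv (snd T y) e)) x v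
         + qmult (aplus T x v) e - qmult e (aminus T x v)"
        using 1[THEN conjunct2, THEN conjunct2, THEN spec, THEN mp, OF *] by (simp only: u2_inv[OF T x])
      ultimately show ?thesis by simp
    qed
    show ?thesis
      using e[of q1] e[of qi] e[of qj] im P by (simp add: quat_eq_iff imag_quat_def)
  qed
  have "spin_forms \<A> nabla T x v = (THE (p, m). ?P p m)"
    unfolding spin_forms_def by (simp add: case_prod_beta)
  also have "\<dots> = (aplus T x v, aminus T x v)"
  proof (rule the_equality)
    show "case (aplus T x v, aminus T x v) of (p, m) \<Rightarrow> ?P p m" unfolding prod.case by (rule 1)
    fix r assume "case r of (p, m) \<Rightarrow> ?P p m"
    then show "r = (aplus T x v, aminus T x v)"
      using 2[of "fst r" "snd r"] unfolding case_prod_beta prod_eq_iff fst_conv snd_conv by blast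
  qed
  finally show ?thesis .
qed

text \<open>Averaging over left multiplication by i keeps the i-component of \<open>aplus\<close>,
  removes the components along j and k, which anticommute with i, and leaves right multiplication by
  \<open>aminus\<close> untouched.\<close>

lemma nabla_herm_u2:
  assumes V: "open V" "smooth_vf \<A> V Y" and x: "x \<in> V" "x \<in> fst T"
  shows "snd T x (nabla_herm Y x v) = dir_deriv \<A> (\<lambda>y. snd T y (Y y)) x v
     + aplus T x v $ 2 *\<^sub>R qmult qi (snd T x (Y x)) - qmult (snd T x (Y x)) (aminus T x v)"
proof -
  let ?y = "snd T x (Y x)" and ?dy = "dir_deriv \<A> (\<lambda>y. snd T y (Y y)) x v"
  have W: "open (V \<inter> fst T)" "x \<in> V \<inter> fst T" using V Topen x by auto
  have sm: "smooth_fun \<A> (V \<inter> fst T) (\<lambda>y. snd T y (Y y))" by (rule smooth_u2[OF T V])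
  have bl: "bounded_linear (qmult qi)" using linear_qmult linear_conv_bounded_linear by blast
  have "dir_deriv \<A> (\<lambda>y. snd T y (J y (Y y))) x v = dir_deriv \<A> (\<lambda>y. qmult qi (snd T y (Y y))) x v"
    by (rule dir_deriv_cong[OF W _ smooth_fun_linear[OF bl W(1) sm]]) (use u2_J[OF T] in auto)
  also have "\<dots> = qmult qi ?dy"
    by (rule dir_deriv_linear[OF bl sm W(2)])
  finally have "snd T x (nabla (\<lambda>y. J y (Y y)) x v) = qmult qi ?dy
      + qmult (aplus T x v) (qmult qi ?y) - qmult (qmult qi ?y) (aminus T x v)"
    using nabla_u2[OF V(1) smooth_J[OF V] x] u2_J[OF T x(2)] by simp
  then have "snd T x (nabla_herm Y x v) = (1/2) *\<^sub>R ((?dy + qmult (aplus T x v) ?y - qmult ?y (aminus T x v))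
     - qmult qi (qmult qi ?dy + qmult (aplus T x v) (qmult qi ?y) - qmult (qmult qi ?y) (aminus T x v)))"
    using nabla_u2[OF V x] u2_J[OF T x(2)]
    by (simp add: nabla_herm_def linear_scale[OF linear_u2[OF T x(2)]] linear_diff[OF linear_u2[OF T x(2)]])
  then show ?thesis
    by (simp add: quat_eq_iff aplus_def) (simp add: field_simps)
qed

lemma linear_om: "x \<in> fst T \<Longrightarrow> linear (\<lambda>v. om T x v k)"
  unfolding om_def
  using linear_compose[OF linear_nabla[OF Topen smooth_u2_frame[OF T]] linear_u2[OF T]] by (simp add: comp_def)

lemma linear_aplus: "x \<in> fst T \<Longrightarrow> linear (aplus T x)"
  using linear_om[of x 1] linear_om[of x 2] linear_om[of x 3]
  by (simp add: linear_iff aplus_def quat_eq_iff field_simps)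

lemma smooth_aplus:
  assumes V: "open V" and X: "smooth_vf \<A> V X"
  shows "smooth_fun \<A> (V \<inter> fst T) (\<lambda>x. aplus T x (X x))"
proof -
  have W: "open (V \<inter> fst T)" using V Topen by auto
  have "smooth_vf \<A> (V \<inter> fst T) (\<lambda>y. nabla (\<lambda>y. inv (snd T y) (axis k 1)) y (X y))" for k
    by (rule smooth_nabla[OF W smooth_vf_subset[OF smooth_u2_frame[OF T]] smooth_vf_subset[OF X]]) auto
  from smooth_u2[OF T W this]
  have om: "smooth_fun \<A> (V \<inter> fst T) (\<lambda>x. om T x (X x) k)" for k
    by (simp add: om_def inf_assoc)
  have c: "smooth_fun \<A> (V \<inter> fst T) (\<lambda>x. om T x (X x) k $ m)" for k m
    using smooth_fun_inner[OF W om smooth_fun_const, of k "axis m 1"] by (simp add: inner_axis)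
  have "aplus T x v = (1/2) *\<^sub>R ((om T x v 1 $ 2 + om T x v 3 $ 4) *\<^sub>R axis 2 1
    + (om T x v 1 $ 3 - om T x v 2 $ 4) *\<^sub>R axis 3 1 + (om T x v 1 $ 4 + om T x v 2 $ 3) *\<^sub>R axis 4 1)" for x v
    by (simp add: aplus_def quat_eq_iff axis_quat)
  then show ?thesis
    by (simp only:) (intro smooth_fun_scaleR smooth_fun_add smooth_fun_diff W c smooth_fun_const)
qed

end

end



section \<open>The line bundle of complex bivectors\<close>

lemma real_matrix_simps:
  fixes A B M :: "real^4^4"
  shows "(A + B) ** M = A ** M + B ** M" "(A - B) ** M = A ** M - B ** M" "(- A) ** M = - (A ** M)"
    "(r *\<^sub>R A) ** M = r *\<^sub>R (A ** M)"
    "M ** (A + B) = M ** A + M ** B" "M ** (A - B) = M ** A - M ** B" "M ** (- A) = - (M ** A)"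
    "M ** (r *\<^sub>R A) = r *\<^sub>R (M ** A)"
    "transpose (A + B) = transpose A + transpose B" "transpose (A - B) = transpose A - transpose B"
    "transpose (- A) = - transpose A" "transpose (r *\<^sub>R A) = r *\<^sub>R transpose A"
  by (simp_all add: matrix_matrix_mult_def transpose_def vec_eq_iff sum_distrib_left sum.distrib
      sum_subtractf sum_negf algebra_simps)

lemma matrix_mult_tensor: "linear L \<Longrightarrow> matrix L ** tensor v w = tensor (L v) w"
proof -
  assume "linear L"
  then have "matrix L *v v = L v" using fun_cong[OF matrix_vector_mul(2)] by blast
  then have "L v $ a = (\<Sum>k\<in>UNIV. matrix L $ a $ k * v $ k)" for a
    by (simp add: matrix_vector_mult_def vec_eq_iff)
  then show ?thesis
    by (simp add: tensor_def matrix_matrix_mult_def vec_eq_iff sum_distrib_right mult.assoc)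
qed

lemma transpose_tensor: "transpose (tensor v w) = tensor w v"
  by (simp add: transpose_def tensor_def vec_eq_iff)

lemma tensor_mult_transpose:
  assumes "linear L" shows "tensor v w ** transpose (matrix L) = tensor v (L w)"
proof -
  have "tensor v w ** transpose (matrix L) = transpose (matrix L ** tensor w v)"
    by (simp add: matrix_transpose_mul transpose_tensor)
  then show ?thesis by (simp add: matrix_mult_tensor[OF assms] transpose_tensor)
qed

lemma bilinear_tensor: "bilinear tensor"
  by (simp add: bilinear_def linear_iff tensor_def vec_eq_iff algebra_simps)

lemmas tensor_simps = bilinear_ladd[OF bilinear_tensor] bilinear_radd[OF bilinear_tensor]
  bilinear_lmul[OF bilinear_tensor] bilinear_rmul[OF bilinear_tensor] bilinear_lneg[OF bilinear_tensor]
  bilinear_rneg[OF bilinear_tensor]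

text \<open>Contraction of a tensor with two covectors. A matrix acting on the tensor moves to a
  covector, which allows work with bivectors without component sums.\<close>

definition bipair :: "bivector \<Rightarrow> (R4 \<Rightarrow> real) \<Rightarrow> (R4 \<Rightarrow> real) \<Rightarrow> real" where
  "bipair S l m = (\<Sum>a\<in>UNIV. \<Sum>b\<in>UNIV. S $ a $ b * (l (axis a 1) * m (axis b 1)))"

lemma bipair_transpose: "bipair (transpose S) l m = bipair S m l"
  unfolding bipair_def transpose_def by (subst sum.swap) (simp add: mult.commute)

lemma bipair_mult_left:
  assumes "linear L" "linear l"
  shows "bipair (matrix L ** S) l m = bipair S (\<lambda>u. l (L u)) m"
proof -
  have e: "l (L (axis k 1)) = (\<Sum>a\<in>UNIV. L (axis k 1) $ a * l (axis a 1))" for k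
    using linear_R4_expand[OF assms(2), of "L (axis k 1)"] by simp
  have "bipair (matrix L ** S) l m = (\<Sum>a\<in>UNIV. \<Sum>b\<in>UNIV. \<Sum>k\<in>UNIV. S $ k $ b * ((L (axis k 1) $ a * l (axis a 1)) * m (axis b 1)))"
    by (simp add: bipair_def matrix_matrix_mult_def matrix_def sum_distrib_left sum_distrib_right mult_ac)
  also have "\<dots> = (\<Sum>b\<in>UNIV. \<Sum>k\<in>UNIV. \<Sum>a\<in>UNIV. S $ k $ b * ((L (axis k 1) $ a * l (axis a 1)) * m (axis b 1)))"
    by (subst sum.swap) (intro sum.cong refl sum.swap)
  also have "\<dots> = (\<Sum>k\<in>UNIV. \<Sum>b\<in>UNIV. \<Sum>a\<in>UNIV. S $ k $ b * ((L (axis k 1) $ a * l (axis a 1)) * m (axis b 1)))"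
    by (rule sum.swap)
  also have "\<dots> = bipair S (\<lambda>u. l (L u)) m"
    by (simp add: bipair_def e sum_distrib_left sum_distrib_right)
  finally show ?thesis .
qed

lemma bipair_mult_right:
  assumes "linear L" "linear m"
  shows "bipair (S ** transpose (matrix L)) l m = bipair S l (\<lambda>u. m (L u))"
proof -
  have "bipair (S ** transpose (matrix L)) l m = bipair (matrix L ** transpose S) m l"
    by (metis bipair_transpose matrix_transpose_mul transpose_transpose)
  then show ?thesis using bipair_mult_left[OF assms] bipair_transpose by simp
qed

lemma bipair_add: "bipair (S + S') l m = bipair S l m + bipair S' l m"
  by (simp add: bipair_def sum.distrib distrib_right)

lemma bipair_scaleR: "bipair (r *\<^sub>R S) l m = r * bipair S l m"
  by (simp add: bipair_def sum_distrib_left mult.assoc)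

lemma bipair_minus: "bipair (- S) l m = - bipair S l m"
  by (simp add: bipair_def sum_negf)

lemma bipair_tensor:
  assumes "linear l" "linear m"
  shows "bipair (tensor v w) l m = l v * m w"
proof -
  have lm: "l v = (\<Sum>a\<in>UNIV. v $ a * l (axis a 1))" "m w = (\<Sum>a\<in>UNIV. w $ a * m (axis a 1))"
    using linear_R4_expand[OF assms(1), of v] linear_R4_expand[OF assms(2), of w] by simp_all
  show ?thesis unfolding lm sum_product bipair_def tensor_def by (simp add: mult_ac)
qed

text \<open>The complex 2-by-2 determinant of \<open>a\<close> and \<open>b\<close>, when a
  quaternion is written as z + w j with z, w in the complex numbers spanned by 1 and i.\<close>

definition cdet :: "quat \<Rightarrow> quat \<Rightarrow> complex" where
  "cdet a b = Complex (a$1) (a$2) * Complex (b$3) (b$4) - Complex (a$3) (a$4) * Complex (b$1) (b$2)"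

lemma bilinear_cdet: "bilinear cdet"
  by (simp add: bilinear_def linear_iff cdet_def complex_eq_iff algebra_simps)

lemma bounded_bilinear_cdet: "bounded_bilinear cdet"
  using bilinear_cdet bilinear_conv_bounded_bilinear by blast

context almost_hermitian
begin

section \<open>Complex structure of the line bundle\<close>

lemma matrix_J_J: "matrix (J x) ** (matrix (J x) ** S) = - (S :: bivector)"
proof -
  have "J x \<circ> J x = (\<lambda>v. - v)" by auto
  then have "matrix (J x) ** matrix (J x) = - mat 1"
    using matrix_compose[OF linear_J linear_J, of x x]
    by (simp add: matrix_def mat_def axis_def vec_eq_iff)
  then have "matrix (J x) ** (matrix (J x) ** S) = (- mat 1) ** S" by (simp add: matrix_mul_assoc)
  also have "\<dots> = - S"
    using real_matrix_simps(3)[of "mat 1" S] by simp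
  finally show ?thesis .
qed

lemma cscale_add_left: "cscale (J x) (\<zeta> + \<xi>) S = cscale (J x) \<zeta> S + cscale (J x) \<xi> S"
  and cscale_minus: "cscale (J x) (- \<zeta>) S = - cscale (J x) \<zeta> S"
  and cscale_scaleR: "cscale (J x) (r *\<^sub>R \<zeta>) S = r *\<^sub>R cscale (J x) \<zeta> S"
  and cscale_1: "cscale (J x) 1 S = S"
  by (simp_all add: cscale_def algebra_simps real_matrix_simps)

lemma cscale_cscale: "cscale (J x) \<zeta> (cscale (J x) \<xi> S) = cscale (J x) (\<zeta> * \<xi>) S"
  by (simp add: cscale_def real_matrix_simps matrix_J_J algebra_simps)

lemma cwedge_add_left: "cwedge (J x) (v + v') w = cwedge (J x) v w + cwedge (J x) v' w"
  and cwedge_scaleR_left: "cwedge (J x) (r *\<^sub>R v) w = r *\<^sub>R cwedge (J x) v w"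
  and cwedge_skew: "cwedge (J x) v w = - cwedge (J x) w v"
  by (simp_all add: cwedge_def ctensor_def J_simps tensor_simps algebra_simps)

lemma cwedge_J_left: "cwedge (J x) (J x v) w = matrix (J x) ** cwedge (J x) v w"
  by (simp add: cwedge_def ctensor_def real_matrix_simps matrix_mult_tensor[OF linear_J] tensor_simps algebra_simps)

lemma cwedge_complex_left:
  "cwedge (J x) (Re \<zeta> *\<^sub>R v + Im \<zeta> *\<^sub>R J x v) w = cscale (J x) \<zeta> (cwedge (J x) v w)"
  by (simp add: cwedge_add_left cwedge_scaleR_left cwedge_J_left cscale_def)

lemma cwedge_complex_right:
  "cwedge (J x) w (Re \<zeta> *\<^sub>R v + Im \<zeta> *\<^sub>R J x v) = cscale (J x) \<zeta> (cwedge (J x) w v)"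
  using cwedge_complex_left[of x \<zeta> v w] cwedge_skew[of x w] 
  by (metis cscale_minus cscale_scaleR cwedge_skew minus_minus mult_minus1 scaleR_minus1_left cscale_cscale mult.commute cscale_1)

lemma cwedge_in_K_dual: "cwedge (J x) v w \<in> K_dual (J x)"
  unfolding K_dual_def cwedge_def ctensor_def
  by (simp add: real_matrix_simps transpose_tensor matrix_mult_tensor[OF linear_J]
      tensor_mult_transpose[OF linear_J] tensor_simps algebra_simps)

lemma cscale_in_K_dual:
  assumes "S \<in> K_dual (J x)"
  shows "cscale (J x) \<zeta> S \<in> K_dual (J x)"
proof -
  have S: "transpose S = - S" "matrix (J x) ** S = S ** transpose (matrix (J x))"
    using assms unfolding K_dual_def by auto
  have "(matrix (J x) ** S) ** transpose (matrix (J x)) = matrix (J x) ** (matrix (J x) ** S)"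
    by (simp only: S(2) matrix_mul_assoc)
  moreover have "transpose (matrix (J x) ** S) = - (matrix (J x) ** S)"
    unfolding S(2) matrix_transpose_mul transpose_transpose S(1) by (simp only: real_matrix_simps S(2))
  ultimately show ?thesis
    using S unfolding K_dual_def cscale_def by (simp add: real_matrix_simps)
qed

lemma K_dual_add: "S \<in> K_dual (J x) \<Longrightarrow> S' \<in> K_dual (J x) \<Longrightarrow> S + S' \<in> K_dual (J x)"
  unfolding K_dual_def by (simp add: real_matrix_simps)

section \<open>Metric contractions of complex bivectors\<close>

definition gpair :: "'m \<Rightarrow> bivector \<Rightarrow> R4 \<Rightarrow> R4 \<Rightarrow> real" where
  "gpair x S v w = bipair S (\<lambda>u. g x u v) (\<lambda>u. g x u w)"

lemma linear_g_left: "linear (\<lambda>u. g x u v)"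
  by (simp add: linear_iff)

lemma gpair_tensor: "gpair x (tensor v w) p q = g x v p * g x w q"
  unfolding gpair_def using bipair_tensor[OF linear_g_left linear_g_left] by simp

lemma gpair_J: "gpair x (matrix (J x) ** S) v w = - gpair x S (J x v) w"
  unfolding gpair_def bipair_mult_left[OF linear_J linear_g_left]
  by (simp add: g_J_left bipair_def sum_negf)

lemma gpair_J_right: "gpair x (S ** transpose (matrix (J x))) v w = - gpair x S v (J x w)"
  unfolding gpair_def bipair_mult_right[OF linear_J linear_g_left]
  by (simp add: g_J_left bipair_def sum_negf)

lemma gpair_add: "gpair x (S + S') v w = gpair x S v w + gpair x S' v w"
  and gpair_scaleR: "gpair x (r *\<^sub>R S) v w = r * gpair x S v w"
  by (simp_all add: gpair_def bipair_add bipair_scaleR)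

lemma gpair_diff: "gpair x (S - S') v w = gpair x S v w - gpair x S' v w"
  using gpair_add[of x "S - S'" S' v w] by simp

lemma gpair_minus_right: "gpair x S v (- w) = - gpair x S v w"
  and gpair_minus_left: "gpair x S (- v) w = - gpair x S v w"
  by (simp_all add: gpair_def bipair_def sum_negf)

lemma gpair_K_dual:
  assumes "S \<in> K_dual (J x)"
  shows "gpair x S v w = - gpair x S w v" "gpair x S (J x v) w = gpair x S v (J x w)"
proof -
  show "gpair x S v w = - gpair x S w v"
    using assms bipair_transpose[of S] bipair_minus[of S] unfolding K_dual_def gpair_def by simp
  show "gpair x S (J x v) w = gpair x S v (J x w)"
    using assms gpair_J[of x S v w] gpair_J_right[of x S v w] unfolding K_dual_def by simp
qed

lemma biv_inner_tensor: "biv_inner (g x) S (tensor v w) = gpair x S v w"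
proof -
  have e: "g x u v = (\<Sum>c\<in>UNIV. v $ c * g x u (axis c 1))" for u v
    using linear_R4_expand[of "g x u" v] by (simp add: linear_iff)
  have "S $ a $ b * (g x (axis a 1) v * g x (axis b 1) w)
     = (\<Sum>c\<in>UNIV. \<Sum>d\<in>UNIV. g x (axis a 1) (axis c 1) * g x (axis b 1) (axis d 1) * S $ a $ b * (v $ c * w $ d))" for a b
    unfolding e[of _ v] e[of _ w] sum_product by (simp add: sum_distrib_left mult_ac)
  then show ?thesis unfolding biv_inner_def gpair_def bipair_def tensor_def by simp
qed

lemma biv_inner_add: "biv_inner (g x) S (R + R') = biv_inner (g x) S R + biv_inner (g x) S R'"
  and biv_inner_scaleR: "biv_inner (g x) S (r *\<^sub>R R) = r * biv_inner (g x) S R"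
  by (simp_all add: biv_inner_def sum.distrib sum_distrib_left distrib_left mult.left_commute[of r])

lemma biv_inner_minus: "biv_inner (g x) S (- R) = - biv_inner (g x) S R"
  and biv_inner_diff: "biv_inner (g x) S (R - R') = biv_inner (g x) S R - biv_inner (g x) S R'"
  using biv_inner_scaleR[of x S "-1" R] biv_inner_scaleR[of x S "-1" R'] biv_inner_add[of x S R "- R'"] by simp_all

text \<open>\<open>cwedge\<close> is one half of a signed sum of four tensors. By skewness and
  complex linearity of \<open>S\<close> all four contribute the same amount, hence the factor
  2.\<close>

lemma biv_inner_cwedge:
  assumes "S \<in> K_dual (J x)"
  shows "biv_inner (g x) S (cwedge (J x) v w) = 2 * gpair x S v w"
proof -
  have "gpair x S (J x v) (J x w) = - gpair x S v w" for v w
    using gpair_K_dual(2)[OF assms, of v "J x w"] by (simp add: gpair_minus_right)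
  then show ?thesis
    using gpair_K_dual(1)[OF assms, of v w]
    by (simp add: cwedge_def ctensor_def biv_inner_diff biv_inner_scaleR biv_inner_tensor)
qed

text \<open>The frame has norm 1 and the fibre is a complex line, so the Hermitian product with the
  frame is the coordinate of the section. In this form the coordinate of a smooth section is smooth
  by contraction.\<close>

definition zcoef :: "'m u2chart \<Rightarrow> ('m \<Rightarrow> bivector) \<Rightarrow> 'm \<Rightarrow> complex" where
  "zcoef T s x = K_herm (g x) (J x) (s x) (K_frame J T x)"

context
  fixes T :: "'m u2chart" and x :: 'm
  assumes T: "u2_chart \<A> g J T" and x: "x \<in> fst T"
begin

lemma K_frame_eq: "K_frame J T x = cwedge (J x) (inv (snd T x) q1) (inv (snd T x) qj)"
  by (simp add: K_frame_def case_prod_beta)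

lemma K_frame_in_K_dual: "K_frame J T x \<in> K_dual (J x)"
  unfolding K_frame_eq by (rule cwedge_in_K_dual)

text \<open>Both parts become metric contractions: multiplying the frame by the complex structure
  amounts to applying \<open>J\<close> to its first factor.\<close>

lemma zcoef_gpair:
  assumes "s x \<in> K_dual (J x)"
  shows "zcoef T s x = Complex (2 * gpair x (s x) (inv (snd T x) q1) (inv (snd T x) qj))
    (2 * gpair x (s x) (J x (inv (snd T x) q1)) (inv (snd T x) qj))"
  unfolding zcoef_def K_herm_def K_frame_eq
  by (simp add: biv_inner_cwedge[OF assms] flip: cwedge_J_left)

lemma inv_u2_complex:
  "inv (snd T x) (quat a b c d) = (a *\<^sub>R inv (snd T x) q1 + b *\<^sub>R J x (inv (snd T x) q1))
     + (c *\<^sub>R inv (snd T x) qj + d *\<^sub>R J x (inv (snd T x) qj))"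
proof -
  note l = linear_inv_u2[OF T x]
  have "quat a b c d = (a *\<^sub>R q1 + b *\<^sub>R qmult qi q1) + (c *\<^sub>R qj + d *\<^sub>R qmult qi qj)"
    by (simp add: quat_eq_iff)
  then show ?thesis by (simp only: linear_add[OF l] linear_scale[OF l] J_inv_u2[OF T x])
qed

text \<open>Both vectors are expanded over the complex numbers in the unitary frame; the alternating
  product of two vectors in a complex plane is their determinant times that of the basis.\<close>

lemma cwedge_u2: "cwedge (J x) v w = cscale (J x) (cdet (snd T x v) (snd T x w)) (K_frame J T x)"
proof -
  define e f where "e = inv (snd T x) q1" and "f = inv (snd T x) qj"
  define C where "C \<zeta> v = Re \<zeta> *\<^sub>R v + Im \<zeta> *\<^sub>R J x v" for \<zeta> v
  have rep: "v = C (Complex (snd T x v $ 1) (snd T x v $ 2)) e + C (Complex (snd T x v $ 3) (snd T x v $ 4)) f" for v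
  proof -
    have "v = inv (snd T x) (quat (snd T x v $ 1) (snd T x v $ 2) (snd T x v $ 3) (snd T x v $ 4))"
    proof -
      have "quat (snd T x v $ 1) (snd T x v $ 2) (snd T x v $ 3) (snd T x v $ 4) = snd T x v"
        by (simp add: quat_eq_iff)
      then show ?thesis using inv_u2[OF T x] by simp
    qed
    from trans[OF this inv_u2_complex] show ?thesis by (simp add: C_def e_def f_def)
  qed
  have radd: "cwedge (J x) v (w + w') = cwedge (J x) v w + cwedge (J x) v w'" for v w w'
    using cwedge_add_left[of x w w' v] cwedge_skew[of x v] by (simp add: algebra_simps)
  have self: "cwedge (J x) v v = 0" for v
    by (simp add: cwedge_def)
  have CC: "cwedge (J x) (C \<zeta> v) (C \<xi> w) = cscale (J x) (\<zeta> * \<xi>) (cwedge (J x) v w)" for \<zeta> \<xi> v w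
    unfolding C_def cwedge_complex_left cwedge_complex_right cscale_cscale by (simp add: mult.commute)
  have z: "cscale (J x) \<zeta> 0 = 0" for \<zeta>
    by (simp add: cscale_def)
  have "cwedge (J x) v w = cwedge (J x) (C (Complex (snd T x v $ 1) (snd T x v $ 2)) e + C (Complex (snd T x v $ 3) (snd T x v $ 4)) f)
     (C (Complex (snd T x w $ 1) (snd T x w $ 2)) e + C (Complex (snd T x w $ 3) (snd T x w $ 4)) f)"
    using rep by metis
  also have "\<dots> = cscale (J x) (cdet (snd T x v) (snd T x w)) (cwedge (J x) e f)"
    using cwedge_skew[of x f e] cscale_minus
    by (simp add: cwedge_add_left radd CC self z cdet_def diff_conv_add_uminus cscale_add_left del: add_uminus_conv_diff)
      (simp add: cscale_def real_matrix_simps)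
  finally show ?thesis by (simp add: K_frame_eq e_def f_def)
qed

text \<open>That the fibre is a complex line: of the sixteen real components of a tensor, skewness
  and the symmetry under \<open>J\<close> leave only two independent ones, \<open>a\<close> and
  \<open>b\<close>.\<close>

lemma zcoef_K_dual:
  assumes "s x \<in> K_dual (J x)"
  shows "cscale (J x) (zcoef T s x) (K_frame J T x) = s x"
proof -
  define E where "E k = inv (snd T x) (axis k 1)" for k
  have ax: "u = (\<Sum>k\<in>UNIV. g x u (E k) *\<^sub>R E k)" for u
  proof -
    have "g x u (E k) = snd T x u $ k" for k
      using x by (simp add: E_def inner_axis u2_inv[OF T] flip: inner_u2[OF T])
    then show ?thesis
      using linear_R4_expand[OF linear_inv_u2[OF T x], of "snd T x u"] by (simp add: E_def inv_u2[OF T x])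
  qed
  have "s x $ p $ q = (\<Sum>j\<in>UNIV. \<Sum>k\<in>UNIV. gpair x (s x) (E j) (E k) * (E j $ p * E k $ q))" for p q
  proof -
    have d: "axis a 1 $ p = (\<Sum>j\<in>UNIV. g x (axis a 1) (E j) * E j $ p)" for a p
      using arg_cong[OF ax[of "axis a 1"], of "\<lambda>v. v $ p"] by simp
    have "s x $ p $ q = (\<Sum>a\<in>UNIV. \<Sum>b\<in>UNIV. s x $ a $ b * (axis a 1 $ p * axis b 1 $ q))"
      by (simp add: axis_def if_distrib[of "\<lambda>r. _ * r"] if_distrib[of "\<lambda>r. r * _"] cong: if_cong)
    also have "\<dots> = (\<Sum>a\<in>UNIV. \<Sum>b\<in>UNIV. \<Sum>j\<in>UNIV. \<Sum>k\<in>UNIV.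
        s x $ a $ b * (g x (axis a 1) (E j) * g x (axis b 1) (E k)) * (E j $ p * E k $ q))"
      unfolding d sum_product by (simp add: sum_distrib_left mult_ac)
    also have "\<dots> = (\<Sum>a\<in>UNIV. \<Sum>j\<in>UNIV. \<Sum>b\<in>UNIV. \<Sum>k\<in>UNIV.
        s x $ a $ b * (g x (axis a 1) (E j) * g x (axis b 1) (E k)) * (E j $ p * E k $ q))"
      by (intro sum.cong refl sum.swap)
    also have "\<dots> = (\<Sum>j\<in>UNIV. \<Sum>a\<in>UNIV. \<Sum>b\<in>UNIV. \<Sum>k\<in>UNIV.
        s x $ a $ b * (g x (axis a 1) (E j) * g x (axis b 1) (E k)) * (E j $ p * E k $ q))"
      by (rule sum.swap)
    also have "\<dots> = (\<Sum>j\<in>UNIV. \<Sum>a\<in>UNIV. \<Sum>k\<in>UNIV. \<Sum>b\<in>UNIV.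
        s x $ a $ b * (g x (axis a 1) (E j) * g x (axis b 1) (E k)) * (E j $ p * E k $ q))"
      by (intro sum.cong refl sum.swap)
    also have "\<dots> = (\<Sum>j\<in>UNIV. \<Sum>k\<in>UNIV. \<Sum>a\<in>UNIV. \<Sum>b\<in>UNIV.
        s x $ a $ b * (g x (axis a 1) (E j) * g x (axis b 1) (E k)) * (E j $ p * E k $ q))"
      by (intro sum.cong refl sum.swap)
    finally show ?thesis by (simp add: gpair_def bipair_def sum_distrib_right)
  qed
  then have exp: "s x = (\<Sum>j\<in>UNIV. \<Sum>k\<in>UNIV. gpair x (s x) (E j) (E k) *\<^sub>R tensor (E j) (E k))"
    by (simp add: vec_eq_iff tensor_def)
  define e f where "e = E 1" and "f = E 3"
  have E: "E 1 = e" "E 2 = J x e" "E 3 = f" "E 4 = J x f"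
    by (simp_all add: e_def f_def E_def axis_quat J_inv_u2[OF T x])
      (simp_all add: qmult_def)
  note sk = gpair_K_dual(1)[OF assms] and Jr = gpair_K_dual(2)[OF assms]
  define a b where "a = gpair x (s x) e f" and "b = gpair x (s x) (J x e) f"
  have self: "gpair x (s x) u u = 0" for u using sk[of u u] by simp
  have Js: "gpair x (s x) u (J x u) = 0" "gpair x (s x) (J x u) u = 0" for u
    using sk[of u "J x u"] Jr[of u u] by simp_all
  have JJ: "gpair x (s x) (J x u) (J x v) = - gpair x (s x) u v" for u v
    using Jr[of u "J x v"] by (simp add: gpair_minus_right)
  have P: "gpair x (s x) e (J x f) = b" "gpair x (s x) f e = - a" "gpair x (s x) (J x f) e = - b"
    "gpair x (s x) f (J x e) = - b" "gpair x (s x) e f = a" "gpair x (s x) (J x e) f = b"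
    using sk[of f e] sk[of "J x f" e] sk[of f "J x e"] Jr[of e f] by (simp_all add: a_def b_def)
  \<comment> \<open>The factors 2 compensate the 1/2 contained in \<open>ctensor\<close>.\<close>
  have "s x = cscale (J x) (Complex (2 * a) (2 * b)) (cwedge (J x) e f)"
    unfolding cscale_def cwedge_J_left[symmetric]
    by (subst exp) (simp add: sum_4 E self Js JJ P cwedge_def ctensor_def tensor_simps algebra_simps)
  moreover have "inv (snd T x) q1 = e" "inv (snd T x) qj = f"
    by (simp_all add: e_def f_def E_def axis_quat)
  ultimately show ?thesis
    using zcoef_gpair[of s, OF assms] by (simp add: K_frame_eq a_def b_def)
qed

lemma zcoef_cscale:
  assumes "s x = cscale (J x) \<zeta> S" "S \<in> K_dual (J x)"
  shows "zcoef T s x = \<zeta> * zcoef T (\<lambda>_. S) x"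
proof -
  have "s x \<in> K_dual (J x)" using assms cscale_in_K_dual by simp
  from zcoef_gpair[of s, OF this] zcoef_gpair[of "\<lambda>_. S", OF assms(2)] show ?thesis
    by (simp add: assms(1) cscale_def gpair_add gpair_scaleR gpair_J gpair_minus_left complex_eq_iff algebra_simps)
qed

lemma zcoef_K_frame: "zcoef T (K_frame J T) x = 1"
proof -
  have o: "inv (snd T x) q1 = E1 \<Longrightarrow> inv (snd T x) qj = E3 \<Longrightarrow>
    g x E1 E1 = 1 \<and> g x E3 E3 = 1 \<and> g x E1 E3 = 0 \<and> g x E1 (J x E3) = 0 \<and> g x E3 E1 = 0 \<and>
    g x (J x E1) E3 = 0 \<and> g x (J x E3) E1 = 0 \<and> g x E3 (J x E1) = 0" for E1 E3
    using J_inv_u2[OF T x] g_inv_u2[OF T x] by (auto simp: inner_quat)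
  show ?thesis
    using o[OF refl refl] zcoef_gpair[of "K_frame J T", OF K_frame_in_K_dual]
    unfolding K_frame_eq
    by (simp add: cwedge_def ctensor_def gpair_diff gpair_scaleR gpair_tensor complex_eq_iff)
qed

lemma zcoef_cscale_K_frame: "s x = cscale (J x) \<zeta> (K_frame J T x) \<Longrightarrow> zcoef T s x = \<zeta>"
  using zcoef_cscale[of s \<zeta> "K_frame J T x"] K_frame_in_K_dual zcoef_K_frame by (simp add: zcoef_def)

lemma cscale_K_frame_inject:
  "cscale (J x) \<zeta> (K_frame J T x) = cscale (J x) \<xi> (K_frame J T x) \<Longrightarrow> \<zeta> = \<xi>"
  using zcoef_cscale_K_frame[of "\<lambda>_. cscale (J x) \<zeta> (K_frame J T x)" \<zeta>]
    zcoef_cscale_K_frame[of "\<lambda>_. cscale (J x) \<zeta> (K_frame J T x)" \<xi>] by simp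

lemma K_herm_zcoef:
  assumes "s x \<in> K_dual (J x)" "t x \<in> K_dual (J x)"
  shows "K_herm (g x) (J x) (s x) (t x) = zcoef T s x * cnj (zcoef T t x)"
proof -
  let ?K = "K_frame J T x"
  have "K_herm (g x) (J x) (s x) (cscale (J x) \<zeta> ?K) = zcoef T s x * cnj \<zeta>" for \<zeta>
    by (simp add: zcoef_def K_herm_def cscale_def real_matrix_simps matrix_J_J
        biv_inner_add biv_inner_diff biv_inner_scaleR biv_inner_minus complex_eq_iff)
  then show ?thesis using zcoef_K_dual[of t, OF assms(2)] by metis
qed

lemma zcoef_add:
  assumes "s x \<in> K_dual (J x)" "t x \<in> K_dual (J x)"
  shows "zcoef T (\<lambda>y. s y + t y) x = zcoef T s x + zcoef T t x"
  using zcoef_gpair[of s, OF assms(1)] zcoef_gpair[of t, OF assms(2)] zcoef_gpair[of "\<lambda>y. s y + t y"] K_dual_add[OF assms]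
  by (simp add: gpair_add complex_eq_iff)

end

end



section \<open>Unitary connections\<close>

context almost_hermitian
begin

definition K_coord :: "'m chart \<Rightarrow> ('m \<Rightarrow> bivector) \<Rightarrow> R4 \<Rightarrow> bivector" where
  "K_coord c s p = matrix (dcoord \<A> c (point c p)) ** s (point c p) ** transpose (matrix (dcoord \<A> c (point c p)))"

lemma smooth_K_section_iff:
  "smooth_K_section \<A> J U s \<longleftrightarrow> (\<forall>x\<in>U. s x \<in> K_dual (J x)) \<and>
     (\<forall>c\<in>\<A>. smooth_on (coord c ` (U \<inter> cdom c)) (K_coord c s))"
  unfolding smooth_K_section_def K_coord_def[abs_def] Let_def ..

lemma smooth_K_in_K_dual: "smooth_K_section \<A> J U s \<Longrightarrow> x \<in> U \<Longrightarrow> s x \<in> K_dual (J x)"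
  unfolding smooth_K_section_iff by blast

lemma smooth_KD: "smooth_K_section \<A> J U s \<Longrightarrow> c \<in> \<A> \<Longrightarrow> smooth_on (coord c ` (U \<inter> cdom c)) (K_coord c s)"
  unfolding smooth_K_section_iff by blast

lemma smooth_K_subset: "smooth_K_section \<A> J U s \<Longrightarrow> V \<subseteq> U \<Longrightarrow> smooth_K_section \<A> J V s"
  unfolding smooth_K_section_iff by (meson Int_mono image_mono order_refl smooth_on_subset subsetD)

lemma smooth_K_cong:
  assumes "open U" "\<And>x. x \<in> U \<Longrightarrow> s x = t x" "smooth_K_section \<A> J U s"
  shows "smooth_K_section \<A> J U t"
  unfolding smooth_K_section_iff
proof (intro conjI ballI)
  show "t x \<in> K_dual (J x)" if "x \<in> U" for x
    using smooth_K_in_K_dual[OF assms(3) that] assms(2)[OF that] by simp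
  fix c assume c: "c \<in> \<A>"
  show "smooth_on (coord c ` (U \<inter> cdom c)) (K_coord c t)"
    by (rule smooth_on_cong[OF open_coord_image[OF c assms(1)] _ smooth_KD[OF assms(3) c]])
      (use assms c in \<open>auto simp: K_coord_def\<close>)
qed

lemma smooth_K_local:
  assumes "open U" "\<And>x. x \<in> U \<Longrightarrow> \<exists>V. open V \<and> x \<in> V \<and> smooth_K_section \<A> J (U \<inter> V) s"
  shows "smooth_K_section \<A> J U s"
  unfolding smooth_K_section_iff
proof (intro conjI ballI)
  show "s x \<in> K_dual (J x)" if "x \<in> U" for x
    using assms(2)[OF that] smooth_K_in_K_dual that by blast
  fix c assume c: "c \<in> \<A>"
  show "smooth_on (coord c ` (U \<inter> cdom c)) (K_coord c s)"
    by (rule smooth_on_local_chart[OF assms(1) _ c]) (meson assms(2) smooth_KD c)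
qed

lemma smooth_K_cwedge:
  assumes U: "open U" and v: "smooth_vf \<A> U v" and w: "smooth_vf \<A> U w"
  shows "smooth_K_section \<A> J U (\<lambda>x. cwedge (J x) (v x) (w x))"
  unfolding smooth_K_section_iff
proof (intro conjI ballI cwedge_in_K_dual)
  fix c assume c: "c \<in> \<A>"
  let ?S = "coord c ` (U \<inter> cdom c)"
  have o: "open ?S" using open_coord_image[OF c U] .
  have bb: "bounded_bilinear tensor"
    using bilinear_tensor bilinear_conv_bounded_bilinear by blast
  have t: "smooth_on ?S (\<lambda>p. tensor (vf_coord \<A> c X p) (vf_coord \<A> c Y p))"
    if "smooth_vf \<A> U X" "smooth_vf \<A> U Y" for X Y
    by (rule smooth_on_bilinear[OF bb o smooth_vfD[OF that(1) c] smooth_vfD[OF that(2) c]])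
  define t' where "t' X Y p = tensor (vf_coord \<A> c X p) (vf_coord \<A> c Y p)" for X Y p
  note Jv = smooth_J[OF U v] and Jw = smooth_J[OF U w]
  have t: "smooth_on ?S (t' X Y)" if "smooth_vf \<A> U X" "smooth_vf \<A> U Y" for X Y
    using t[OF that] by (simp add: t'_def[abs_def])
  have m: "smooth_on ?S (\<lambda>p. r *\<^sub>R f p)" if "smooth_on ?S f" for r :: real and f :: "R4 \<Rightarrow> bivector"
    by (rule smooth_on_linear[OF bounded_linear_scaleR_right o that])
  have 1: "smooth_on ?S (\<lambda>p. ((1/2) *\<^sub>R t' v w p + (-1/2) *\<^sub>R t' (\<lambda>x. J x (v x)) (\<lambda>x. J x (w x)) p)
     + ((-1/2) *\<^sub>R t' w v p + (1/2) *\<^sub>R t' (\<lambda>x. J x (w x)) (\<lambda>x. J x (v x)) p))"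
    by (intro smooth_on_add o m t v w Jv Jw)
  show "smooth_on ?S (K_coord c (\<lambda>x. cwedge (J x) (v x) (w x)))"
  proof (rule smooth_on_cong[OF o _ 1])
    fix p assume "p \<in> ?S"
    then have x: "point c p \<in> cdom c" using c by auto
    note l = linear_dcoord[OF c x]
    show "((1/2) *\<^sub>R t' v w p + (-1/2) *\<^sub>R t' (\<lambda>x. J x (v x)) (\<lambda>x. J x (w x)) p)
     + ((-1/2) *\<^sub>R t' w v p + (1/2) *\<^sub>R t' (\<lambda>x. J x (w x)) (\<lambda>x. J x (v x)) p)
      = K_coord c (\<lambda>x. cwedge (J x) (v x) (w x)) p"
      by (simp add: K_coord_def cwedge_def ctensor_def real_matrix_simps matrix_mult_tensor[OF l]
          tensor_mult_transpose[OF l] t'_def vf_coord_def algebra_simps)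
  qed
qed

text \<open>In a chart this is the contraction of the smooth components \<open>K_coord\<close> with
  inner products of coordinate fields; the differential of the chart acting on the bivector cancels
  its inverse in the covectors.\<close>

lemma smooth_gpair:
  assumes U: "open U" and s: "smooth_K_section \<A> J U s" and v: "smooth_vf \<A> U v" and w: "smooth_vf \<A> U w"
  shows "smooth_fun \<A> U (\<lambda>x. gpair x (s x) (v x) (w x))"
  unfolding smooth_fun_def
proof
  fix c assume c: "c \<in> \<A>"
  let ?S = "coord c ` (U \<inter> cdom c)"
  have o: "open ?S" using open_coord_image[OF c U] .
  define G where "G X a x = g x (coord_field c (axis a 1) x) (X x)" for X :: "'m vfield" and a :: 4 and x
  have G: "smooth_on ?S (G X a \<circ> point c)" if "smooth_vf \<A> U X" for X a
  proof -
    have "smooth_fun \<A> (U \<inter> cdom c) (G X a)"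
      unfolding G_def[abs_def]
      by (rule smooth_g[OF open_Int[OF U open_cdom[OF c]] smooth_vf_subset[OF smooth_coord_field[OF c]] smooth_vf_subset[OF that]]) auto
    from smooth_funD[OF this c] show ?thesis by (simp add: Int_assoc)
  qed
  have "smooth_on ?S (\<lambda>p. \<Sum>a\<in>UNIV. \<Sum>b\<in>UNIV. K_coord c s p $ a $ b * ((G v a \<circ> point c) p * (G w b \<circ> point c) p))"
    by (intro smooth_on_sum[OF o] smooth_on_bilinear[OF bounded_bilinear_mult o] G v w
        smooth_on_linear[OF bounded_linear_vec_nth o] smooth_KD[OF s c])
  then show "smooth_on ?S ((\<lambda>x. gpair x (s x) (v x) (w x)) \<circ> point c)"
  proof (rule smooth_on_cong[OF o, rotated])
    fix p assume "p \<in> ?S"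
    then obtain x where x: "x \<in> U" "x \<in> cdom c" "p = coord c x" by auto
    have px: "point c p = x" using x c by simp
    note l = linear_dcoord[OF c x(2)] and li = linear_inv_dcoord[OF c x(2)]
    have lg: "linear (\<lambda>u. g x (inv (dcoord \<A> c x) u) X)" for X
      using linear_compose[OF li linear_g_left] by (simp add: comp_def)
    have "(\<Sum>a\<in>UNIV. \<Sum>b\<in>UNIV. K_coord c s p $ a $ b * ((G v a \<circ> point c) p * (G w b \<circ> point c) p))
      = bipair (K_coord c s p) (\<lambda>u. g x (inv (dcoord \<A> c x) u) (v x)) (\<lambda>u. g x (inv (dcoord \<A> c x) u) (w x))"
      by (simp add: bipair_def G_def px coord_field_def)
    also have "\<dots> = gpair x (s x) (v x) (w x)"
      unfolding K_coord_def px bipair_mult_right[OF l lg] bipair_mult_left[OF l lg]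
      using inv_dcoord[OF c x(2)] by (simp add: gpair_def)
    finally show "(\<Sum>a\<in>UNIV. \<Sum>b\<in>UNIV. K_coord c s p $ a $ b * ((G v a \<circ> point c) p * (G w b \<circ> point c) p))
      = ((\<lambda>x. gpair x (s x) (v x) (w x)) \<circ> point c) p"
      using px by simp
  qed
qed

lemma smooth_fun_Complex:
  assumes "open U" "smooth_fun \<A> U a" "smooth_fun \<A> U b"
  shows "smooth_fun \<A> U (\<lambda>x. Complex (a x) (b x))"
proof -
  have "smooth_fun \<A> U (\<lambda>x. a x *\<^sub>R 1 + b x *\<^sub>R \<i>)"
    by (intro smooth_fun_add smooth_fun_scaleR assms smooth_fun_const)
  moreover have "Complex (a x) (b x) = a x *\<^sub>R 1 + b x *\<^sub>R \<i>" for x by (simp add: complex_eq_iff)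
  ultimately show ?thesis by simp
qed

context
  fixes T :: "'m u2chart"
  assumes T: "u2_chart \<A> g J T"
begin

lemma smooth_zcoef:
  assumes U: "open U" and s: "smooth_K_section \<A> J U s"
  shows "smooth_fun \<A> (U \<inter> fst T) (zcoef T s)"
proof (rule smooth_fun_cong)
  let ?W = "U \<inter> fst T"
  show W: "open ?W" using U u2_open[OF T] by blast
  have E: "smooth_vf \<A> ?W (\<lambda>x. inv (snd T x) q)" for q
    by (rule smooth_vf_subset[OF smooth_u2_frame[OF T]]) auto
  have s': "smooth_K_section \<A> J ?W s" by (rule smooth_K_subset[OF s]) auto
  show "smooth_fun \<A> ?W (\<lambda>x. Complex (2 * gpair x (s x) (inv (snd T x) q1) (inv (snd T x) qj))
    (2 * gpair x (s x) (J x (inv (snd T x) q1)) (inv (snd T x) qj)))"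
    by (intro smooth_fun_Complex smooth_fun_mult smooth_fun_const smooth_gpair W s' E smooth_J)
  fix x assume "x \<in> ?W"
  then show "Complex (2 * gpair x (s x) (inv (snd T x) q1) (inv (snd T x) qj))
    (2 * gpair x (s x) (J x (inv (snd T x) q1)) (inv (snd T x) qj)) = zcoef T s x"
    using zcoef_gpair[OF T, of x s] smooth_K_in_K_dual[OF s, of x] by simp
qed

text \<open>Writes a complex multiple of the frame as a wedge product of two smooth vector fields.
  Every section is thus locally a wedge product, and a connection on the line bundle can be compared
  with one on the tangent bundle.\<close>

definition K_left :: "('m \<Rightarrow> complex) \<Rightarrow> 'm vfield" where
  "K_left z y = Re (z y) *\<^sub>R inv (snd T y) q1 + Im (z y) *\<^sub>R J y (inv (snd T y) q1)"

lemma cscale_K_frame_cwedge: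
  "cscale (J y) (z y) (K_frame J T y) = cwedge (J y) (K_left z y) (inv (snd T y) qj)"
  unfolding K_left_def K_frame_def by (simp add: cwedge_complex_left case_prod_beta)

lemma smooth_K_left:
  assumes V: "open V" and z: "smooth_fun \<A> V z"
  shows "smooth_vf \<A> (V \<inter> fst T) (K_left z)"
proof -
  have W: "open (V \<inter> fst T)" using V u2_open[OF T] by blast
  have z': "smooth_fun \<A> (V \<inter> fst T) z" by (rule smooth_fun_subset[OF z]) auto
  have E: "smooth_vf \<A> (V \<inter> fst T) (\<lambda>x. inv (snd T x) q)" for q
    by (rule smooth_vf_subset[OF smooth_u2_frame[OF T]]) auto
  show ?thesis unfolding K_left_def[abs_def]
    by (intro smooth_vf_add smooth_vf_scaleR W E smooth_J smooth_fun_linear[OF bounded_linear_Re W z']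
        smooth_fun_linear[OF bounded_linear_Im W z'])
qed

lemma smooth_K_cscale_frame:
  assumes V: "open V" and z: "smooth_fun \<A> V z"
  shows "smooth_K_section \<A> J (V \<inter> fst T) (\<lambda>y. cscale (J y) (z y) (K_frame J T y))"
  unfolding cscale_K_frame_cwedge
  by (rule smooth_K_cwedge[OF open_Int[OF V u2_open[OF T]] smooth_K_left[OF V z] smooth_vf_subset[OF smooth_u2_frame[OF T]]]) auto

lemma K_section_cwedge:
  assumes "smooth_K_section \<A> J U s" "y \<in> U \<inter> fst T"
  shows "s y = cwedge (J y) (K_left (zcoef T s) y) (inv (snd T y) qj)"
proof -
  have "s y \<in> K_dual (J y)" using smooth_K_in_K_dual[OF assms(1)] assms(2) by simp
  then show ?thesis
    unfolding cscale_K_frame_cwedge[symmetric] using zcoef_K_dual[OF T, of y s] assms(2) by simp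
qed

end

end

definition (in oriented_manifold) one_form :: "('m \<Rightarrow> R4 \<Rightarrow> real) \<Rightarrow> bool" where
  "one_form \<beta> \<longleftrightarrow> (\<forall>x. linear (\<beta> x)) \<and>
     (\<forall>U X. open U \<longrightarrow> smooth_vf \<A> U X \<longrightarrow> smooth_fun \<A> U (\<lambda>x. \<beta> x (X x)))"

context hermitian_levi_civita
begin

text \<open>The connection on \<open>K\<^sup>*\<close> with form \<open>aplus\<^sub>i + \<beta>\<close>, where \<open>aplus\<^sub>i\<close>, the \<open>i\<close>-component of \<open>aplus\<close>, belongs to the
  connection induced by the Hermitian part of \<open>nabla\<close>.\<close>

definition kval :: "'m u2chart \<Rightarrow> ('m \<Rightarrow> R4 \<Rightarrow> real) \<Rightarrow> 'm kconn" where
  "kval T \<beta> s x v = cscale (J x)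
     (dir_deriv \<A> (zcoef T s) x v + 2 * \<i> * of_real (aplus T x v $ 2 + \<beta> x v) * zcoef T s x) (K_frame J T x)"

text \<open>The selected chart may jump with \<open>x\<close>; this is harmless because
  \<open>kval\<close> turns out to be independent of the chart.\<close>

definition kconn :: "('m \<Rightarrow> R4 \<Rightarrow> real) \<Rightarrow> 'm kconn" where
  "kconn \<beta> s x v = kval (u2_chart_at \<A> g J x) \<beta> s x v"

lemma kval_cong:
  assumes T: "u2_chart \<A> g J T" and U: "open U" "x \<in> U" "x \<in> fst T"
    and s: "smooth_K_section \<A> J U s" and eq: "\<And>y. y \<in> U \<Longrightarrow> s y = t y"
  shows "kval T \<beta> t x v = kval T \<beta> s x v"
proof -
  have z: "zcoef T t y = zcoef T s y" if "y \<in> U" for y using eq[OF that] by (simp add: zcoef_def)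
  have "dir_deriv \<A> (zcoef T t) x v = dir_deriv \<A> (zcoef T s) x v"
    by (rule dir_deriv_cong[OF _ _ _ smooth_zcoef[OF T U(1) s]]) (use U u2_open[OF T] z in auto)
  then show ?thesis using z[OF U(2)] by (simp add: kval_def)
qed

text \<open>The Leibniz rule for \<open>nabla_herm\<close>, twisted by \<beta>. Its right-hand side
  mentions no chart, which is what makes the local definitions agree.\<close>

lemma kval_cwedge:
  assumes T: "u2_chart \<A> g J T" and V: "open V" "x \<in> V" "x \<in> fst T"
    and w: "smooth_vf \<A> V w1" "smooth_vf \<A> V w2"
  shows "kval T \<beta> (\<lambda>y. cwedge (J y) (w1 y) (w2 y)) x v =
    cwedge (J x) (nabla_herm w1 x v) (w2 x) + cwedge (J x) (w1 x) (nabla_herm w2 x v)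
    + cscale (J x) (2 * \<i> * of_real (\<beta> x v)) (cwedge (J x) (w1 x) (w2 x))"
proof -
  let ?z = "zcoef T (\<lambda>y. cwedge (J y) (w1 y) (w2 y))"
  let ?W = "V \<inter> fst T"
  have W: "open ?W" "x \<in> ?W" using V u2_open[OF T] by auto
  note s = smooth_u2[OF T V(1)]
  have z: "?z y = cdet (snd T y (w1 y)) (snd T y (w2 y))" if "y \<in> fst T" for y
    by (rule zcoef_cscale_K_frame[OF T that]) (rule cwedge_u2[OF T that])
  have "dir_deriv \<A> ?z x v = dir_deriv \<A> (\<lambda>y. cdet (snd T y (w1 y)) (snd T y (w2 y))) x v"
    by (rule dir_deriv_cong[OF W _ smooth_fun_bilinear[OF bounded_bilinear_cdet W(1) s[OF w(1)] s[OF w(2)]]])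
      (use z in auto)
  also have "\<dots> = cdet (snd T x (w1 x)) (dir_deriv \<A> (\<lambda>y. snd T y (w2 y)) x v)
     + cdet (dir_deriv \<A> (\<lambda>y. snd T y (w1 y)) x v) (snd T x (w2 x))"
    by (rule dir_deriv_bilinear[OF bounded_bilinear_cdet s[OF w(1)] s[OF w(2)] W(2)])
  finally have d: "dir_deriv \<A> ?z x v = cdet (snd T x (w1 x)) (dir_deriv \<A> (\<lambda>y. snd T y (w2 y)) x v)
     + cdet (dir_deriv \<A> (\<lambda>y. snd T y (w1 y)) x v) (snd T x (w2 x))" .
  \<comment> \<open>Right multiplication by an imaginary quaternion lies in su(2) and does not
    affect the determinant. Left multiplication by i acts once on each of the two columns, whence
    the factor 2 in the connection form.\<close>
  have id: "cdet y1 d2 + cdet d1 y2 + 2 * \<i> * of_real (a + b) * cdet y1 y2 =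
     cdet (d1 + a *\<^sub>R qmult qi y1 - qmult y1 m) y2 + cdet y1 (d2 + a *\<^sub>R qmult qi y2 - qmult y2 m)
     + 2 * \<i> * of_real b * cdet y1 y2" if "m $ 1 = 0" for y1 y2 d1 d2 m a b
    using that by (simp add: cdet_def complex_eq_iff algebra_simps)
  have "aminus T x v $ 1 = 0" by (simp add: aminus_def)
  from id[OF this] have "dir_deriv \<A> ?z x v + 2 * \<i> * of_real (aplus T x v $ 2 + \<beta> x v) * ?z x =
     cdet (snd T x (nabla_herm w1 x v)) (snd T x (w2 x)) + cdet (snd T x (w1 x)) (snd T x (nabla_herm w2 x v))
     + 2 * \<i> * of_real (\<beta> x v) * cdet (snd T x (w1 x)) (snd T x (w2 x))"
    unfolding d z[OF V(3)] nabla_herm_u2[OF T V(1) w(1) V(2,3)] nabla_herm_u2[OF T V(1) w(2) V(2,3)] .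
  then show ?thesis
    unfolding kval_def by (simp only: cscale_add_left cwedge_u2[OF T V(3)] cscale_cscale)
qed

text \<open>Near \<open>x\<close> the section is a wedge product of vector fields built from
  \<open>T\<close>; for this product both charts give the same chart-free expression.\<close>

lemma kval_independent:
  assumes T: "u2_chart \<A> g J T" "x \<in> fst T" and T': "u2_chart \<A> g J T'" "x \<in> fst T'"
    and U: "open U" "x \<in> U" and s: "smooth_K_section \<A> J U s"
  shows "kval T \<beta> s x v = kval T' \<beta> s x v"
proof -
  let ?w1 = "K_left T (zcoef T s)" and ?w2 = "\<lambda>y. inv (snd T y) qj"
  let ?V = "U \<inter> fst T"
  have V: "open ?V" "x \<in> ?V" using U T u2_open[OF T(1)] by auto
  have w1: "smooth_vf \<A> ?V ?w1"
    using smooth_K_left[OF T(1) V(1) smooth_zcoef[OF T(1) U(1) s]] by (simp add: Int_assoc)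
  have w2: "smooth_vf \<A> ?V ?w2" by (rule smooth_vf_subset[OF smooth_u2_frame[OF T(1)]]) auto
  have eq: "cwedge (J y) (?w1 y) (?w2 y) = s y" if "y \<in> ?V" for y
    using K_section_cwedge[OF T(1) s that] by simp
  have "kval R \<beta> s x v = cwedge (J x) (nabla_herm ?w1 x v) (?w2 x) + cwedge (J x) (?w1 x) (nabla_herm ?w2 x v)
    + cscale (J x) (2 * \<i> * of_real (\<beta> x v)) (cwedge (J x) (?w1 x) (?w2 x))"
    if R: "u2_chart \<A> g J R" "x \<in> fst R" for R
    using kval_cong[OF R(1) V R(2) smooth_K_cwedge[OF V(1) w1 w2] eq] kval_cwedge[OF R(1) V R(2) w1 w2] by simp
  then show ?thesis using T T' by simp
qed

lemma kconn_eq_kval: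
  assumes "u2_chart \<A> g J T" "x \<in> fst T" "open U" "x \<in> U" "smooth_K_section \<A> J U s"
  shows "kconn \<beta> s x v = kval T \<beta> s x v"
  unfolding kconn_def using kval_independent[OF u2_chart_at assms] .

lemma smooth_kconn:
  assumes \<beta>: "one_form \<beta>" and U: "open U" and s: "smooth_K_section \<A> J U s" and X: "smooth_vf \<A> U X"
  shows "smooth_K_section \<A> J U (\<lambda>x. kconn \<beta> s x (X x))"
proof (rule smooth_K_local[OF U])
  fix x0 assume x0: "x0 \<in> U"
  define T where "T = u2_chart_at \<A> g J x0"
  have T: "u2_chart \<A> g J T" "x0 \<in> fst T" using u2_chart_at T_def by auto
  let ?V = "U \<inter> fst T"
  have V: "open ?V" using U u2_open[OF T(1)] by auto
  have X': "smooth_vf \<A> ?V X" by (rule smooth_vf_subset[OF X]) auto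
  have b: "smooth_fun \<A> ?V (\<lambda>x. \<beta> x (X x))"
    using \<beta> V X' unfolding one_form_def by blast
  have a: "smooth_fun \<A> ?V (\<lambda>x. aplus T x (X x) $ 2)"
    using smooth_fun_inner[OF V smooth_aplus[OF T(1) U X] smooth_fun_const, of "axis 2 1"] by (simp add: inner_axis)
  note z = smooth_zcoef[OF T(1) U s]
  define \<zeta> where "\<zeta> x = dir_deriv \<A> (zcoef T s) x (X x) + 2 * \<i> * of_real (aplus T x (X x) $ 2 + \<beta> x (X x)) * zcoef T s x" for x
  have "smooth_fun \<A> ?V \<zeta>"
    unfolding \<zeta>_def
    by (intro smooth_fun_add smooth_fun_mult V smooth_dir_deriv z X' smooth_fun_const
        smooth_fun_linear[OF bounded_linear_of_real V] a b)
  from smooth_K_cscale_frame[OF T(1) V this]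
  have 1: "smooth_K_section \<A> J ?V (\<lambda>y. cscale (J y) (\<zeta> y) (K_frame J T y))" by (simp add: Int_assoc)
  have "smooth_K_section \<A> J ?V (\<lambda>x. kconn \<beta> s x (X x))"
    by (rule smooth_K_cong[OF V _ 1])
      (use kconn_eq_kval[OF T(1) _ U _ s] in \<open>auto simp: kval_def \<zeta>_def\<close>)
  then show "\<exists>V. open V \<and> x0 \<in> V \<and> smooth_K_section \<A> J (U \<inter> V) (\<lambda>x. kconn \<beta> s x (X x))"
    using u2_open[OF T(1)] T(2) by blast
qed

lemma linear_kconn:
  assumes \<beta>: "linear (\<beta> x)" and U: "open U" "x \<in> U" and s: "smooth_K_section \<A> J U s"
  shows "linear (kconn \<beta> s x)"
proof -
  define T where "T = u2_chart_at \<A> g J x"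
  have T: "u2_chart \<A> g J T" "x \<in> fst T" using u2_chart_at T_def by auto
  have d: "linear (dir_deriv \<A> (zcoef T s) x)"
    using linear_dir_deriv[OF smooth_zcoef[OF T(1) U(1) s]] U T by blast
  have a: "linear (aplus T x)" using linear_aplus[OF T] .
  show ?thesis
    unfolding linear_iff kconn_def kval_def T_def[symmetric] cscale_add_left[symmetric] cscale_scaleR[symmetric]
    by (auto simp: linear_add[OF d] linear_add[OF a] linear_add[OF \<beta>] linear_scale[OF d] linear_scale[OF a]
        linear_scale[OF \<beta>] intro!: arg_cong[where f = "\<lambda>z. cscale (J x) z _"]) (simp_all add: scaleR_conv_of_real algebra_simps)
qed

lemma unitary_connection_kconn:
  assumes \<beta>: "one_form \<beta>"
  shows "unitary_connection \<A> g J (kconn \<beta>)"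
  unfolding unitary_connection_def
proof (intro allI impI conjI ballI)
  fix U s assume U: "open U" and s: "smooth_K_section \<A> J U s"
  show "linear (kconn \<beta> s x)" if "x \<in> U" for x
    using linear_kconn[OF _ U that s] \<beta> unfolding one_form_def by blast
  show "smooth_K_section \<A> J U (\<lambda>x. kconn \<beta> s x (X x))" if "smooth_vf \<A> U X" for X
    by (rule smooth_kconn[OF \<beta> U s that])
  show "kconn \<beta> t x = kconn \<beta> s x" if "\<forall>y\<in>U. t y = s y" "x \<in> U" for t x
  proof
    show "kconn \<beta> t x v = kconn \<beta> s x v" for v
      unfolding kconn_def
      by (rule kval_cong[OF u2_chart_at(1) U that(2) u2_chart_at(2) s]) (use that(1) in simp)
  qed
  fix x v assume x: "x \<in> U"
  define T where "T = u2_chart_at \<A> g J x"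
  have T: "u2_chart \<A> g J T" "x \<in> fst T" using u2_chart_at T_def by auto
  let ?W = "U \<inter> fst T"
  have W: "open ?W" "x \<in> ?W" using U x T u2_open[OF T(1)] by auto
  have K: "kconn \<beta> r x v = cscale (J x)
     (dir_deriv \<A> (zcoef T r) x v + 2 * \<i> * of_real (aplus T x v $ 2 + \<beta> x v) * zcoef T r x) (K_frame J T x)" for r
    by (simp add: kconn_def kval_def T_def)
  have Kx: "K_frame J T x \<in> K_dual (J x)" by (rule K_frame_in_K_dual[OF T])
  note zs = smooth_zcoef[OF T(1) U s]
  show "kconn \<beta> (\<lambda>y. s y + t y) x v = kconn \<beta> s x v + kconn \<beta> t x v" if t: "smooth_K_section \<A> J U t" for t
  proof -
    note zt = smooth_zcoef[OF T(1) U t]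
    have z: "zcoef T (\<lambda>y. s y + t y) y = zcoef T s y + zcoef T t y" if "y \<in> ?W" for y
      using that smooth_K_in_K_dual[OF s] smooth_K_in_K_dual[OF t] by (intro zcoef_add[OF T(1)]) auto
    have "dir_deriv \<A> (zcoef T (\<lambda>y. s y + t y)) x v = dir_deriv \<A> (\<lambda>y. zcoef T s y + zcoef T t y) x v"
      by (rule dir_deriv_cong[OF W _ smooth_fun_add[OF W(1) zs zt]]) (use z in auto)
    also have "\<dots> = dir_deriv \<A> (zcoef T s) x v + dir_deriv \<A> (zcoef T t) x v"
      by (rule dir_deriv_add[OF zs zt W(2)])
    finally show ?thesis
      using z[OF W(2)] by (simp add: K algebra_simps flip: cscale_add_left)
  qed
  show "kconn \<beta> (\<lambda>y. cscale (J y) (f y) (s y)) x v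
     = cscale (J x) (dir_deriv \<A> f x v) (s x) + cscale (J x) (f x) (kconn \<beta> s x v)"
    if f: "smooth_fun \<A> U f" for f :: "'m \<Rightarrow> complex"
  proof -
    have f': "smooth_fun \<A> ?W f" by (rule smooth_fun_subset[OF f]) auto
    have z: "zcoef T (\<lambda>y. cscale (J y) (f y) (s y)) y = f y * zcoef T s y" if "y \<in> ?W" for y
    proof -
      have y: "y \<in> fst T" "s y \<in> K_dual (J y)" using that smooth_K_in_K_dual[OF s] by auto
      show ?thesis
        using zcoef_cscale[OF T(1) y(1), of "\<lambda>y. cscale (J y) (f y) (s y)" "f y" "s y"] y by (simp add: zcoef_def)
    qed
    have "dir_deriv \<A> (zcoef T (\<lambda>y. cscale (J y) (f y) (s y))) x v = dir_deriv \<A> (\<lambda>y. f y * zcoef T s y) x v"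
      by (rule dir_deriv_cong[OF W _ smooth_fun_mult[OF W(1) f' zs]]) (use z in auto)
    also have "\<dots> = f x * dir_deriv \<A> (zcoef T s) x v + dir_deriv \<A> f x v * zcoef T s x"
      by (rule dir_deriv_bilinear[OF bounded_bilinear_mult f' zs W(2)])
    finally have "kconn \<beta> (\<lambda>y. cscale (J y) (f y) (s y)) x v
      = cscale (J x) (dir_deriv \<A> f x v) (cscale (J x) (zcoef T s x) (K_frame J T x)) + cscale (J x) (f x) (kconn \<beta> s x v)"
      using z[OF W(2)] by (simp add: K cscale_cscale algebra_simps flip: cscale_add_left)
    then show ?thesis using zcoef_K_dual[OF T, of s] smooth_K_in_K_dual[OF s x] by simp
  qed
  show "dir_deriv \<A> (\<lambda>y. K_herm (g y) (J y) (s y) (t y)) x v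
     = K_herm (g x) (J x) (kconn \<beta> s x v) (t x) + K_herm (g x) (J x) (s x) (kconn \<beta> t x v)"
    if t: "smooth_K_section \<A> J U t" for t
  proof -
    note zt = smooth_zcoef[OF T(1) U t]
    have zt': "smooth_fun \<A> ?W (\<lambda>y. cnj (zcoef T t y))"
      by (rule smooth_fun_linear[OF bounded_linear_cnj W(1) zt])
    have kz: "zcoef T (\<lambda>y. kconn \<beta> r y v) x = dir_deriv \<A> (zcoef T r) x v + 2 * \<i> * of_real (aplus T x v $ 2 + \<beta> x v) * zcoef T r x" for r
      by (rule zcoef_cscale_K_frame[OF T]) (rule K)
    have kK: "kconn \<beta> r x v \<in> K_dual (J x)" for r
      unfolding K by (rule cscale_in_K_dual[OF Kx])
    have h: "K_herm (g y) (J y) (s y) (t y) = zcoef T s y * cnj (zcoef T t y)" if "y \<in> ?W" for y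
      using that smooth_K_in_K_dual[OF s] smooth_K_in_K_dual[OF t] by (intro K_herm_zcoef[OF T(1)]) auto
    have "dir_deriv \<A> (\<lambda>y. K_herm (g y) (J y) (s y) (t y)) x v = dir_deriv \<A> (\<lambda>y. zcoef T s y * cnj (zcoef T t y)) x v"
      by (rule dir_deriv_cong[OF W _ smooth_fun_mult[OF W(1) zs zt']]) (use h in auto)
    also have "\<dots> = zcoef T s x * cnj (dir_deriv \<A> (zcoef T t) x v) + dir_deriv \<A> (zcoef T s) x v * cnj (zcoef T t x)"
      using dir_deriv_bilinear[OF bounded_bilinear_mult zs zt' W(2)] dir_deriv_linear[OF bounded_linear_cnj zt W(2)] by simp
    \<comment> \<open>The connection form is real, so its two contributions, multiplied by 2i and by
      its conjugate, cancel.\<close>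
    also have "\<dots> = zcoef T (\<lambda>y. kconn \<beta> s y v) x * cnj (zcoef T t x) + zcoef T s x * cnj (zcoef T (\<lambda>y. kconn \<beta> t y v) x)"
      unfolding kz by (simp add: algebra_simps)
    also have "\<dots> = K_herm (g x) (J x) (kconn \<beta> s x v) (t x) + K_herm (g x) (J x) (s x) (kconn \<beta> t x v)"
      using K_herm_zcoef[OF T, of "\<lambda>y. kconn \<beta> s y v" t] K_herm_zcoef[OF T, of s "\<lambda>y. kconn \<beta> t y v"] kK
        smooth_K_in_K_dual[OF s x] smooth_K_in_K_dual[OF t x] by simp
    finally show ?thesis .
  qed
qed


subsection \<open>Connection forms of unitary connections\<close>

context
  fixes T :: "'m u2chart" and x :: 'm
  assumes T: "u2_chart \<A> g J T" and x: "x \<in> fst T"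
begin

lemma alpha_form_eqI:
  assumes a: "\<And>z :: 'm \<Rightarrow> complex. smooth_fun \<A> (fst T) z \<Longrightarrow>
     A (\<lambda>y. cscale (J y) (z y) (K_frame J T y)) x v
       = cscale (J x) (dir_deriv \<A> z x v + 2 * \<i> * of_real a * z x) (K_frame J T x)"
  shows "alpha_form \<A> J T A x v = a"
  unfolding alpha_form_def
proof (rule the_equality)
  fix b assume b: "\<forall>z::'m \<Rightarrow> complex. smooth_fun \<A> (fst T) z \<longrightarrow>
     A (\<lambda>y. cscale (J y) (z y) (K_frame J T y)) x v
       = cscale (J x) (dir_deriv \<A> z x v + 2 * \<i> * of_real b * z x) (K_frame J T x)"
  have "smooth_fun \<A> (fst T) (\<lambda>y. 1 :: complex)" by simp
  then have "cscale (J x) (2 * \<i> * of_real a) (K_frame J T x) = cscale (J x) (2 * \<i> * of_real b) (K_frame J T x)"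
    using a[of "\<lambda>y. 1"] b[THEN spec, of "\<lambda>y. 1"] by simp
  from cscale_K_frame_inject[OF T x this] show "b = a" by simp
qed (use a in blast)

lemma alpha_form_kconn: "alpha_form \<A> J T (kconn \<beta>) x v = aplus T x v $ 2 + \<beta> x v"
proof (rule alpha_form_eqI)
  fix z :: "'m \<Rightarrow> complex" assume z: "smooth_fun \<A> (fst T) z"
  let ?s = "\<lambda>y. cscale (J y) (z y) (K_frame J T y)"
  have s: "smooth_K_section \<A> J (fst T) ?s"
    using smooth_K_cscale_frame[OF T u2_open[OF T] z] by simp
  have zz: "zcoef T ?s y = z y" if "y \<in> fst T" for y
    by (rule zcoef_cscale_K_frame[OF T that]) simp
  have "dir_deriv \<A> (zcoef T ?s) x v = dir_deriv \<A> z x v"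
    by (rule dir_deriv_cong[OF u2_open[OF T] x _ z]) (use zz in auto)
  then show "kconn \<beta> ?s x v = cscale (J x) (dir_deriv \<A> z x v + 2 * \<i> * of_real (aplus T x v $ 2 + \<beta> x v) * z x) (K_frame J T x)"
    using kconn_eq_kval[OF T x u2_open[OF T] x s] zz[OF x] by (simp add: kval_def)
qed

text \<open>Differentiating the constant norm of the frame shows that the coefficient
  \<open>c\<close> of its derivative is imaginary, so a real form with c = 2 i \<alpha> exists; it
  inherits linearity from \<open>A\<close>.\<close>

lemma linear_alpha_form:
  assumes A: "unitary_connection \<A> g J A"
  shows "linear (alpha_form \<A> J T A x)"
proof -
  note U = u2_open[OF T]
  let ?K = "K_frame J T"
  have K: "smooth_K_section \<A> J (fst T) ?K"
    using smooth_K_cscale_frame[OF T U smooth_fun_const[of _ 1]] by (simp add: cscale_1)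
  note Ac = A[unfolded unitary_connection_def, THEN spec, THEN mp, OF U, THEN spec, THEN mp, OF K]
  have lin: "linear (A ?K x)" using Ac x by blast
  have AK: "A ?K x v \<in> K_dual (J x)" for v
  proof -
    \<comment> \<open>Derivatives of sections are known to be sections only along smooth vector
      fields; this field extends \<open>v\<close> with constant components in the chart.\<close>
    let ?X = "\<lambda>y. inv (snd T y) (snd T x v)"
    have "smooth_K_section \<A> J (fst T) (\<lambda>y. A ?K y (?X y))"
      using Ac smooth_u2_frame[OF T] by blast
    from smooth_K_in_K_dual[OF this x] show ?thesis by (simp add: inv_u2[OF T x])
  qed
  define c where "c v = zcoef T (\<lambda>y. A ?K y v) x" for v
  have cK: "A ?K x v = cscale (J x) (c v) (?K x)" for v
    using zcoef_K_dual[OF T x, of "\<lambda>y. A ?K y v"] AK by (simp add: c_def)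
  have KK: "?K y \<in> K_dual (J y)" if "y \<in> fst T" for y using K_frame_in_K_dual[OF T that] .
  have "c v + cnj (c v) = 0" for v
  proof -
    have "dir_deriv \<A> (\<lambda>y. K_herm (g y) (J y) (?K y) (?K y)) x v
       = K_herm (g x) (J x) (A ?K x v) (?K x) + K_herm (g x) (J x) (?K x) (A ?K x v)"
      using Ac K x by blast
    moreover have "dir_deriv \<A> (\<lambda>y. K_herm (g y) (J y) (?K y) (?K y)) x v = dir_deriv \<A> (\<lambda>y. 1 :: complex) x v"
      by (rule dir_deriv_cong[OF U x _ smooth_fun_const])
        (use zcoef_K_frame[OF T] in \<open>simp add: zcoef_def\<close>)
    ultimately show ?thesis
      using K_herm_zcoef[OF T x, of "\<lambda>y. A ?K y v" ?K] K_herm_zcoef[OF T x, of ?K "\<lambda>y. A ?K y v"]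
        AK[of v] KK[OF x] zcoef_K_frame[OF T x] by (simp add: c_def)
  qed
  then have Re: "Re (c v) = 0" for v
    by (metis complex_add_cnj of_real_eq_0_iff mult_eq_0_iff zero_neq_numeral)
  have al: "alpha_form \<A> J T A x v = Im (c v) / 2" for v
  proof (rule alpha_form_eqI)
    fix z :: "'m \<Rightarrow> complex" assume z: "smooth_fun \<A> (fst T) z"
    have "c v = 2 * \<i> * of_real (Im (c v) / 2)" using Re by (simp add: complex_eq_iff)
    moreover have "A (\<lambda>y. cscale (J y) (z y) (?K y)) x v = cscale (J x) (dir_deriv \<A> z x v) (?K x) + cscale (J x) (z x) (A ?K x v)"
      using Ac z x by blast
    ultimately show "A (\<lambda>y. cscale (J y) (z y) (?K y)) x v
      = cscale (J x) (dir_deriv \<A> z x v + 2 * \<i> * of_real (Im (c v) / 2) * z x) (?K x)"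
      by (simp only: cK cscale_cscale cscale_add_left mult.commute)
  qed
  have "c (v + w) = c v + c w" for v w
    by (rule cscale_K_frame_inject[OF T x]) (simp add: cscale_add_left linear_add[OF lin] flip: cK)
  moreover have "c (r *\<^sub>R v) = r *\<^sub>R c v" for r v
    by (rule cscale_K_frame_inject[OF T x]) (simp add: cscale_scaleR linear_scale[OF lin] flip: cK)
  ultimately show ?thesis by (simp add: linear_iff al add_divide_distrib)
qed

end

end



section \<open>The tensor of a spinor field\<close>

text \<open>Independence of the frame, used once in each of the two arguments of
  \<open>C\<close>.\<close>

lemma (in almost_hermitian) tensor_norm_u2:
  assumes T: "u2_chart \<A> g J T" and x: "x \<in> fst T" and C: "bilinear C"
  shows "tensor_norm (g x) C = sqrt (\<Sum>j\<in>UNIV. \<Sum>k\<in>UNIV.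
    snd T x (C (inv (snd T x) (axis j 1)) (inv (snd T x) (axis k 1)))
    \<bullet> snd T x (C (inv (snd T x) (axis j 1)) (inv (snd T x) (axis k 1))))"
proof -
  define E where "E k = snd T x (some_frame (g x) k)" for k
  define c where "c p q = snd T x (C (inv (snd T x) p) (inv (snd T x) q))" for p q
  have E: "E j \<bullet> E k = (if j = k then 1 else 0)" for j k
    using orthonormal_frame_some_frame[of x] unfolding E_def inner_u2[OF T x] orthonormal_frame_def by blast
  note l = linear_u2[OF T x] and li = linear_inv_u2[OF T x]
  have c: "bilinear c"
    using C unfolding bilinear_def c_def
    by (simp add: linear_iff linear_add[OF l] linear_scale[OF l] linear_add[OF li] linear_scale[OF li])
  have "(\<Sum>j\<in>UNIV. \<Sum>k\<in>UNIV. g x (C (some_frame (g x) j) (some_frame (g x) k)) (C (some_frame (g x) j) (some_frame (g x) k)))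
    = (\<Sum>j\<in>UNIV. \<Sum>k\<in>UNIV. c (E j) (E k) \<bullet> c (E j) (E k))"
    by (simp add: c_def E_def inv_u2[OF T x] inner_u2[OF T x])
  also have "\<dots> = (\<Sum>j\<in>UNIV. \<Sum>k\<in>UNIV. c (E j) (axis k 1) \<bullet> c (E j) (axis k 1))"
    by (intro sum.cong refl orthonormal_trace[where \<beta> = "\<lambda>p q. c (E _) p \<bullet> c (E _) q"] E)
      (simp_all add: linear_iff bilinear_radd[OF c] bilinear_rmul[OF c] inner_add_left inner_add_right)
  also have "\<dots> = (\<Sum>k\<in>UNIV. \<Sum>j\<in>UNIV. c (E j) (axis k 1) \<bullet> c (E j) (axis k 1))"
    by (rule sum.swap)
  also have "\<dots> = (\<Sum>k\<in>UNIV. \<Sum>j\<in>UNIV. c (axis j 1) (axis k 1) \<bullet> c (axis j 1) (axis k 1))"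
    by (intro sum.cong refl orthonormal_trace[where \<beta> = "\<lambda>p q. c p (axis _ 1) \<bullet> c q (axis _ 1)"] E)
      (simp_all add: linear_iff bilinear_ladd[OF c] bilinear_lmul[OF c] inner_add_left inner_add_right)
  also have "\<dots> = (\<Sum>j\<in>UNIV. \<Sum>k\<in>UNIV. c (axis j 1) (axis k 1) \<bullet> c (axis j 1) (axis k 1))"
    by (rule sum.swap)
  finally show ?thesis by (simp add: tensor_norm_def c_def)
qed

lemma (in almost_hermitian) dirac_trace_u2:
  assumes T: "u2_chart \<A> g J T" and x: "x \<in> fst T" and C: "bilinear C"
  shows "snd T x (dirac_trace (g x) C) = (\<Sum>k\<in>UNIV. snd T x (C (inv (snd T x) (axis k 1)) (inv (snd T x) (axis k 1))))"
proof -
  define E where "E k = snd T x (some_frame (g x) k)" for k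
  define c where "c p q = snd T x (C (inv (snd T x) p) (inv (snd T x) q))" for p q
  have E: "E j \<bullet> E k = (if j = k then 1 else 0)" for j k
    using orthonormal_frame_some_frame[of x] unfolding E_def inner_u2[OF T x] orthonormal_frame_def by blast
  note l = linear_u2[OF T x] and li = linear_inv_u2[OF T x]
  have c: "bilinear c"
    using C unfolding bilinear_def c_def
    by (simp add: linear_iff linear_add[OF l] linear_scale[OF l] linear_add[OF li] linear_scale[OF li])
  have "snd T x (dirac_trace (g x) C) = (\<Sum>k\<in>UNIV. c (E k) (E k))"
    by (simp add: dirac_trace_def linear_sum[OF l] c_def E_def inv_u2[OF T x])
  also have "\<dots> = (\<Sum>k\<in>UNIV. c (axis k 1) (axis k 1))"
    by (rule orthonormal_trace[OF E]) (use c in \<open>simp_all add: bilinear_def\<close>)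
  finally show ?thesis by (simp add: c_def)
qed

text \<open>By the Clifford relation, the products of e_k with the conjugate of e_j and of e_j with
  the conjugate of e_k add up to 2 for j = k and to 0 otherwise. Hence the left side and |D|^2 have
  the sum 2 S.\<close>

lemma Alt_norm_identity:
  fixes b :: "4 \<Rightarrow> quat"
  defines "S \<equiv> \<Sum>k\<in>UNIV. b k \<bullet> b k" and "D \<equiv> \<Sum>k\<in>UNIV. qmult (b k) (axis k 1)"
  shows "(\<Sum>j\<in>UNIV. \<Sum>k\<in>UNIV. qmult (b j) (axis k 1) \<bullet> qmult (b k) (axis j 1)) = 2 * S - D \<bullet> D"
  unfolding S_def D_def by (simp add: sum_4 inner_quat axis_quat algebra_simps)

lemma sum_qmult_axis_inner:
  fixes b :: "4 \<Rightarrow> quat"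
  shows "(\<Sum>j\<in>UNIV. \<Sum>k\<in>(UNIV::4 set). qmult (b j) (axis k 1) \<bullet> qmult (b j) (axis k 1)) = 4 * (\<Sum>k\<in>UNIV. b k \<bullet> b k)"
  by (simp add: inner_qmult_left inner_axis_axis sum_distrib_left mult.commute)

text \<open>Parseval: the four products of \<open>r\<close> with the basis quaternions are
  orthogonal and have the length of \<open>r\<close>.\<close>

lemma sum_inner_qmult_axis: "(\<Sum>k\<in>UNIV. (w \<bullet> qmult r (axis k 1))\<^sup>2) = (w \<bullet> w) * (r \<bullet> r)"
  by (simp add: sum_4 inner_quat axis_quat power2_eq_square algebra_simps)

locale spinor = hermitian_levi_civita \<A> g J nabla
  for \<A> :: "'m::{t2_space, second_countable_topology} chart set" and g J nabla +
  fixes \<phi> :: "'m \<Rightarrow> R4 \<Rightarrow> R4"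
  assumes phi: "self_dual_spinor_field \<A> g \<phi>" and phi_nz: "\<phi> x \<noteq> (\<lambda>v. 0)"
begin

lemma linear_phi: "linear (\<phi> x)"
  using phi unfolding self_dual_spinor_field_def smooth_endo_def by blast

lemma smooth_phi: "open U \<Longrightarrow> smooth_vf \<A> U X \<Longrightarrow> smooth_vf \<A> U (\<lambda>x. \<phi> x (X x))"
  using phi unfolding self_dual_spinor_field_def smooth_endo_def by blast

definition qf :: "'m u2chart \<Rightarrow> 'm \<Rightarrow> quat" where
  "qf T x = snd T x (\<phi> x (inv (snd T x) q1))"

text \<open>The quaternion form b of the spinor for the reference connection, where \<alpha> is the
  i-component of \<open>aplus\<close>.\<close>

definition b0 :: "'m u2chart \<Rightarrow> 'm \<Rightarrow> R4 \<Rightarrow> quat" where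
  "b0 T x v = dir_deriv \<A> (qf T) x v - qmult (qf T x) (aplus T x v) + aplus T x v $ 2 *\<^sub>R qmult qi (qf T x)"

definition B0 :: "'m \<Rightarrow> R4 \<Rightarrow> R4 \<Rightarrow> R4" where
  "B0 x v w = (let T = u2_chart_at \<A> g J x in inv (snd T x) (qmult (b0 T x v) (snd T x w)))"

text \<open>\<open>betaB\<close> and \<open>betaD\<close> are such that the connections \<open>kconn betaB\<close> and \<open>kconn betaD\<close> minimize the tensor \<open>\<B>\<^sup>A\<phi>\<close>
  and annihilate the Dirac operator, respectively. Any nonzero vector may replace \<open>axis 1 1\<close>.\<close>

definition betaB :: "'m \<Rightarrow> R4 \<Rightarrow> real" where
  "betaB x v = - g x (B0 x v (axis 1 1)) (J x (\<phi> x (axis 1 1))) / g x (\<phi> x (axis 1 1)) (\<phi> x (axis 1 1))"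

definition betaD :: "'m \<Rightarrow> R4 \<Rightarrow> real" where
  "betaD x v = - g x (dirac_trace (g x) (B0 x)) (J x (\<phi> x v)) * g x (axis 1 1) (axis 1 1)
     / g x (\<phi> x (axis 1 1)) (\<phi> x (axis 1 1))"

context
  fixes T :: "'m u2chart"
  assumes T: "u2_chart \<A> g J T"
begin

lemma phi_u2: "x \<in> fst T \<Longrightarrow> snd T x (\<phi> x v) = qmult (qf T x) (snd T x v)"
proof -
  assume x: "x \<in> fst T"
  have "\<phi> x \<in> W_plus (g x)" using phi unfolding self_dual_spinor_field_def by blast
  then obtain q where q: "\<And>v. snd T x (\<phi> x v) = qmult q (snd T x v)"
    using W_plus_isometry[OF _ u2_isometry[OF T x]] by blast
  have "qf T x = q" using q[of "inv (snd T x) q1"] by (simp add: qf_def u2_inv[OF T x])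
  then show ?thesis using q by simp
qed

lemma qf_nonzero: "x \<in> fst T \<Longrightarrow> qf T x \<noteq> 0"
proof
  assume x: "x \<in> fst T" and "qf T x = 0"
  then have "snd T x (\<phi> x v) = 0" for v using phi_u2[OF x, of v] qmult_eq_0_iff by simp
  then have "\<phi> x v = 0" for v using inv_u2[OF T x, of "\<phi> x v"] linear_0[OF linear_inv_u2[OF T x]] by simp
  then show False using phi_nz[of x] by blast
qed

lemma smooth_qf: "smooth_fun \<A> (fst T) (qf T)"
  using smooth_u2[OF T u2_open[OF T] smooth_phi[OF u2_open[OF T] smooth_u2_frame[OF T]]]
  by (simp add: qf_def[abs_def])

lemma linear_b0: "x \<in> fst T \<Longrightarrow> linear (b0 T x)"
proof -
  assume x: "x \<in> fst T"
  note d = linear_dir_deriv[OF smooth_qf x] and a = linear_aplus[OF T x]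
  show ?thesis
    by (simp add: linear_iff b0_def linear_add[OF d] linear_scale[OF d] linear_add[OF a] linear_scale[OF a]
        qmult_add_right qmult_scaleR_right algebra_simps)
qed

lemma smooth_b0:
  assumes V: "open V" and X: "smooth_vf \<A> V X"
  shows "smooth_fun \<A> (V \<inter> fst T) (\<lambda>x. b0 T x (X x))"
proof -
  have W: "open (V \<inter> fst T)" using V u2_open[OF T] by blast
  have q: "smooth_fun \<A> (V \<inter> fst T) (qf T)" by (rule smooth_fun_subset[OF smooth_qf]) auto
  have X': "smooth_vf \<A> (V \<inter> fst T) X" by (rule smooth_vf_subset[OF X]) auto
  note a = smooth_aplus[OF T V X]
  have a2: "smooth_fun \<A> (V \<inter> fst T) (\<lambda>x. aplus T x (X x) $ 2)"
    using smooth_fun_inner[OF W a smooth_fun_const, of "axis 2 1"] by (simp add: inner_axis)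
  show ?thesis unfolding b0_def
    by (intro smooth_fun_add smooth_fun_diff smooth_fun_scaleR smooth_fun_bilinear[OF bounded_bilinear_qmult]
        W q X' a a2 smooth_dir_deriv smooth_fun_const)
qed

lemma dir_deriv_phi:
  assumes V: "open V" "smooth_vf \<A> V Z" and x: "x \<in> V" "x \<in> fst T"
  shows "dir_deriv \<A> (\<lambda>y. snd T y (\<phi> y (Z y))) x v
    = qmult (qf T x) (dir_deriv \<A> (\<lambda>y. snd T y (Z y)) x v) + qmult (dir_deriv \<A> (qf T) x v) (snd T x (Z x))"
proof -
  have W: "open (V \<inter> fst T)" "x \<in> V \<inter> fst T" using V x u2_open[OF T] by auto
  have q: "smooth_fun \<A> (V \<inter> fst T) (qf T)" by (rule smooth_fun_subset[OF smooth_qf]) auto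
  note z = smooth_u2[OF T V]
  have "dir_deriv \<A> (\<lambda>y. snd T y (\<phi> y (Z y))) x v = dir_deriv \<A> (\<lambda>y. qmult (qf T y) (snd T y (Z y))) x v"
    by (rule dir_deriv_cong[OF W _ smooth_fun_bilinear[OF bounded_bilinear_qmult W(1) q z]])
      (use phi_u2 in auto)
  then show ?thesis using dir_deriv_bilinear[OF bounded_bilinear_qmult q z W(2)] by simp
qed

text \<open>Left multiplication commutes with right multiplication, so the \<open>aminus\<close>
  terms cancel and the difference depends on \<open>Z\<close> only through its value. The left side
  is free of charts; it shows that \<open>B0\<close> does not depend on the chart.\<close>

lemma nabla_herm_phi:
  assumes V: "open V" "smooth_vf \<A> V Z" and x: "x \<in> V" "x \<in> fst T"
  shows "nabla_herm (\<lambda>y. \<phi> y (Z y)) x v - \<phi> x (nabla Z x v) = inv (snd T x) (qmult (b0 T x v) (snd T x (Z x)))"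
proof -
  have "snd T x (nabla_herm (\<lambda>y. \<phi> y (Z y)) x v - \<phi> x (nabla Z x v)) = qmult (b0 T x v) (snd T x (Z x))"
    unfolding linear_diff[OF linear_u2[OF T x(2)]] nabla_herm_u2[OF T V(1) smooth_phi[OF V] x]
      phi_u2[OF x(2)] nabla_u2[OF T V x] dir_deriv_phi[OF V x] b0_def
    by (simp add: qmult_add_left qmult_add_right qmult_diff_left qmult_diff_right qmult_scaleR_left qmult_assoc)
  then show ?thesis using inv_u2[OF T x(2)] by metis
qed

end

lemma B0_u2:
  assumes T: "u2_chart \<A> g J T" "x \<in> fst T"
  shows "B0 x v w = inv (snd T x) (qmult (b0 T x v) (snd T x w))"
proof -
  let ?R = "u2_chart_at \<A> g J x"
  note R = u2_chart_at[of x]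
  let ?Z = "\<lambda>y. inv (snd ?R y) (snd ?R x w)"
  have Z: "smooth_vf \<A> (fst ?R) ?Z" by (rule smooth_u2_frame[OF R(1)])
  have Zx: "?Z x = w" by (rule inv_u2[OF R])
  have "B0 x v w = inv (snd ?R x) (qmult (b0 ?R x v) (snd ?R x (?Z x)))"
    unfolding Zx by (simp add: B0_def Let_def)
  also have "\<dots> = inv (snd T x) (qmult (b0 T x v) (snd T x (?Z x)))"
    using nabla_herm_phi[OF R(1) u2_open[OF R(1)] Z R(2) R(2)] nabla_herm_phi[OF T(1) u2_open[OF R(1)] Z R(2) T(2)]
    by metis
  finally show ?thesis unfolding Zx .
qed

lemma bilinear_u2_qmult:
  assumes T: "u2_chart \<A> g J T" "x \<in> fst T" and b: "linear b"
  shows "bilinear (\<lambda>X Y. inv (snd T x) (qmult (b X) (snd T x Y)))"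
proof -
  note l = linear_u2[OF T] and li = linear_inv_u2[OF T]
  show ?thesis unfolding bilinear_def
    by (simp add: linear_iff linear_add[OF l] linear_scale[OF l] linear_add[OF li] linear_scale[OF li]
        linear_add[OF b] linear_scale[OF b] qmult_add_left qmult_add_right qmult_scaleR_left qmult_scaleR_right)
qed

text \<open>The coefficient of the orthogonal projection to the line of i q, with sign reversed. The
  auxiliary vector drops out, since right multiplication by \<open>y\<close> scales numerator and
  denominator by |y|^2.\<close>

lemma betaB_u2:
  assumes T: "u2_chart \<A> g J T" "x \<in> fst T"
  shows "betaB x v = - (b0 T x v \<bullet> qmult qi (qf T x)) / (qf T x \<bullet> qf T x)"
proof -
  define y where "y = snd T x (axis 1 1)"
  have "axis 1 1 \<noteq> (0 :: R4)" by (simp add: axis_eq_0_iff)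
  then have "0 < y \<bullet> y" unfolding y_def inner_u2[OF T] by (rule g_pos)
  then show ?thesis
    unfolding betaB_def B0_u2[OF T] inner_u2[OF T, symmetric] u2_J[OF T] phi_u2[OF T] u2_inv[OF T]
    by (simp add: inner_qmult_right inner_qmult_left flip: y_def qmult_assoc)
qed

text \<open>Minus the coordinates of the trace for the reference connection in the orthogonal basis
  i q e_k. The extra metric factor turns the squared length of the image of the auxiliary vector
  into |q|^2.\<close>

lemma betaD_u2:
  assumes T: "u2_chart \<A> g J T" "x \<in> fst T"
  shows "betaD x v = - ((\<Sum>k\<in>UNIV. qmult (b0 T x (inv (snd T x) (axis k 1))) (axis k 1))
     \<bullet> qmult (qmult qi (qf T x)) (snd T x v)) / (qf T x \<bullet> qf T x)"
proof -
  define y where "y = snd T x (axis 1 1)"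
  have "axis 1 1 \<noteq> (0 :: R4)" by (simp add: axis_eq_0_iff)
  then have y: "0 < y \<bullet> y" unfolding y_def inner_u2[OF T] by (rule g_pos)
  have B0: "B0 x = (\<lambda>X Y. inv (snd T x) (qmult (b0 T x X) (snd T x Y)))"
    using B0_u2[OF T] by blast
  show ?thesis
    unfolding betaD_def inner_u2[OF T, symmetric] u2_J[OF T] phi_u2[OF T] B0
      dirac_trace_u2[OF T bilinear_u2_qmult[OF T linear_b0[OF T]]] u2_inv[OF T]
    using y by (simp add: inner_qmult_left qmult_assoc flip: y_def)
qed

lemma one_form_local:
  assumes lin: "\<And>x. linear (\<beta> x)"
    and sm: "\<And>x0 U X. open U \<Longrightarrow> smooth_vf \<A> U X \<Longrightarrow>
      smooth_fun \<A> (U \<inter> fst (u2_chart_at \<A> g J x0)) (\<lambda>x. \<beta> x (X x))"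
  shows "one_form \<beta>"
  unfolding one_form_def
proof (intro conjI allI impI lin)
  fix U X assume U: "open U" and X: "smooth_vf \<A> U X"
  show "smooth_fun \<A> U (\<lambda>x. \<beta> x (X x))"
    by (rule smooth_fun_local[OF U]) (use sm[OF U X] u2_chart_at u2_open in blast)
qed

lemma smooth_qf_norm_inverse:
  assumes T: "u2_chart \<A> g J T" and V: "open V"
  shows "smooth_fun \<A> (V \<inter> fst T) (\<lambda>x. inverse (qf T x \<bullet> qf T x))"
proof -
  have W: "open (V \<inter> fst T)" using V u2_open[OF T] by blast
  have q: "smooth_fun \<A> (V \<inter> fst T) (qf T)" by (rule smooth_fun_subset[OF smooth_qf[OF T]]) auto
  show ?thesis
    by (intro smooth_fun_inverse smooth_fun_inner W q) (use qf_nonzero[OF T] in auto)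
qed

lemma one_form_betaB: "one_form betaB"
proof (rule one_form_local)
  show "linear (betaB x)" for x
    using linear_b0[OF u2_chart_at]
    by (simp add: linear_iff betaB_u2[OF u2_chart_at] inner_add_left add_divide_distrib diff_divide_distrib)
  fix x0 U X assume U: "open U" and X: "smooth_vf \<A> U X"
  define T where "T = u2_chart_at \<A> g J x0"
  have T: "u2_chart \<A> g J T" using u2_chart_at T_def by auto
  have W: "open (U \<inter> fst T)" using U u2_open[OF T] by blast
  have q: "smooth_fun \<A> (U \<inter> fst T) (qf T)" by (rule smooth_fun_subset[OF smooth_qf[OF T]]) auto
  have "smooth_fun \<A> (U \<inter> fst T) (\<lambda>x. - (b0 T x (X x) \<bullet> qmult qi (qf T x)) * inverse (qf T x \<bullet> qf T x))"
    by (intro smooth_fun_mult smooth_fun_minus smooth_fun_inner W smooth_b0[OF T U X]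
        smooth_fun_bilinear[OF bounded_bilinear_qmult] smooth_fun_const q smooth_qf_norm_inverse[OF T U])
  then show "smooth_fun \<A> (U \<inter> fst (u2_chart_at \<A> g J x0)) (\<lambda>x. betaB x (X x))"
    unfolding T_def[symmetric]
    by (rule smooth_fun_cong[OF W, rotated]) (use betaB_u2[OF T] in \<open>auto simp: divide_inverse\<close>)
qed

lemma one_form_betaD: "one_form betaD"
proof (rule one_form_local)
  show "linear (betaD x)" for x
    using linear_u2[OF u2_chart_at]
    by (simp add: linear_iff betaD_u2[OF u2_chart_at] qmult_add_right qmult_scaleR_right inner_add_right add_divide_distrib diff_divide_distrib)
  fix x0 U X assume U: "open U" and X: "smooth_vf \<A> U X"
  define T where "T = u2_chart_at \<A> g J x0"
  have T: "u2_chart \<A> g J T" using u2_chart_at T_def by auto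
  have W: "open (U \<inter> fst T)" using U u2_open[OF T] by blast
  have q: "smooth_fun \<A> (U \<inter> fst T) (qf T)" by (rule smooth_fun_subset[OF smooth_qf[OF T]]) auto
  have b: "smooth_fun \<A> (U \<inter> fst T) (\<lambda>x. b0 T x (inv (snd T x) (axis k 1)))" for k
    using smooth_b0[OF T W smooth_vf_subset[OF smooth_u2_frame[OF T]]] by (simp add: Int_assoc)
  have "smooth_fun \<A> (U \<inter> fst T) (\<lambda>x. - ((\<Sum>k\<in>UNIV. qmult (b0 T x (inv (snd T x) (axis k 1))) (axis k 1))
     \<bullet> qmult (qmult qi (qf T x)) (snd T x (X x))) * inverse (qf T x \<bullet> qf T x))"
    by (intro smooth_fun_mult smooth_fun_minus smooth_fun_inner smooth_fun_sum W b smooth_u2[OF T U X]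
        smooth_fun_bilinear[OF bounded_bilinear_qmult] smooth_fun_const q smooth_qf_norm_inverse[OF T U])
  then show "smooth_fun \<A> (U \<inter> fst (u2_chart_at \<A> g J x0)) (\<lambda>x. betaD x (X x))"
    unfolding T_def[symmetric]
    by (rule smooth_fun_cong[OF W, rotated]) (use betaD_u2[OF T] in \<open>auto simp: divide_inverse\<close>)
qed


subsection \<open>Norms at a point\<close>

text \<open>\<open>beta_of A\<close> is the difference of \<open>A\<close> and the connection \<open>kconn (\<lambda>x v. 0)\<close>.\<close>

definition beta_of :: "'m kconn \<Rightarrow> 'm \<Rightarrow> R4 \<Rightarrow> real" where
  "beta_of A x v = (let T = u2_chart_at \<A> g J x in alpha_form \<A> J T A x v - aplus T x v $ 2)"

lemma beta_of_kconn: "beta_of (kconn \<beta>) x v = \<beta> x v"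
  by (simp add: beta_of_def Let_def alpha_form_kconn[OF u2_chart_at])

lemma linear_beta_of: "unitary_connection \<A> g J A \<Longrightarrow> linear (beta_of A x)"
proof -
  assume A: "unitary_connection \<A> g J A"
  note l = linear_alpha_form[OF u2_chart_at A, of x] and a = linear_aplus[OF u2_chart_at, of x]
  show ?thesis
    by (simp add: linear_iff beta_of_def Let_def linear_add[OF l] linear_scale[OF l] linear_add[OF a]
        linear_scale[OF a] algebra_simps)
qed

text \<open>Passing from the reference connection to \<open>A\<close> adds a multiple of i q, and
  right multiplication by \<open>aminus\<close> cancels as before; this makes the value independent
  of the extension of \<open>Y\<close>.\<close>

lemma B_tensor_eq:
  fixes x defines "T \<equiv> u2_chart_at \<A> g J x"
  shows "B_tensor \<A> g J nabla \<phi> A x X Y =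
    inv (snd T x) (qmult (b0 T x X + beta_of A x X *\<^sub>R qmult qi (qf T x)) (snd T x Y))"
    (is "_ = ?r Y")
proof -
  have T: "u2_chart \<A> g J T" "x \<in> fst T" using u2_chart_at T_def by auto
  have 1: "spin_conn_plus \<A> g J nabla A \<phi> x X Z = ?r (Z x)"
    if V: "open V" "smooth_vf \<A> V Z" and x: "x \<in> V" for V Z
  proof -
    have "snd T x (spin_conn_plus \<A> g J nabla A \<phi> x X Z) =
       qmult (b0 T x X + beta_of A x X *\<^sub>R qmult qi (qf T x)) (snd T x (Z x))"
      unfolding spin_conn_plus_def spin_conn_minus_def Let_def T_def[symmetric] beta_of_def
        linear_diff[OF linear_u2[OF T]] u2_inv[OF T] spin_forms_eq[OF T] snd_conv phi_u2[OF T]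
        nabla_u2[OF T(1) V x T(2)] dir_deriv_phi[OF T(1) V x T(2)] b0_def
      by (simp add: qmult_add_left qmult_add_right qmult_diff_left qmult_diff_right qmult_scaleR_left
          qmult_assoc scaleR_diff_left)
    then show ?thesis using inv_u2[OF T] by metis
  qed
  \<comment> \<open>An extension of \<open>Y\<close> exists, namely with constant components in the
    chart; without one the definite description would not fix a value.\<close>
  let ?Z = "\<lambda>y. inv (snd T y) (snd T x Y)"
  have Z: "open (fst T)" "smooth_vf \<A> (fst T) ?Z" "?Z x = Y"
    using u2_open[OF T(1)] smooth_u2_frame[OF T(1)] inv_u2[OF T] by auto
  show ?thesis unfolding B_tensor_def
  proof (rule the_equality)
    show "\<forall>U Z. open U \<and> x \<in> U \<and> smooth_vf \<A> U Z \<and> Z x = Y \<longrightarrow> ?r Y = spin_conn_plus \<A> g J nabla A \<phi> x X Z"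
      using 1 by auto
    fix r assume "\<forall>U Z. open U \<and> x \<in> U \<and> smooth_vf \<A> U Z \<and> Z x = Y \<longrightarrow> r = spin_conn_plus \<A> g J nabla A \<phi> x X Z"
    then have "r = spin_conn_plus \<A> g J nabla A \<phi> x X ?Z" using Z T(2) by blast
    then show "r = ?r Y" using 1[OF Z(1,2) T(2)] Z(3) by simp
  qed
qed

definition bk :: "'m \<Rightarrow> (R4 \<Rightarrow> real) \<Rightarrow> 4 \<Rightarrow> quat" where
  "bk x \<beta> k = (let T = u2_chart_at \<A> g J x; e = inv (snd T x) (axis k 1) in b0 T x e + \<beta> e *\<^sub>R qmult qi (qf T x))"

definition S_norm :: "'m \<Rightarrow> (R4 \<Rightarrow> real) \<Rightarrow> real" where
  "S_norm x \<beta> = (\<Sum>k\<in>UNIV. bk x \<beta> k \<bullet> bk x \<beta> k)"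

definition D_vec :: "'m \<Rightarrow> (R4 \<Rightarrow> real) \<Rightarrow> quat" where
  "D_vec x \<beta> = (\<Sum>k\<in>UNIV. qmult (bk x \<beta> k) (axis k 1))"

text \<open>The alternating and symmetric parts have a quarter of 4 S + 4 S with twice the mixed sum
  2 S - |D|^2 subtracted or added.\<close>

lemma spinor_tensor_norms:
  assumes A: "unitary_connection \<A> g J A"
  shows "tensor_norm (g x) (B_tensor \<A> g J nabla \<phi> A x) = sqrt (4 * S_norm x (beta_of A x))"
    and "tensor_norm (g x) (Alt (B_tensor \<A> g J nabla \<phi> A x))
      = sqrt (S_norm x (beta_of A x) + D_vec x (beta_of A x) \<bullet> D_vec x (beta_of A x) / 2)"
    and "tensor_norm (g x) (Sym (B_tensor \<A> g J nabla \<phi> A x))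
      = sqrt (3 * S_norm x (beta_of A x) - D_vec x (beta_of A x) \<bullet> D_vec x (beta_of A x) / 2)"
    and "vec_norm (g x) (dirac_trace (g x) (B_tensor \<A> g J nabla \<phi> A x))
      = sqrt (D_vec x (beta_of A x) \<bullet> D_vec x (beta_of A x))"
proof -
  define T where "T = u2_chart_at \<A> g J x"
  have T: "u2_chart \<A> g J T" "x \<in> fst T" using u2_chart_at T_def by auto
  note l = linear_u2[OF T]
  define b where "b = (\<lambda>X. b0 T x X + beta_of A x X *\<^sub>R qmult qi (qf T x))"
  define B where "B = B_tensor \<A> g J nabla \<phi> A x"
  have B: "B = (\<lambda>X Y. inv (snd T x) (qmult (b X) (snd T x Y)))"
    unfolding B_def b_def T_def using B_tensor_eq by blast
  have lb: "linear b"
    using linear_b0[OF T] linear_beta_of[OF A, of x] by (simp add: b_def linear_iff algebra_simps)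
  have bB: "bilinear B" unfolding B by (rule bilinear_u2_qmult[OF T lb])
  have bA: "bilinear (Alt B)" and bS: "bilinear (Sym B)"
    using bB unfolding bilinear_def by (simp_all add: Alt_def[abs_def] Sym_def[abs_def] linear_iff algebra_simps)
  have bk: "b (inv (snd T x) (axis k 1)) = bk x (beta_of A x) k" for k
    by (simp add: bk_def Let_def T_def b_def)
  let ?b = "bk x (beta_of A x)"
  have c: "snd T x (B (inv (snd T x) (axis j 1)) (inv (snd T x) (axis k 1))) = qmult (?b j) (axis k 1)" for j k
    by (simp add: B u2_inv[OF T] bk)
  have cA: "snd T x (Alt B (inv (snd T x) (axis j 1)) (inv (snd T x) (axis k 1))) = (1/2) *\<^sub>R (qmult (?b j) (axis k 1) - qmult (?b k) (axis j 1))" for j k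
    by (simp only: Alt_def linear_scale[OF l] linear_diff[OF l] c)
  have cS: "snd T x (Sym B (inv (snd T x) (axis j 1)) (inv (snd T x) (axis k 1))) = (1/2) *\<^sub>R (qmult (?b j) (axis k 1) + qmult (?b k) (axis j 1))" for j k
    by (simp only: Sym_def linear_scale[OF l] linear_add[OF l] c)
  define P where "P j k = qmult (?b j) (axis k 1)" for j k
  have PP: "(\<Sum>j\<in>UNIV. \<Sum>k\<in>UNIV. P j k \<bullet> P j k) = 4 * S_norm x (beta_of A x)"
    unfolding P_def S_norm_def by (rule sum_qmult_axis_inner)
  then have PP': "(\<Sum>j\<in>UNIV. \<Sum>k\<in>UNIV. P k j \<bullet> P k j) = 4 * S_norm x (beta_of A x)"
    by (subst sum.swap)
  have PQ: "(\<Sum>j\<in>UNIV. \<Sum>k\<in>UNIV. P j k \<bullet> P k j) = 2 * S_norm x (beta_of A x) - D_vec x (beta_of A x) \<bullet> D_vec x (beta_of A x)"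
    unfolding P_def S_norm_def D_vec_def by (rule Alt_norm_identity)
  have m: "((1/2) *\<^sub>R (u - v)) \<bullet> ((1/2) *\<^sub>R (u - v)) = (1/4) * (u \<bullet> u) + (1/4) * (v \<bullet> v) - (1/2) * (u \<bullet> v)"
    "((1/2) *\<^sub>R (u + v)) \<bullet> ((1/2) *\<^sub>R (u + v)) = (1/4) * (u \<bullet> u) + (1/4) * (v \<bullet> v) + (1/2) * (u \<bullet> v)" for u v :: quat
    by (simp_all add: inner_diff_left inner_diff_right inner_add_left inner_add_right inner_commute)
  show "tensor_norm (g x) (B_tensor \<A> g J nabla \<phi> A x) = sqrt (4 * S_norm x (beta_of A x))"
    unfolding B_def[symmetric] tensor_norm_u2[OF T bB] c P_def[symmetric] PP ..
  show "tensor_norm (g x) (Alt (B_tensor \<A> g J nabla \<phi> A x))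
      = sqrt (S_norm x (beta_of A x) + D_vec x (beta_of A x) \<bullet> D_vec x (beta_of A x) / 2)"
    unfolding B_def[symmetric] tensor_norm_u2[OF T bA] cA P_def[symmetric] m sum.distrib sum_subtractf
      sum_distrib_left[symmetric] PP PP' PQ
    by (simp add: field_simps)
  show "tensor_norm (g x) (Sym (B_tensor \<A> g J nabla \<phi> A x))
      = sqrt (3 * S_norm x (beta_of A x) - D_vec x (beta_of A x) \<bullet> D_vec x (beta_of A x) / 2)"
    unfolding B_def[symmetric] tensor_norm_u2[OF T bS] cS P_def[symmetric] m sum.distrib sum_subtractf
      sum_distrib_left[symmetric] PP PP' PQ
    by (simp add: field_simps)
  show "vec_norm (g x) (dirac_trace (g x) (B_tensor \<A> g J nabla \<phi> A x))
      = sqrt (D_vec x (beta_of A x) \<bullet> D_vec x (beta_of A x))"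
    unfolding B_def[symmetric] vec_norm_def inner_u2[OF T, symmetric] dirac_trace_u2[OF T bB] c D_vec_def ..
qed

text \<open>Squared metric distance of two covectors, weighted by |q|^2 because a unit change of the
  connection form moves b along i q, which has length |q|.\<close>

definition dist2 :: "'m \<Rightarrow> (R4 \<Rightarrow> real) \<Rightarrow> (R4 \<Rightarrow> real) \<Rightarrow> real" where
  "dist2 x \<beta> \<gamma> = (let T = u2_chart_at \<A> g J x in qf T x \<bullet> qf T x *
     (\<Sum>k\<in>UNIV. (\<beta> (inv (snd T x) (axis k 1)) - \<gamma> (inv (snd T x) (axis k 1)))\<^sup>2))"

lemma dist2_nonneg: "0 \<le> dist2 x \<beta> \<gamma>"
  by (simp add: dist2_def Let_def sum_nonneg)

lemma dist2_eq_0: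
  assumes "dist2 x \<beta> \<gamma> = 0" "linear \<beta>" "linear \<gamma>"
  shows "\<beta> = \<gamma>"
proof -
  define T where "T = u2_chart_at \<A> g J x"
  have T: "u2_chart \<A> g J T" "x \<in> fst T" using u2_chart_at T_def by auto
  have "(\<Sum>k\<in>UNIV. (\<beta> (inv (snd T x) (axis k 1)) - \<gamma> (inv (snd T x) (axis k 1)))\<^sup>2) = 0"
    using assms(1) qf_nonzero[OF T] by (simp add: dist2_def Let_def T_def)
  then have e: "\<beta> (inv (snd T x) (axis k 1)) = \<gamma> (inv (snd T x) (axis k 1))" for k
    by (subst (asm) sum_nonneg_eq_0_iff) auto
  have "\<beta> v = \<gamma> v" for v
  proof -
    have v: "v = (\<Sum>k\<in>UNIV. snd T x v $ k *\<^sub>R inv (snd T x) (axis k 1))"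
      using linear_R4_expand[OF linear_inv_u2[OF T], of "snd T x v"] by (simp add: inv_u2[OF T])
    show ?thesis
      by (subst (1 2) v) (simp add: linear_sum[OF assms(2)] linear_scale[OF assms(2)]
         linear_sum[OF assms(3)] linear_scale[OF assms(3)] e)
  qed
  then show ?thesis by blast
qed

lemma bk_betaB_orthogonal:
  "bk x (betaB x) k \<bullet> qmult qi (qf (u2_chart_at \<A> g J x) x) = 0"
  using qf_nonzero[OF u2_chart_at, of x]
  by (simp add: bk_def Let_def betaB_u2[OF u2_chart_at] inner_add_left inner_diff_left inner_qmult_left inner_quat[of qi])

text \<open>Pythagoras: \<beta> moves each \<open>bk x \<beta> k\<close> along i q only, and for
  \<open>betaB\<close> these vectors are orthogonal to i q.\<close>

lemma S_norm_eq: "S_norm x \<beta> = S_norm x (betaB x) + dist2 x \<beta> (betaB x)"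
proof -
  define T where "T = u2_chart_at \<A> g J x"
  define r where "r = qmult qi (qf T x)"
  define d where "d k = \<beta> (inv (snd T x) (axis k 1)) - betaB x (inv (snd T x) (axis k 1))" for k
  have r: "r \<bullet> r = qf T x \<bullet> qf T x" by (simp add: r_def inner_qmult_left inner_quat[of qi])
  have o: "bk x (betaB x) k \<bullet> r = 0" for k using bk_betaB_orthogonal[of x k] by (simp add: r_def T_def)
  have "bk x \<beta> k = bk x (betaB x) k + d k *\<^sub>R r" for k
    by (simp add: bk_def Let_def T_def[symmetric] d_def r_def[symmetric] algebra_simps)
  then have "bk x \<beta> k \<bullet> bk x \<beta> k = bk x (betaB x) k \<bullet> bk x (betaB x) k + qf T x \<bullet> qf T x * (d k)\<^sup>2" for k
    using o[of k] by (simp add: inner_add_left inner_add_right inner_commute r power2_eq_square)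
  then show ?thesis
    by (simp add: S_norm_def dist2_def Let_def T_def[symmetric] d_def[symmetric] sum.distrib sum_distrib_left)
qed

text \<open>The coordinate of the trace along i q e_k is affine in the single number \<beta>(e_k),
  and \<open>betaD\<close> is the form for which all four coordinates vanish.\<close>

lemma D_norm_eq: "D_vec x \<beta> \<bullet> D_vec x \<beta> = dist2 x \<beta> (betaD x)"
proof -
  define T where "T = u2_chart_at \<A> g J x"
  have T: "u2_chart \<A> g J T" "x \<in> fst T" using u2_chart_at T_def by auto
  define r where "r = qmult qi (qf T x)"
  define n where "n = qf T x \<bullet> qf T x"
  define e where "e k = inv (snd T x) (axis k 1)" for k
  define D0 where "D0 = (\<Sum>k\<in>UNIV. qmult (b0 T x (e k)) (axis k 1))"
  have r: "r \<bullet> r = n" by (simp add: r_def n_def inner_qmult_left inner_quat[of qi])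
  have n: "0 < n" using qf_nonzero[OF T] by (simp add: n_def)
  have D: "D_vec x \<beta> = D0 + (\<Sum>k\<in>UNIV. \<beta> (e k) *\<^sub>R qmult r (axis k 1))"
    by (simp add: D_vec_def bk_def Let_def T_def[symmetric] e_def[symmetric] r_def[symmetric] D0_def
        qmult_add_left qmult_scaleR_left sum.distrib)
  have "D_vec x \<beta> \<bullet> qmult r (axis k 1) = D0 \<bullet> qmult r (axis k 1) + \<beta> (e k) * n" for k
    by (simp add: D inner_add_left inner_sum_left inner_qmult_left r inner_axis_axis
        if_distrib[of "\<lambda>t. _ * t"] cong: if_cong)
  moreover have "betaD x (e k) = - (D0 \<bullet> qmult r (axis k 1)) / n" for k
    unfolding betaD_u2[OF T] by (simp add: e_def u2_inv[OF T] D0_def r_def n_def)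
  ultimately have "D_vec x \<beta> \<bullet> qmult r (axis k 1) = n * (\<beta> (e k) - betaD x (e k))" for k
    using n by (simp add: field_simps)
  then have "(\<Sum>k\<in>UNIV. (n * (\<beta> (e k) - betaD x (e k)))\<^sup>2) = (D_vec x \<beta> \<bullet> D_vec x \<beta>) * n"
    using sum_inner_qmult_axis[of "D_vec x \<beta>" r] r by simp
  \<comment> \<open>The basis i q e_k is orthogonal with squared length \<open>n\<close> instead of
    1; one factor \<open>n\<close> on the left belongs to \<open>dist2\<close>, the other
    cancels.\<close>
  then have "n * (n * (\<Sum>k\<in>UNIV. (\<beta> (e k) - betaD x (e k))\<^sup>2)) = n * (D_vec x \<beta> \<bullet> D_vec x \<beta>)"
    by (simp add: power_mult_distrib sum_distrib_left power2_eq_square mult_ac)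
  then show ?thesis
    using n by (simp add: dist2_def Let_def T_def[symmetric] e_def[symmetric] n_def[symmetric])
qed

end



section \<open>Closedness of the induced 2-form\<close>

text \<open>Left multiplication by an imaginary quaternion is a self-dual 2-form. For these,
  exterior derivative and divergence are Hodge dual, so the four components of the alternating
  3-form on the left are, up to sign, those of the quaternion on the right.\<close>

lemma cyclic_sum_eq_0_iff:
  assumes h: "linear h" "\<And>v. h v $ 1 = 0"
  shows "(\<forall>x y z. qmult (h x) y \<bullet> z + qmult (h y) z \<bullet> x + qmult (h z) x \<bullet> y = 0)
    \<longleftrightarrow> (\<Sum>k\<in>UNIV. qmult (h (axis k 1)) (axis k 1)) = 0" (is "?L \<longleftrightarrow> ?R")
proof
  assume ?L
  \<comment> \<open>The four triples of distinct basis vectors, one for each component of the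
    trace.\<close>
  from this[rule_format, of "axis 2 1" "axis 3 1" "axis 4 1"] this[rule_format, of "axis 1 1" "axis 3 1" "axis 4 1"]
    this[rule_format, of "axis 1 1" "axis 2 1" "axis 4 1"] this[rule_format, of "axis 1 1" "axis 2 1" "axis 3 1"]
  show ?R by (simp add: sum_4 axis_quat quat_eq_iff inner_quat h(2))
next
  assume ?R
  \<comment> \<open>The four equations are solved for one entry of \<open>h (axis 2 1)\<close> and
    for all of \<open>h (axis 1 1)\<close>; after substitution the claim is a polynomial
    identity.\<close>
  then have R: "h (axis 2 1) $ 2 = - h (axis 3 1) $ 3 - h (axis 4 1) $ 4"
    "h (axis 1 1) $ 2 = h (axis 3 1) $ 4 - h (axis 4 1) $ 3"
    "h (axis 1 1) $ 3 = h (axis 4 1) $ 2 - h (axis 2 1) $ 4"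
    "h (axis 1 1) $ 4 = h (axis 2 1) $ 3 - h (axis 3 1) $ 2"
    by (simp_all add: sum_4 axis_quat quat_eq_iff h(2))
  have e: "h v $ m = v$1 * h (axis 1 1) $ m + v$2 * h (axis 2 1) $ m + v$3 * h (axis 3 1) $ m + v$4 * h (axis 4 1) $ m" for v m
    using arg_cong[OF linear_R4_expand[OF h(1), of v], of "\<lambda>w. w $ m"] by (simp add: sum_4)
  show ?L
  proof (intro allI)
    fix x y z
    show "qmult (h x) y \<bullet> z + qmult (h y) z \<bullet> x + qmult (h z) x \<bullet> y = 0"
      unfolding inner_quat qmult_nth h(2) e[of x] e[of y] e[of z] R by (simp add: algebra_simps)
  qed
qed

context spinor
begin

abbreviation \<sigma> :: "'m \<Rightarrow> R4 \<Rightarrow> R4 \<Rightarrow> real" where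
  "\<sigma> \<equiv> sigma_form g J \<phi>"

lemma sigma_eq: "\<sigma> x v w = 1/4 * g x (J x (\<phi> x v)) (\<phi> x w)"
  by (simp add: sigma_form_def fund_form_def)

lemmas phi_simps = linear_add[OF linear_phi] linear_scale[OF linear_phi]

lemma sigma_skew: "\<sigma> x v w = - \<sigma> x w v"
  using g_sym[of x "J x (\<phi> x v)" "\<phi> x w"] by (simp add: sigma_eq g_J_left)

lemma two_form_sigma: "two_form \<A> \<sigma>"
  unfolding two_form_def smooth_bilinear_def
proof (intro conjI allI impI)
  show "bilinear (\<sigma> x)" for x
    by (simp add: bilinear_def linear_iff sigma_eq phi_simps J_simps algebra_simps)
  show "\<sigma> x v v = 0" for x v by (simp add: sigma_eq)
  show "smooth_fun \<A> U (\<lambda>x. \<sigma> x (X x) (Y x))" if "open U" "smooth_vf \<A> U X" "smooth_vf \<A> U Y" for U X Y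
    unfolding sigma_eq by (intro smooth_fun_mult smooth_fun_const smooth_g smooth_J smooth_phi that)
qed

lemma nondegenerate_sigma: "nondegenerate \<sigma>"
  unfolding nondegenerate_def
proof (intro allI impI)
  fix x v assume v: "\<forall>w. \<sigma> x v w = 0"
  define T where "T = u2_chart_at \<A> g J x"
  have T: "u2_chart \<A> g J T" "x \<in> fst T" using u2_chart_at T_def by auto
  let ?q = "qf T x" and ?y = "snd T x v"
  \<comment> \<open>Chosen so that multiplying by q gives |q|^2 times i q y; the pairing with
    \<open>v\<close> is then a positive multiple of a squared norm.\<close>
  let ?z = "qmult (qcnj ?q) (qmult qi (qmult ?q ?y))"
  have "\<sigma> x v (inv (snd T x) ?z) = 0" using v by blast
  then have "qmult qi (qmult ?q ?y) \<bullet> qmult ?q ?z = 0"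
    unfolding sigma_eq inner_u2[OF T, symmetric] u2_J[OF T] phi_u2[OF T] u2_inv[OF T] by simp
  then have "qmult qi (qmult ?q ?y) \<bullet> qmult qi (qmult ?q ?y) = 0"
    using qf_nonzero[OF T] by (simp add: qmult_qcnj qmult_scaleR_left flip: qmult_assoc[of ?q "qcnj ?q"])
  then have "qmult qi (qmult ?q ?y) = 0" by simp
  then have "?y = 0" using qf_nonzero[OF T] by (simp add: qmult_eq_0_iff quat_eq_iff[of qi])
  then show "v = 0" using inv_u2[OF T, of v] linear_0[OF linear_inv_u2[OF T]] by simp
qed

text \<open>Four times the covariant derivative of \<open>\<sigma>\<close>, obtained from the form
  \<langle>i q y, q z\<rangle> by replacing the derivative of q by \<open>b0\<close>.\<close>

definition psi :: "'m u2chart \<Rightarrow> 'm \<Rightarrow> R4 \<Rightarrow> R4 \<Rightarrow> R4 \<Rightarrow> real" where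
  "psi T x u v w = qmult qi (qmult (b0 T x u) (snd T x v)) \<bullet> qmult (qf T x) (snd T x w)
     + qmult qi (qmult (qf T x) (snd T x v)) \<bullet> qmult (b0 T x u) (snd T x w)"

lemma dir_deriv_sigma:
  assumes T: "u2_chart \<A> g J T" and V: "open V" "x \<in> V" "x \<in> fst T"
    and Y: "smooth_vf \<A> V Y" and Z: "smooth_vf \<A> V Z"
  shows "dir_deriv \<A> (\<lambda>y. \<sigma> y (Y y) (Z y)) x v =
    1/4 * psi T x v (Y x) (Z x) + \<sigma> x (nabla Y x v) (Z x) + \<sigma> x (Y x) (nabla Z x v)"
proof -
  let ?W = "V \<inter> fst T"
  have W: "open ?W" "x \<in> ?W" using V u2_open[OF T] by auto
  have f: "smooth_fun \<A> ?W (\<lambda>y. snd T y (\<phi> y (X y)))" if "smooth_vf \<A> V X" for X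
    by (rule smooth_u2[OF T V(1) smooth_phi[OF V(1) that]])
  have i: "bounded_linear (qmult qi)" using linear_qmult linear_conv_bounded_linear by blast
  have bl: "bounded_linear (\<lambda>r. 1/4 * r :: real)" by (rule bounded_linear_mult_right)
  note fi = smooth_fun_linear[OF i W(1) f[OF Y]]
  note ff = smooth_fun_inner[OF W(1) fi f[OF Z]]
  have "dir_deriv \<A> (\<lambda>y. \<sigma> y (Y y) (Z y)) x v =
    dir_deriv \<A> (\<lambda>y. 1/4 * (qmult qi (snd T y (\<phi> y (Y y))) \<bullet> snd T y (\<phi> y (Z y)))) x v"
    by (rule dir_deriv_cong[OF W _ smooth_fun_linear[OF bl W(1) ff]])
      (use u2_J[OF T] inner_u2[OF T] in \<open>simp add: sigma_eq flip: u2_J[OF T]\<close>)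
  also have "\<dots> = 1/4 * (qmult qi (snd T x (\<phi> x (Y x))) \<bullet> dir_deriv \<A> (\<lambda>y. snd T y (\<phi> y (Z y))) x v
      + qmult qi (dir_deriv \<A> (\<lambda>y. snd T y (\<phi> y (Y y))) x v) \<bullet> snd T x (\<phi> x (Z x)))"
    unfolding dir_deriv_linear[OF bl ff W(2)] dir_deriv_bilinear[OF bounded_bilinear_inner fi f[OF Z] W(2)]
      dir_deriv_linear[OF i f[OF Y] W(2)] ..
  finally have 1: "dir_deriv \<A> (\<lambda>y. \<sigma> y (Y y) (Z y)) x v =
    1/4 * (qmult qi (snd T x (\<phi> x (Y x))) \<bullet> dir_deriv \<A> (\<lambda>y. snd T y (\<phi> y (Z y))) x v
      + qmult qi (dir_deriv \<A> (\<lambda>y. snd T y (\<phi> y (Y y))) x v) \<bullet> snd T x (\<phi> x (Z x)))" .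
  define m a where "m = aminus T x v" and "a = aplus T x v $ 2"
  have d: "dir_deriv \<A> (\<lambda>y. snd T y (\<phi> y (X y))) x v =
      qmult (b0 T x v) (snd T x (X x)) - a *\<^sub>R qmult qi (qmult (qf T x) (snd T x (X x)))
      + qmult (qf T x) (snd T x (nabla X x v)) + qmult (qmult (qf T x) (snd T x (X x))) m"
    if X: "smooth_vf \<A> V X" for X
    unfolding dir_deriv_phi[OF T V(1) X V(2,3)] nabla_u2[OF T V(1) X V(2,3)] b0_def m_def a_def
    by (simp add: qmult_add_left qmult_add_right qmult_diff_left qmult_diff_right qmult_scaleR_left qmult_assoc)
  \<comment> \<open>Infinitesimal left multiplication by a multiple of i and right multiplication by
    an imaginary quaternion are skew and commute with left multiplication by i, so their
    contributions cancel.\<close>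
  have id: "qmult qi y \<bullet> (dz - a *\<^sub>R qmult qi z + nz + qmult z m) + qmult qi (dy - a *\<^sub>R qmult qi y + ny + qmult y m) \<bullet> z
     = (qmult qi dy \<bullet> z + qmult qi y \<bullet> dz) + qmult qi ny \<bullet> z + qmult qi y \<bullet> nz" if "m $ 1 = 0"
    for y z dy dz ny nz m :: quat and a
    using that by (simp add: inner_quat algebra_simps)
  have "m $ 1 = 0" by (simp add: m_def aminus_def)
  note id = id[OF this]
  show ?thesis
    unfolding 1 unfolding d[OF Y] d[OF Z] phi_u2[OF T V(3)] id psi_def sigma_eq inner_u2[OF T V(3), symmetric]
      u2_J[OF T V(3)]
    by (simp add: algebra_simps)
qed

text \<open>Coordinate fields commute, so vanishing torsion makes their covariant derivatives
  symmetric; with the skewness of \<open>\<sigma>\<close> these terms cancel in the cyclic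
  sum.\<close>

lemma ext_deriv_sigma:
  fixes x defines "T \<equiv> u2_chart_at \<A> g J x"
  shows "ext_deriv \<A> \<sigma> x u v w = 1/4 * (psi T x u v w + psi T x v w u + psi T x w u v)"
proof -
  have T: "u2_chart \<A> g J T" "x \<in> fst T" using u2_chart_at T_def by auto
  let ?c = "chart_at \<A> x" and ?X = "coord_field (chart_at \<A> x)"
  note c = chart_at[of x]
  have o: "open (cdom ?c)" using open_cdom[OF c(1)] .
  note X = smooth_coord_field[OF c(1)]
  have e: "frechet_derivative (\<lambda>q. form_coord \<A> ?c \<sigma> q v w) (at (coord ?c x)) u = dir_deriv \<A> (\<lambda>y. \<sigma> y (?X v y) (?X w y)) x u" for u v w
    unfolding dir_deriv_def form_coord_def coord_field_def Let_def comp_def ..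
  have vc: "vf_coord \<A> ?c (?X v) p = v" if "p \<in> coord ?c ` cdom ?c" for v p
    using that c by (auto simp: vf_coord_def coord_field_def)
  have "frechet_derivative (vf_coord \<A> ?c (?X v)) (at (coord ?c x)) = frechet_derivative (\<lambda>p. v) (at (coord ?c x))" for v
    by (rule frechet_derivative_cong_open(1)[OF open_coord_image[OF c(1) open_UNIV]])
      (use c vc[of _ v] in auto)
  then have "lie_bracket \<A> (?X v) (?X w) x = 0" for v w
    by (simp add: lie_bracket_def Let_def)
  then have sym: "nabla (?X w) x v = nabla (?X v) x w" for v w
    using nabla_torsion_free[OF o X X c(2), of v w] by simp
  have d: "dir_deriv \<A> (\<lambda>y. \<sigma> y (?X v y) (?X w y)) x u = 1/4 * psi T x u v w + \<sigma> x (nabla (?X v) x u) w + \<sigma> x v (nabla (?X w) x u)" for u v w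
    using dir_deriv_sigma[OF T(1) o c(2) T(2) X X] by simp
  show ?thesis
    unfolding ext_deriv_def Let_def e d
    using sym[of u v] sym[of v w] sym[of w u] sigma_skew[of x u "nabla (?X w) x v"]
      sigma_skew[of x v "nabla (?X w) x u"] sigma_skew[of x w "nabla (?X v) x u"]
    by (simp add: algebra_simps)
qed

text \<open>At each point closedness says that the trace for \<open>betaB\<close> vanishes, and the
  squared norm of that trace is the distance from \<open>betaB\<close> to
  \<open>betaD\<close>.\<close>

lemma closed_iff: "closed_form \<A> \<sigma> \<longleftrightarrow> (\<forall>x. betaB x = betaD x)"
proof -
  have "(\<forall>u v w. ext_deriv \<A> \<sigma> x u v w = 0) \<longleftrightarrow> betaB x = betaD x" for x
  proof -
    define T where "T = u2_chart_at \<A> g J x"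
    have T: "u2_chart \<A> g J T" "x \<in> fst T" using u2_chart_at T_def by auto
    note li = linear_inv_u2[OF T]
    define q where "q = qf T x"
    define b where "b p = b0 T x (inv (snd T x) p) + betaB x (inv (snd T x) p) *\<^sub>R qmult qi q" for p
    define h where "h p = qmult (qcnj q) (qmult qi (b p))" for p
    have q: "q \<noteq> 0" using qf_nonzero[OF T] q_def by simp
    have lB: "linear (betaB x)" and lD: "linear (betaD x)"
      using one_form_betaB one_form_betaD unfolding one_form_def by blast+
    note lb0 = linear_b0[OF T]
    have lb: "linear b"
      by (simp add: linear_iff b_def linear_add[OF li] linear_scale[OF li] linear_add[OF lb0] linear_scale[OF lb0]
          linear_add[OF lB] linear_scale[OF lB] algebra_simps)
    have lh: "linear h"
      by (simp add: linear_iff h_def linear_add[OF lb] linear_scale[OF lb] qmult_add_right qmult_scaleR_right)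
    have "b p \<bullet> qmult qi q = 0" for p
      using q unfolding b_def betaB_u2[OF T] q_def[symmetric]
      by (simp add: inner_diff_left inner_qmult_left inner_quat[of qi])
    \<comment> \<open>The real part of \<open>h p\<close> is \<langle>q, i b\<rangle> = - \<langle>i
      q, b\<rangle>, which is 0 for \<open>betaB\<close>.\<close>
    then have h1: "h p $ 1 = 0" for p
      by (simp add: h_def inner_quat algebra_simps)
    have psi: "psi T x u v w = 2 * (qmult (h (snd T x u)) (snd T x v) \<bullet> snd T x w)" for u v w
    proof -
      define \<beta> where "\<beta> = betaB x u"
      have b0: "b0 T x u = b (snd T x u) - \<beta> *\<^sub>R qmult qi q"
        by (simp add: b_def inv_u2[OF T] \<beta>_def)
      \<comment> \<open>Adding a multiple of i q to the derivative is an infinitesimal change of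
        phase of q, under which \<langle>i q y, q z\<rangle> is invariant. This permits replacing
        \<open>b0\<close> by \<open>b\<close>.\<close>
      have id1: "qmult qi (qmult (r - \<beta> *\<^sub>R qmult qi q) y) \<bullet> qmult q z + qmult qi (qmult q y) \<bullet> qmult (r - \<beta> *\<^sub>R qmult qi q) z
        = qmult qi (qmult r y) \<bullet> qmult q z + qmult qi (qmult q y) \<bullet> qmult r z" for r y z
      proof -
        have "qmult qi (qmult qi p) = - p" for p by (simp add: quat_eq_iff)
        moreover have "qmult qi p \<bullet> qmult qi p' = p \<bullet> p'" for p p' by (simp add: inner_quat)
        ultimately show ?thesis
          by (simp add: qmult_diff_left qmult_diff_right qmult_scaleR_left qmult_scaleR_right inner_diff_left
              inner_diff_right inner_add_left qmult_assoc)
      qed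
      \<comment> \<open>The adjoint of left multiplication by a quaternion is that by its conjugate.
        As \<open>h\<close> is imaginary, the second term of \<open>psi\<close> equals the first,
        hence the factor 2.\<close>
      have id2: "qmult qi (qmult r y) \<bullet> qmult q z = qmult (qmult (qcnj q) (qmult qi r)) y \<bullet> z" for r y z
        by (simp add: inner_quat algebra_simps)
      have id3: "qmult qi (qmult q y) \<bullet> qmult r z = - (qmult (qcnj (qmult (qcnj q) (qmult qi r))) y \<bullet> z)" for r y z
        by (simp add: inner_quat algebra_simps)
      have id4: "qmult (qcnj p) y \<bullet> z = - (qmult p y \<bullet> z)" if "p $ 1 = 0" for p y z
        using that by (simp add: inner_quat algebra_simps)
      show ?thesis
        unfolding psi_def q_def[symmetric] b0 unfolding id1 unfolding id2 id3 h_def[symmetric] id4[OF h1] by simp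
    qed
    have "(\<forall>u v w. ext_deriv \<A> \<sigma> x u v w = 0) \<longleftrightarrow>
      (\<forall>u v w. qmult (h (snd T x u)) (snd T x v) \<bullet> snd T x w + qmult (h (snd T x v)) (snd T x w) \<bullet> snd T x u
         + qmult (h (snd T x w)) (snd T x u) \<bullet> snd T x v = 0)"
    proof -
      have "1/4 * (2 * r + 2 * s + 2 * t) = 0 \<longleftrightarrow> r + s + t = 0" for r s t :: real by auto
      then show ?thesis unfolding ext_deriv_sigma T_def[symmetric] psi by simp
    qed
    also have "\<dots> \<longleftrightarrow> (\<forall>u v w. qmult (h u) v \<bullet> w + qmult (h v) w \<bullet> u + qmult (h w) u \<bullet> v = 0)"
      by (metis u2_inv[OF T])
    also have "\<dots> \<longleftrightarrow> (\<Sum>k\<in>UNIV. qmult (h (axis k 1)) (axis k 1)) = 0"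
      by (rule cyclic_sum_eq_0_iff[OF lh h1])
    also have "(\<Sum>k\<in>UNIV. qmult (h (axis k 1)) (axis k 1)) = qmult (qcnj q) (qmult qi (D_vec x (betaB x)))"
      by (simp add: h_def D_vec_def bk_def Let_def T_def[symmetric] q_def[symmetric] b_def[symmetric]
          qmult_assoc linear_sum[OF linear_qmult])
    also have "\<dots> = 0 \<longleftrightarrow> D_vec x (betaB x) = 0"
    proof -
      have "qcnj q \<noteq> 0" using q by (simp add: quat_eq_iff)
      moreover have "qi \<noteq> 0" by (simp add: quat_eq_iff)
      ultimately show ?thesis by (simp add: qmult_eq_0_iff)
    qed
    also have "\<dots> \<longleftrightarrow> dist2 x (betaB x) (betaD x) = 0"
      using D_norm_eq[of x "betaB x"] by (metis inner_eq_zero_iff)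
    also have "\<dots> \<longleftrightarrow> betaB x = betaD x"
      using dist2_eq_0[OF _ lB lD] by (auto simp: dist2_def Let_def)
    finally show ?thesis .
  qed
  then show ?thesis unfolding closed_form_def by blast
qed

lemma symplectic_iff: "symplectic \<A> \<sigma> \<longleftrightarrow> (\<forall>x. betaB x = betaD x)"
  unfolding symplectic_def using two_form_sigma nondegenerate_sigma closed_iff by blast

end


theorem mainTheorem4:
  fixes \<A> :: "'m::{t2_space, second_countable_topology} chart set"
    and g :: "'m \<Rightarrow> R4 \<Rightarrow> R4 \<Rightarrow> real"
    and J \<phi> :: "'m \<Rightarrow> R4 \<Rightarrow> R4"
    and nabla :: "'m tconn"
  assumes "oriented_smooth_atlas \<A>"
    and "riemannian_metric \<A> g"
    and "compatible_acs \<A> g J"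
    and "levi_civita \<A> g nabla"
    and "self_dual_spinor_field \<A> g \<phi>"
    and nowhere_zero: "\<And>x. \<phi> x \<noteq> (\<lambda>v. 0)"
  shows "symplectic \<A> (sigma_form g J \<phi>) \<longleftrightarrow>
    (\<exists>A. unitary_connection \<A> g J A \<and>
       minimizes \<A> g J (\<lambda>A x. tensor_norm (g x) (B_tensor \<A> g J nabla \<phi> A x)) A \<and>
       minimizes \<A> g J (\<lambda>A x. tensor_norm (g x) (Alt (B_tensor \<A> g J nabla \<phi> A x))) A \<and>
       minimizes \<A> g J (\<lambda>A x. tensor_norm (g x) (Sym (B_tensor \<A> g J nabla \<phi> A x))) A \<and>
       minimizes \<A> g J (\<lambda>A x. vec_norm (g x) (dirac_trace (g x) (B_tensor \<A> g J nabla \<phi> A x))) A)"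
proof -
  interpret spinor \<A> g J nabla \<phi>
    by unfold_locales (use assms in auto)
  note B = unitary_connection_kconn[OF one_form_betaB] and D = unitary_connection_kconn[OF one_form_betaD]
  have bB: "beta_of (kconn betaB) x = betaB x" and bD: "beta_of (kconn betaD) x = betaD x" for x
    using beta_of_kconn by blast+
  have d0: "dist2 x \<beta> \<beta> = 0" for x \<beta> by (simp add: dist2_def Let_def)
  note SD = S_norm_eq[of _ "beta_of _ _"] D_norm_eq
  show ?thesis
    unfolding symplectic_iff
  proof
    assume eq: "\<forall>x. betaB x = betaD x"
    show "\<exists>A. unitary_connection \<A> g J A \<and>
       minimizes \<A> g J (\<lambda>A x. tensor_norm (g x) (B_tensor \<A> g J nabla \<phi> A x)) A \<and>
       minimizes \<A> g J (\<lambda>A x. tensor_norm (g x) (Alt (B_tensor \<A> g J nabla \<phi> A x))) A \<and>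
       minimizes \<A> g J (\<lambda>A x. tensor_norm (g x) (Sym (B_tensor \<A> g J nabla \<phi> A x))) A \<and>
       minimizes \<A> g J (\<lambda>A x. vec_norm (g x) (dirac_trace (g x) (B_tensor \<A> g J nabla \<phi> A x))) A"
    \<comment> \<open>Where \<open>betaB\<close> and \<open>betaD\<close> agree, this one connection
      minimizes S and annihilates the trace.\<close>
    proof (intro exI[of _ "kconn betaB"] conjI B)
      show "minimizes \<A> g J (\<lambda>A x. tensor_norm (g x) (B_tensor \<A> g J nabla \<phi> A x)) (kconn betaB)"
        unfolding minimizes_def
      proof (intro allI impI)
        fix x A' assume A': "unitary_connection \<A> g J A'"
        show "tensor_norm (g x) (B_tensor \<A> g J nabla \<phi> (kconn betaB) x) \<le> tensor_norm (g x) (B_tensor \<A> g J nabla \<phi> A' x)"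
          unfolding spinor_tensor_norms(1)[OF A'] spinor_tensor_norms(1)[OF B] bB
          using S_norm_eq[of x "beta_of A' x"] dist2_nonneg[of x "beta_of A' x" "betaB x"] by simp
      qed
      show "minimizes \<A> g J (\<lambda>A x. tensor_norm (g x) (Alt (B_tensor \<A> g J nabla \<phi> A x))) (kconn betaB)"
        unfolding minimizes_def
      proof (intro allI impI)
        fix x A' assume A': "unitary_connection \<A> g J A'"
        show "tensor_norm (g x) (Alt (B_tensor \<A> g J nabla \<phi> (kconn betaB) x)) \<le> tensor_norm (g x) (Alt (B_tensor \<A> g J nabla \<phi> A' x))"
          unfolding spinor_tensor_norms(2)[OF A'] spinor_tensor_norms(2)[OF B] bB D_norm_eq eq[rule_format, symmetric] d0
          using S_norm_eq[of x "beta_of A' x"] dist2_nonneg[of x "beta_of A' x" "betaB x"] by simp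
      qed
      show "minimizes \<A> g J (\<lambda>A x. tensor_norm (g x) (Sym (B_tensor \<A> g J nabla \<phi> A x))) (kconn betaB)"
        unfolding minimizes_def
      proof (intro allI impI)
        fix x A' assume A': "unitary_connection \<A> g J A'"
        \<comment> \<open>The trace enters negatively, but both excesses are now the same
          \<open>dist2\<close>, so the squared norm grows by (3 - 1/2) times it.\<close>
        show "tensor_norm (g x) (Sym (B_tensor \<A> g J nabla \<phi> (kconn betaB) x)) \<le> tensor_norm (g x) (Sym (B_tensor \<A> g J nabla \<phi> A' x))"
          unfolding spinor_tensor_norms(3)[OF A'] spinor_tensor_norms(3)[OF B] bB D_norm_eq eq[rule_format, symmetric] d0
          using S_norm_eq[of x "beta_of A' x"] dist2_nonneg[of x "beta_of A' x" "betaB x"] by simp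
      qed
      show "minimizes \<A> g J (\<lambda>A x. vec_norm (g x) (dirac_trace (g x) (B_tensor \<A> g J nabla \<phi> A x))) (kconn betaB)"
        unfolding minimizes_def
      proof (intro allI impI)
        fix x A' assume A': "unitary_connection \<A> g J A'"
        show "vec_norm (g x) (dirac_trace (g x) (B_tensor \<A> g J nabla \<phi> (kconn betaB) x)) \<le> vec_norm (g x) (dirac_trace (g x) (B_tensor \<A> g J nabla \<phi> A' x))"
          unfolding spinor_tensor_norms(4)[OF A'] spinor_tensor_norms(4)[OF B] bB D_norm_eq eq[rule_format, symmetric] d0
          using dist2_nonneg by simp
      qed
    qed
  next
    assume "\<exists>A. unitary_connection \<A> g J A \<and>
       minimizes \<A> g J (\<lambda>A x. tensor_norm (g x) (B_tensor \<A> g J nabla \<phi> A x)) A \<and>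
       minimizes \<A> g J (\<lambda>A x. tensor_norm (g x) (Alt (B_tensor \<A> g J nabla \<phi> A x))) A \<and>
       minimizes \<A> g J (\<lambda>A x. tensor_norm (g x) (Sym (B_tensor \<A> g J nabla \<phi> A x))) A \<and>
       minimizes \<A> g J (\<lambda>A x. vec_norm (g x) (dirac_trace (g x) (B_tensor \<A> g J nabla \<phi> A x))) A"
    then obtain A where A: "unitary_connection \<A> g J A"
      and mB: "minimizes \<A> g J (\<lambda>A x. tensor_norm (g x) (B_tensor \<A> g J nabla \<phi> A x)) A"
      and mD: "minimizes \<A> g J (\<lambda>A x. vec_norm (g x) (dirac_trace (g x) (B_tensor \<A> g J nabla \<phi> A x))) A"
      by blast
    show "\<forall>x. betaB x = betaD x"
    proof
      fix x
      \<comment> \<open>Comparison with the two explicit global connections shows that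
        \<open>A\<close> attains the least possible values, so its form has distance 0 from both
        \<open>betaB\<close> and \<open>betaD\<close>.\<close>
      have "tensor_norm (g x) (B_tensor \<A> g J nabla \<phi> A x) \<le> tensor_norm (g x) (B_tensor \<A> g J nabla \<phi> (kconn betaB) x)"
        using mB B unfolding minimizes_def by blast
      then have "sqrt (4 * S_norm x (beta_of A x)) \<le> sqrt (4 * S_norm x (betaB x))"
        unfolding spinor_tensor_norms(1)[OF A] spinor_tensor_norms(1)[OF B] bB .
      then have dB: "dist2 x (beta_of A x) (betaB x) = 0"
        using S_norm_eq[of x "beta_of A x"] dist2_nonneg[of x "beta_of A x" "betaB x"] by simp
      have "vec_norm (g x) (dirac_trace (g x) (B_tensor \<A> g J nabla \<phi> A x))
        \<le> vec_norm (g x) (dirac_trace (g x) (B_tensor \<A> g J nabla \<phi> (kconn betaD) x))"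
        using mD D unfolding minimizes_def by blast
      then have "sqrt (D_vec x (beta_of A x) \<bullet> D_vec x (beta_of A x)) \<le> sqrt (D_vec x (betaD x) \<bullet> D_vec x (betaD x))"
        unfolding spinor_tensor_norms(4)[OF A] spinor_tensor_norms(4)[OF D] bD .
      then have dD: "dist2 x (beta_of A x) (betaD x) = 0"
        using dist2_nonneg[of x "beta_of A x" "betaD x"] unfolding D_norm_eq d0 by simp
      have lin: "linear (betaB x)" "linear (betaD x)" "linear (beta_of A x)"
        using one_form_betaB one_form_betaD linear_beta_of[OF A, of x] unfolding one_form_def by simp_all
      show "betaB x = betaD x"
        using dist2_eq_0[OF dB lin(3,1)] dist2_eq_0[OF dD lin(3,2)] by simp
    qed
  qed
qed

end
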